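(* Let $\varphi:(M^m,c_M,D^M)\to(N^n,c_N,D^N)$ be a horizontally conformal submersion with nowhere degenerate fibres between Weyl spaces, $\dim M=m$, $\dim N=n$. Then $$\operatorname{trace}_{c_M}(D\,\mathrm d\varphi)^{\flat}=(\mathscr H D^M)^{m-2}\otimes(D^N)^{-(n-2)}-(D^{\rm Bott})^{m-n},$$ where the right hand side is the difference of two partial connections on $L^{m-n}$, over $\mathscr H$, regarded as a section of $\mathscr H^*$.
   Context: Category: smooth, real analytic or complex analytic ($\mathbb K=\mathbb R,\mathbb R,\mathbb C$, respectively). Conformal manifold $(M^m,c)$: a reduction of the frame bundle to $CO(m,\mathbb K)=\{a: a^Ta=\rho_m(a)I_m,\ \rho_m(a)\in\mathbb K\setminus\{0\}\}$; equivalently a class of local metrics $g$ (local representatives), differing by nowhere zero (positive if $\mathbb K=\mathbb R$) function factors. $L^2$ is the line bundle associated to the bundle of conformal frames via $\rho_m$, and $L$ is a square root of it (canonical in the smooth and real analytic categories; local in the complex analytic one); $c$ is an $L^2$-valued metric and a local section $s$ of $L$ corresponds to the representative $g$ with $c=g\otimes s^2$. A Weyl connection on $(M,c)$ is a torsion free linear connection $D$ preserving $c$; $Dg=-2\alpha^g\otimes g$ and the Lee form $\alpha^g$ is the connection form, with respect to $s$, of the connection induced on $L$. A Weyl space is a conformal manifold with a Weyl connection. $\mathscr V=\ker\mathrm d\varphi$ (nondegenerate everywhere: "nowhere degenerate fibres"), $\mathscr H=\mathscr V^\perp$. Horizontally conformal: for local representatives $g,h$ of $c_M,c_N$, $\varphi^*h|_{\mathscr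 H}$ is a nowhere zero function multiple of $g|_{\mathscr H}$. The line bundles $L_{\mathscr V}^2$, $L_{\mathscr H}^2$ of $(\mathscr V,c_M|_{\mathscr V})$, $(\mathscr H,c_M|_{\mathscr H})$ are identified with $L^2$ (a local representative of $c_M$ induces ones of the restrictions). $D$ in $D\,\mathrm d\varphi$ is the connection on $\varphi^*(TN)\otimes T^*M$ induced by $D^M$, $D^N$, $\varphi$. As $\varphi^*(TN)=\mathscr H$, $\operatorname{trace}_{c_M}(D\,\mathrm d\varphi)$ is a section of $\mathscr H\otimes(L^* )^2$ and $\operatorname{trace}_{c_M}(D\,\mathrm d\varphi)^\flat$ is the corresponding section of $\mathscr H^*$ (equal to $g(\operatorname{trace}_g(D\,\mathrm d\varphi),\cdot)|_{\mathscr H}$ for any local representative $g$). A partial connection over $\mathscr H$ differentiates sections only in directions of $\mathscr H$. $D^M$ and $D^N$ induce conformal partial connections on $\mathscr H$, over $\mathscr H$: $(\mathscr HD^M)_XY=\mathscr H(D^M_XY)$, and the pull-back of $D^N$ via $\mathscr H=\varphi^*(TN)$, also denoted $D^N$. These induce partial connections on $L$ (the line bundle of $(\mathscr H,c_M|_{\mathscr H})$), over $\mathscr H$, denoted the same. The Bott partial connection on $\mathscr V$, over $\mathscr H$, is $D^{\rm Bott}_XU=\mathscr V[X,U]$ for sections $X$ of $\mathscr H$, $U$ of $\mathscr V$; as $(L^2)^{m-n}=(\Lambda^{m-n}\mathscr V)^2$ it induces a partial connection $D^{\rm Bott}$ on $L$, whose connection form with respect to $g$ is $\frac1{m-n}\operatorname{trace}_g(B^{\mathscr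 V})^\flat$, $B^{\mathscr V}(U,V)=\frac12\mathscr H(\nabla^g_UV+\nabla^g_VU)$. For a (partial) connection $D$ on $L$ and $k\in\mathbb Z$, $D^k$ denotes the induced (partial) connection on $L^k$ ($L^k=\otimes^{-k}L^*$ if $k<0$). *)

theory Defs
  imports "HOL-Analysis.Analysis" "HOL-Library.Function_Algebras"
begin

section \<open>The ground field and the categories\<close>

class real_or_complex = real_normed_field +
  assumes real_or_complex:
    "(\<forall>x. \<exists>r. x = r *\<^sub>R 1) \<or> (\<exists>i. i * i = -1 \<and> (\<forall>x. \<exists>a b. x = a *\<^sub>R 1 + b *\<^sub>R i))"

instance real :: real_or_complex
  by standard simp

instance complex :: real_or_complex
proof
  have "\<exists>a b. x = a *\<^sub>R 1 + b *\<^sub>R \<i>" for x :: complex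
    by (rule exI[of _ "Re x"], rule exI[of _ "Im x"]) (simp add: complex_eq_iff)
  then show "(\<forall>x::complex. \<exists>r. x = r *\<^sub>R 1) \<or>
      (\<exists>i::complex. i * i = -1 \<and> (\<forall>x. \<exists>a b. x = a *\<^sub>R 1 + b *\<^sub>R i))"
    by (intro disjI2 exI[of _ \<i>]) simp
qed

text \<open>Nowhere zero factors are required to be positive over the reals.\<close>

definition conformal_factor :: "'k::real_or_complex \<Rightarrow> bool" where
  "conformal_factor a \<longleftrightarrow> a \<noteq> 0 \<and> ((\<forall>x::'k. x \<in> \<real>) \<longrightarrow> (\<exists>r>0. a = of_real r))"

text \<open>Class \<open>C\<^sup>k\<close> over the ground field: the derivatives are linear over \<open>'k\<close>, so over the complex
  numbers every \<open>f\<close> with \<open>Ck (Suc k) U f\<close> is holomorphic.\<close>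

primrec Ck :: "nat \<Rightarrow> ('k::real_or_complex ^ 'm) set \<Rightarrow> ('k ^ 'm \<Rightarrow> 'k) \<Rightarrow> bool" where
  "Ck 0 U f \<longleftrightarrow> continuous_on U f"
| "Ck (Suc k) U f \<longleftrightarrow> (\<exists>f'. (\<forall>z\<in>U. (f has_derivative (\<lambda>v. \<Sum>i\<in>UNIV. v $ i * f' i z)) (at z)) \<and>
     (\<forall>i. Ck k U (f' i)))"

text \<open>\<open>Smooth\<close> over the reals is the smooth category, \<open>Analytic\<close> over the reals the real analytic
  one; over the complex numbers both are the complex analytic category.\<close>

datatype category = Smooth | Analytic

text \<open>The sum below is over all multi-indices. Convergent power series being smooth, the
  first conjunct is only needed in the smooth case.\<close>

definition regular :: "category \<Rightarrow> ('k::real_or_complex ^ 'm) set \<Rightarrow> ('k ^ 'm \<Rightarrow> 'k) \<Rightarrow> bool" where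
  "regular cat U f \<longleftrightarrow> (\<forall>k. Ck k U f) \<and>
     (cat = Analytic \<longrightarrow> (\<forall>p\<in>U. \<exists>r>0. \<exists>a :: ('m \<Rightarrow> nat) \<Rightarrow> 'k. ball p r \<subseteq> U \<and>
        (\<forall>z\<in>ball p r. ((\<lambda>\<alpha>. a \<alpha> * (\<Prod>i\<in>UNIV. (z $ i - p $ i) ^ \<alpha> i)) has_sum f z) UNIV)))"


section \<open>Manifolds\<close>

type_synonym ('a, 'k, 'm) chart = "'a set \<times> ('a \<Rightarrow> 'k ^ 'm)"

definition carrier :: "('a, 'k, 'm) chart set \<Rightarrow> 'a set" where
  "carrier \<A> = (\<Union>\<kappa>\<in>\<A>. fst \<kappa>)"

definition reg_on :: "category \<Rightarrow> ('a::topological_space, 'k::real_or_complex, 'm::finite) chart set \<Rightarrow>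
    'a set \<Rightarrow> ('a \<Rightarrow> 'k) \<Rightarrow> bool" where
  "reg_on cat \<A> W f \<longleftrightarrow> open W \<and> W \<subseteq> carrier \<A> \<and>
     (\<forall>(U, x)\<in>\<A>. regular cat (x ` (U \<inter> W)) (f \<circ> inv_into U x))"

definition smooth_at :: "('a::topological_space, 'k::real_or_complex, 'm::finite) chart set \<Rightarrow> 'a \<Rightarrow>
    ('a \<Rightarrow> 'k) \<Rightarrow> bool" where
  "smooth_at \<A> p f \<longleftrightarrow> (\<exists>W. p \<in> W \<and> reg_on Smooth \<A> W f)"

text \<open>The last conjunct says that the changes of coordinates are regular.\<close>

definition manifold :: "category \<Rightarrow> ('a::topological_space, 'k::real_or_complex, 'm::finite) chart set \<Rightarrow>
    bool" where
  "manifold cat \<A> \<longleftrightarrow>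
     (\<forall>(U, x)\<in>\<A>. open U \<and> open (x ` U) \<and> homeomorphism U (x ` U) x (inv_into U x)) \<and>
     (\<forall>(U, x)\<in>\<A>. \<forall>i. reg_on cat \<A> U (\<lambda>p. x p $ i))"

text \<open>Tangent vectors at \<open>p\<close> are the directional derivatives at \<open>p\<close>, acting on the functions which
  are smooth near \<open>p\<close>; they are extended by \<open>0\<close> to the other functions, so that equality of tangent
  vectors is equality of operators. Linear combinations, and also those of vector fields,
  are formed pointwise.\<close>

type_synonym ('a, 'k) tvec = "('a \<Rightarrow> 'k) \<Rightarrow> 'k"
type_synonym ('a, 'k) vfield = "'a \<Rightarrow> ('a, 'k) tvec"

definition tscale :: "'k::real_or_complex \<Rightarrow> ('a, 'k) tvec \<Rightarrow> ('a, 'k) tvec" (infixr "\<odot>" 75) where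
  "a \<odot> v = (\<lambda>f. a * v f)"

definition chart_vec :: "('a::topological_space, 'k::real_or_complex, 'm::finite) chart set \<Rightarrow>
    ('a, 'k, 'm) chart \<Rightarrow> 'a \<Rightarrow> 'k ^ 'm \<Rightarrow> ('a, 'k) tvec" where
  "chart_vec \<A> \<kappa> p a = (\<lambda>f. if smooth_at \<A> p f
     then frechet_derivative (f \<circ> inv_into (fst \<kappa>) (snd \<kappa>)) (at (snd \<kappa> p)) a else 0)"

definition tangent_space :: "('a::topological_space, 'k::real_or_complex, 'm::finite) chart set \<Rightarrow>
    'a \<Rightarrow> ('a, 'k) tvec set" where
  "tangent_space \<A> p = {chart_vec \<A> \<kappa> p a | \<kappa> a. \<kappa> \<in> \<A> \<and> p \<in> fst \<kappa>}"

definition coord_field :: "('a::topological_space, 'k::real_or_complex, 'm::finite) chart set \<Rightarrow>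
    ('a, 'k, 'm) chart \<Rightarrow> 'm \<Rightarrow> ('a, 'k) vfield" where
  "coord_field \<A> \<kappa> i p = chart_vec \<A> \<kappa> p (axis i 1)"

definition vfield_on :: "category \<Rightarrow> ('a::topological_space, 'k::real_or_complex, 'm::finite) chart set \<Rightarrow>
    'a set \<Rightarrow> ('a, 'k) vfield \<Rightarrow> bool" where
  "vfield_on cat \<A> W X \<longleftrightarrow> open W \<and> W \<subseteq> carrier \<A> \<and> (\<forall>p\<in>W. X p \<in> tangent_space \<A> p) \<and>
     (\<forall>(U, x)\<in>\<A>. \<forall>i. reg_on cat \<A> (W \<inter> U) (\<lambda>p. X p (\<lambda>q. x q $ i)))"

definition field_near :: "('a::topological_space, 'k::real_or_complex, 'm::finite) chart set \<Rightarrow> 'a \<Rightarrow>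
    ('a, 'k) vfield \<Rightarrow> bool" where
  "field_near \<A> p X \<longleftrightarrow> (\<exists>W. p \<in> W \<and> vfield_on Smooth \<A> W X)"

definition lie_bracket :: "('a::topological_space, 'k::real_or_complex, 'm::finite) chart set \<Rightarrow>
    ('a, 'k) vfield \<Rightarrow> ('a, 'k) vfield \<Rightarrow> ('a, 'k) vfield" where
  "lie_bracket \<A> X Y p = (\<lambda>f. if smooth_at \<A> p f then X p (\<lambda>q. Y q f) - Y p (\<lambda>q. X q f) else 0)"


section \<open>Weyl spaces\<close>

text \<open>\<open>D p x Y\<close> is the covariant derivative at \<open>p\<close>, in the direction \<open>x\<close> tangent at \<open>p\<close>, of the local
  vector field \<open>Y\<close>. Local sections are smooth ones in every category; the regularity of \<open>D\<close> in the
  category at hand is that of its Christoffel symbols.\<close>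

type_synonym ('a, 'k) conn = "'a \<Rightarrow> ('a, 'k) tvec \<Rightarrow> ('a, 'k) vfield \<Rightarrow> ('a, 'k) tvec"

definition linear_connection :: "category \<Rightarrow>
    ('a::topological_space, 'k::real_or_complex, 'm::finite) chart set \<Rightarrow> ('a, 'k) conn \<Rightarrow> bool" where
  "linear_connection cat \<A> D \<longleftrightarrow>
     (\<forall>p\<in>carrier \<A>. \<forall>x\<in>tangent_space \<A> p. \<forall>Y. field_near \<A> p Y \<longrightarrow>
        D p x Y \<in> tangent_space \<A> p \<and>
        (\<forall>x'\<in>tangent_space \<A> p. \<forall>a b. D p (a \<odot> x + b \<odot> x') Y = a \<odot> D p x Y + b \<odot> D p x' Y) \<and>
        (\<forall>Z. field_near \<A> p Z \<longrightarrow> D p x (Y + Z) = D p x Y + D p x Z) \<and>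
        (\<forall>f. smooth_at \<A> p f \<longrightarrow> D p x (\<lambda>q. f q \<odot> Y q) = x f \<odot> Y p + f p \<odot> D p x Y) \<and>
        (\<forall>W Z. open W \<and> p \<in> W \<and> (\<forall>q\<in>W. Z q = Y q) \<longrightarrow> D p x Z = D p x Y)) \<and>
     (\<forall>\<kappa>\<in>\<A>. \<forall>i j. vfield_on cat \<A> (fst \<kappa>) (\<lambda>p. D p (coord_field \<A> \<kappa> i p) (coord_field \<A> \<kappa> j)))"

definition torsion_free :: "('a::topological_space, 'k::real_or_complex, 'm::finite) chart set \<Rightarrow>
    ('a, 'k) conn \<Rightarrow> bool" where
  "torsion_free \<A> D \<longleftrightarrow> (\<forall>p\<in>carrier \<A>. \<forall>X Y. field_near \<A> p X \<and> field_near \<A> p Y \<longrightarrow>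
     D p (X p) Y - D p (Y p) X = lie_bracket \<A> X Y p)"

type_synonym ('a, 'k) metric = "'a \<Rightarrow> ('a, 'k) tvec \<Rightarrow> ('a, 'k) tvec \<Rightarrow> 'k"

definition orthonormal_frame :: "('a::topological_space, 'k::real_or_complex, 'm::finite) chart set \<Rightarrow>
    ('a, 'k) metric \<Rightarrow> 'a \<Rightarrow> ('m \<Rightarrow> ('a, 'k) tvec) \<Rightarrow> bool" where
  "orthonormal_frame \<A> g p e \<longleftrightarrow> (\<forall>i. e i \<in> tangent_space \<A> p) \<and>
     (\<forall>i j. g p (e i) (e j) = (if i = j then 1 else 0))"

text \<open>The existence of orthonormal frames, i.e. the reduction to \<open>O(m, 'k)\<close>, means that \<open>g\<close> is positive
  definite over the reals and nondegenerate over the complex numbers.\<close>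

definition local_metric :: "category \<Rightarrow> ('a::topological_space, 'k::real_or_complex, 'm::finite) chart set \<Rightarrow>
    'a set \<Rightarrow> ('a, 'k) metric \<Rightarrow> bool" where
  "local_metric cat \<A> W g \<longleftrightarrow> open W \<and> W \<subseteq> carrier \<A> \<and>
     (\<forall>p\<in>W. (\<forall>x\<in>tangent_space \<A> p. \<forall>y\<in>tangent_space \<A> p. g p x y = g p y x \<and>
          (\<forall>z\<in>tangent_space \<A> p. \<forall>a b. g p (a \<odot> x + b \<odot> y) z = a * g p x z + b * g p y z)) \<and>
        (\<exists>e. orthonormal_frame \<A> g p e)) \<and>
     (\<forall>\<kappa>\<in>\<A>. \<forall>i j. reg_on cat \<A> (W \<inter> fst \<kappa>) (\<lambda>p. g p (coord_field \<A> \<kappa> i p) (coord_field \<A> \<kappa> j p)))"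

definition conformal_on :: "category \<Rightarrow> ('a::topological_space, 'k::real_or_complex, 'm::finite) chart set \<Rightarrow>
    'a set \<Rightarrow> ('a, 'k) metric \<Rightarrow> ('a, 'k) metric \<Rightarrow> bool" where
  "conformal_on cat \<A> W g g' \<longleftrightarrow> (\<exists>\<mu>. reg_on cat \<A> W \<mu> \<and> (\<forall>p\<in>W. conformal_factor (\<mu> p) \<and>
     (\<forall>x\<in>tangent_space \<A> p. \<forall>y\<in>tangent_space \<A> p. g' p x y = \<mu> p * g p x y)))"

text \<open>A conformal structure is given by the class of all its local representatives.\<close>

definition conformal_structure :: "category \<Rightarrow>
    ('a::topological_space, 'k::real_or_complex, 'm::finite) chart set \<Rightarrow>
    ('a set \<times> ('a, 'k) metric) set \<Rightarrow> bool" where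
  "conformal_structure cat \<A> c \<longleftrightarrow> (\<Union>(W, g)\<in>c. W) = carrier \<A> \<and>
     c = {(W, g). local_metric cat \<A> W g \<and> (\<forall>(W', g')\<in>c. conformal_on cat \<A> (W \<inter> W') g g')}"

record ('a, 'k, 'm) weyl =
  atlas :: "('a, 'k, 'm) chart set"
  conf :: "('a set \<times> ('a, 'k) metric) set"
  conn :: "('a, 'k) conn"

abbreviation points :: "('a, 'k, 'm) weyl \<Rightarrow> 'a set" where
  "points M \<equiv> carrier (atlas M)"

abbreviation tangent :: "('a::topological_space, 'k::real_or_complex, 'm::finite) weyl \<Rightarrow> 'a \<Rightarrow>
    ('a, 'k) tvec set" where
  "tangent M \<equiv> tangent_space (atlas M)"

text \<open>The last conjunct is \<open>D g = -2 \<alpha> \<otimes> g\<close>, with \<open>a\<close> the value of the Lee form on \<open>x\<close>.\<close>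

definition weyl_space :: "category \<Rightarrow> ('a::topological_space, 'k::real_or_complex, 'm::finite) weyl \<Rightarrow>
    bool" where
  "weyl_space cat M \<longleftrightarrow> manifold cat (atlas M) \<and> conformal_structure cat (atlas M) (conf M) \<and>
     linear_connection cat (atlas M) (conn M) \<and> torsion_free (atlas M) (conn M) \<and>
     (\<forall>(W, g)\<in>conf M. \<forall>p\<in>W. \<forall>x\<in>tangent M p. \<exists>a. \<forall>Y Z.
        field_near (atlas M) p Y \<and> field_near (atlas M) p Z \<longrightarrow>
        x (\<lambda>q. g q (Y q) (Z q)) - g p (conn M p x Y) (Z p) - g p (Y p) (conn M p x Z)
          = - 2 * a * g p (Y p) (Z p))"


section \<open>Horizontally conformal submersions\<close>

definition differential :: "('b::topological_space, 'k::real_or_complex, 'n::finite) weyl \<Rightarrow> ('a \<Rightarrow> 'b) \<Rightarrow>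
    'a \<Rightarrow> ('a, 'k) tvec \<Rightarrow> ('b, 'k) tvec" where
  "differential N \<phi> p v = (\<lambda>f. if smooth_at (atlas N) (\<phi> p) f then v (f \<circ> \<phi>) else 0)"

definition submersion :: "category \<Rightarrow> ('a::topological_space, 'k::real_or_complex, 'm::finite) weyl \<Rightarrow>
    ('b::topological_space, 'k, 'n::finite) weyl \<Rightarrow> ('a \<Rightarrow> 'b) \<Rightarrow> bool" where
  "submersion cat M N \<phi> \<longleftrightarrow> continuous_on (points M) \<phi> \<and> \<phi> ` points M \<subseteq> points N \<and>
     (\<forall>(V, y)\<in>atlas N. \<forall>j. reg_on cat (atlas M) (points M \<inter> \<phi> -` V) (\<lambda>p. y (\<phi> p) $ j)) \<and>
     (\<forall>p\<in>points M. differential N \<phi> p ` tangent M p = tangent N (\<phi> p))"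

definition vertical :: "('a::topological_space, 'k::real_or_complex, 'm::finite) weyl \<Rightarrow>
    ('b::topological_space, 'k, 'n::finite) weyl \<Rightarrow> ('a \<Rightarrow> 'b) \<Rightarrow> 'a \<Rightarrow> ('a, 'k) tvec set" where
  "vertical M N \<phi> p = {u \<in> tangent M p. differential N \<phi> p u = 0}"

definition horizontal :: "('a::topological_space, 'k::real_or_complex, 'm::finite) weyl \<Rightarrow>
    ('b::topological_space, 'k, 'n::finite) weyl \<Rightarrow> ('a \<Rightarrow> 'b) \<Rightarrow> 'a \<Rightarrow> ('a, 'k) tvec set" where
  "horizontal M N \<phi> p = {x \<in> tangent M p. \<forall>(W, g)\<in>conf M. p \<in> W \<longrightarrow> (\<forall>u\<in>vertical M N \<phi> p. g p x u = 0)}"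

definition nowhere_degenerate_fibres :: "('a::topological_space, 'k::real_or_complex, 'm::finite) weyl \<Rightarrow>
    ('b::topological_space, 'k, 'n::finite) weyl \<Rightarrow> ('a \<Rightarrow> 'b) \<Rightarrow> bool" where
  "nowhere_degenerate_fibres M N \<phi> \<longleftrightarrow>
     (\<forall>(W, g)\<in>conf M. \<forall>p\<in>W. \<forall>u\<in>vertical M N \<phi> p. (\<forall>v\<in>vertical M N \<phi> p. g p u v = 0) \<longrightarrow> u = 0)"

definition horizontally_conformal :: "category \<Rightarrow>
    ('a::topological_space, 'k::real_or_complex, 'm::finite) weyl \<Rightarrow>
    ('b::topological_space, 'k, 'n::finite) weyl \<Rightarrow> ('a \<Rightarrow> 'b) \<Rightarrow> bool" where
  "horizontally_conformal cat M N \<phi> \<longleftrightarrow> (\<forall>(W, g)\<in>conf M. \<forall>(V, h)\<in>conf N.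
     \<exists>l. reg_on cat (atlas M) (W \<inter> \<phi> -` V) l \<and> (\<forall>p\<in>W \<inter> \<phi> -` V. l p \<noteq> 0 \<and>
       (\<forall>x\<in>horizontal M N \<phi> p. \<forall>y\<in>horizontal M N \<phi> p.
          h (\<phi> p) (differential N \<phi> p x) (differential N \<phi> p y) = l p * g p x y)))"

definition hpart :: "('a::topological_space, 'k::real_or_complex, 'm::finite) weyl \<Rightarrow>
    ('b::topological_space, 'k, 'n::finite) weyl \<Rightarrow> ('a \<Rightarrow> 'b) \<Rightarrow> 'a \<Rightarrow> ('a, 'k) tvec \<Rightarrow> ('a, 'k) tvec" where
  "hpart M N \<phi> p v = (THE x. x \<in> horizontal M N \<phi> p \<and> v - x \<in> vertical M N \<phi> p)"

definition vpart :: "('a::topological_space, 'k::real_or_complex, 'm::finite) weyl \<Rightarrow>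
    ('b::topological_space, 'k, 'n::finite) weyl \<Rightarrow> ('a \<Rightarrow> 'b) \<Rightarrow> 'a \<Rightarrow> ('a, 'k) tvec \<Rightarrow> ('a, 'k) tvec" where
  "vpart M N \<phi> p v = v - hpart M N \<phi> p v"

text \<open>The inverse of the isomorphism from the horizontal space at \<open>p\<close> onto the tangent space at \<open>\<phi> p\<close>.\<close>

definition hlift :: "('a::topological_space, 'k::real_or_complex, 'm::finite) weyl \<Rightarrow>
    ('b::topological_space, 'k, 'n::finite) weyl \<Rightarrow> ('a \<Rightarrow> 'b) \<Rightarrow> 'a \<Rightarrow> ('b, 'k) tvec \<Rightarrow> ('a, 'k) tvec" where
  "hlift M N \<phi> p w = (THE x. x \<in> horizontal M N \<phi> p \<and> differential N \<phi> p x = w)"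

definition hfield_near :: "('a::topological_space, 'k::real_or_complex, 'm::finite) weyl \<Rightarrow>
    ('b::topological_space, 'k, 'n::finite) weyl \<Rightarrow> ('a \<Rightarrow> 'b) \<Rightarrow> 'a \<Rightarrow> ('a, 'k) vfield \<Rightarrow> bool" where
  "hfield_near M N \<phi> p X \<longleftrightarrow>
     (\<exists>W. p \<in> W \<and> vfield_on Smooth (atlas M) W X \<and> (\<forall>q\<in>W. X q \<in> horizontal M N \<phi> q))"

definition vfield_near :: "('a::topological_space, 'k::real_or_complex, 'm::finite) weyl \<Rightarrow>
    ('b::topological_space, 'k, 'n::finite) weyl \<Rightarrow> ('a \<Rightarrow> 'b) \<Rightarrow> 'a \<Rightarrow> ('a, 'k) vfield \<Rightarrow> bool" where
  "vfield_near M N \<phi> p U \<longleftrightarrow>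
     (\<exists>W. p \<in> W \<and> vfield_on Smooth (atlas M) W U \<and> (\<forall>q\<in>W. U q \<in> vertical M N \<phi> q))"


section \<open>The trace of the second fundamental form\<close>

text \<open>The pull-back of \<open>D\<^sup>N\<close> by \<open>\<phi>\<close>, on sections \<open>\<sigma>\<close> of the pull-back of the tangent bundle of \<open>N\<close>.
  It is computed in the coordinate frame of some chart of \<open>N\<close>; the result is the same
  for all charts.\<close>

definition pullback_conn :: "('b::topological_space, 'k::real_or_complex, 'n::finite) weyl \<Rightarrow>
    ('a \<Rightarrow> 'b) \<Rightarrow> 'a \<Rightarrow> ('a, 'k) tvec \<Rightarrow> ('a \<Rightarrow> ('b, 'k) tvec) \<Rightarrow> ('b, 'k) tvec" where
  "pullback_conn N \<phi> p x \<sigma> =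
     (let \<kappa> = (SOME \<kappa>. \<kappa> \<in> atlas N \<and> \<phi> p \<in> fst \<kappa>); s = (\<lambda>j q. \<sigma> q (\<lambda>r. snd \<kappa> r $ j)) in
      \<Sum>j\<in>UNIV. x (s j) \<odot> coord_field (atlas N) \<kappa> j (\<phi> p) +
        s j p \<odot> conn N (\<phi> p) (differential N \<phi> p x) (coord_field (atlas N) \<kappa> j))"

text \<open>\<open>(D d\<phi>)(x, y)\<close>, for \<open>x\<close> and \<open>y\<close> tangent at \<open>p\<close>.\<close>

definition D_differential :: "('a::topological_space, 'k::real_or_complex, 'm::finite) weyl \<Rightarrow>
    ('b::topological_space, 'k, 'n::finite) weyl \<Rightarrow> ('a \<Rightarrow> 'b) \<Rightarrow> 'a \<Rightarrow> ('a, 'k) tvec \<Rightarrow> ('a, 'k) tvec \<Rightarrow>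
    ('b, 'k) tvec" where
  "D_differential M N \<phi> p x y = (THE w. \<forall>Y. field_near (atlas M) p Y \<and> Y p = y \<longrightarrow>
     w = pullback_conn N \<phi> p x (\<lambda>q. differential N \<phi> q (Y q)) - differential N \<phi> p (conn M p x Y))"

definition trace_D_differential :: "('a::topological_space, 'k::real_or_complex, 'm::finite) weyl \<Rightarrow>
    ('b::topological_space, 'k, 'n::finite) weyl \<Rightarrow> ('a \<Rightarrow> 'b) \<Rightarrow> ('a, 'k) metric \<Rightarrow> 'a \<Rightarrow> ('b, 'k) tvec" where
  "trace_D_differential M N \<phi> g p = (THE w. \<forall>e. orthonormal_frame (atlas M) g p e \<longrightarrow>
     w = (\<Sum>i\<in>UNIV. D_differential M N \<phi> p (e i) (e i)))"

definition trace_D_differential_flat :: "('a::topological_space, 'k::real_or_complex, 'm::finite) weyl \<Rightarrow>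
    ('b::topological_space, 'k, 'n::finite) weyl \<Rightarrow> ('a \<Rightarrow> 'b) \<Rightarrow> ('a, 'k) metric \<Rightarrow> 'a \<Rightarrow> ('a, 'k) tvec \<Rightarrow> 'k" where
  "trace_D_differential_flat M N \<phi> g p x = g p (hlift M N \<phi> p (trace_D_differential M N \<phi> g p)) x"


section \<open>Partial connections on the powers of \<open>L\<close>, over the horizontal distribution\<close>

text \<open>A partial connection on \<open>L\<^sup>k\<close> is given by its connection forms: \<open>A g\<close> is the one
  with respect to the section \<open>s\<^sup>k\<close>, where \<open>s\<close> is the local section of \<open>L\<close> corresponding to the
  representative \<open>g\<close>. As \<open>-s\<close> leads to the same form, this does not depend on the choice of the
  square root, and makes sense also if \<open>L\<close> exists only locally. If \<open>g' = \<mu> g\<close> then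
  \<open>s' = \<lambda> s\<close> with \<open>\<mu> = \<lambda>\<^sup>-\<^sup>2\<close>, and \<open>k d(log \<lambda>)\<close> is the difference of the connection forms;
  \<open>connection_forms_on_L_power\<close> is the algebraic condition of being such a family of linear
  forms (it contains no differentiability).\<close>

type_synonym ('a, 'k) conn_forms = "('a, 'k) metric \<Rightarrow> 'a \<Rightarrow> ('a, 'k) tvec \<Rightarrow> 'k"

definition connection_forms_on_L_power :: "int \<Rightarrow>
    ('a::topological_space, 'k::real_or_complex, 'm::finite) weyl \<Rightarrow>
    ('b::topological_space, 'k, 'n::finite) weyl \<Rightarrow> ('a \<Rightarrow> 'b) \<Rightarrow> ('a, 'k) conn_forms \<Rightarrow> bool" where
  "connection_forms_on_L_power k M N \<phi> A \<longleftrightarrow> (\<forall>(W, g)\<in>conf M. \<forall>p\<in>W.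
     (\<forall>x\<in>horizontal M N \<phi> p. \<forall>y\<in>horizontal M N \<phi> p. \<forall>a b.
        A g p (a \<odot> x + b \<odot> y) = a * A g p x + b * A g p y) \<and>
     (\<forall>(W', g')\<in>conf M. \<forall>\<mu> O'. p \<in> O' \<and> O' \<subseteq> W \<inter> W' \<and> reg_on Smooth (atlas M) O' \<mu> \<and>
        (\<forall>q\<in>O'. \<forall>x\<in>tangent M q. \<forall>y\<in>tangent M q. g' q x y = \<mu> q * g q x y) \<longrightarrow>
        (\<forall>x\<in>horizontal M N \<phi> p. A g' p x = A g p x - of_int k / 2 * (x \<mu> / \<mu> p))))"

definition conn_power :: "('a, 'k::real_or_complex) conn_forms \<Rightarrow> int \<Rightarrow> ('a, 'k) conn_forms"
    (infixr "^\<^sub>L" 80) where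
  "A ^\<^sub>L k = (\<lambda>g p x. of_int k * A g p x)"

definition conn_tensor :: "('a, 'k::real_or_complex) conn_forms \<Rightarrow> ('a, 'k) conn_forms \<Rightarrow>
    ('a, 'k) conn_forms" (infixl "\<otimes>\<^sub>L" 70) where
  "A \<otimes>\<^sub>L B = (\<lambda>g p x. A g p x + B g p x)"

text \<open>The partial connection on \<open>L\<close> induced by a conformal partial connection \<open>P\<close> on the
  horizontal distribution: the form \<open>\<alpha>\<close> with \<open>P g = -2 \<alpha> \<otimes> g\<close> on horizontal vectors.\<close>

definition induced_on_L :: "('a::topological_space, 'k::real_or_complex, 'm::finite) weyl \<Rightarrow>
    ('b::topological_space, 'k, 'n::finite) weyl \<Rightarrow> ('a \<Rightarrow> 'b) \<Rightarrow> ('a, 'k) conn \<Rightarrow> ('a, 'k) conn_forms" where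
  "induced_on_L M N \<phi> P g p x = (THE a. \<forall>Y Z. hfield_near M N \<phi> p Y \<and> hfield_near M N \<phi> p Z \<longrightarrow>
     x (\<lambda>q. g q (Y q) (Z q)) - g p (P p x Y) (Z p) - g p (Y p) (P p x Z) = - 2 * a * g p (Y p) (Z p))"

definition HDM :: "('a::topological_space, 'k::real_or_complex, 'm::finite) weyl \<Rightarrow>
    ('b::topological_space, 'k, 'n::finite) weyl \<Rightarrow> ('a \<Rightarrow> 'b) \<Rightarrow> ('a, 'k) conn" where
  "HDM M N \<phi> p x Y = hpart M N \<phi> p (conn M p x Y)"

definition HDN :: "('a::topological_space, 'k::real_or_complex, 'm::finite) weyl \<Rightarrow>
    ('b::topological_space, 'k, 'n::finite) weyl \<Rightarrow> ('a \<Rightarrow> 'b) \<Rightarrow> ('a, 'k) conn" where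
  "HDN M N \<phi> p x Y = hlift M N \<phi> p (pullback_conn N \<phi> p x (\<lambda>q. differential N \<phi> q (Y q)))"

definition bott :: "('a::topological_space, 'k::real_or_complex, 'm::finite) weyl \<Rightarrow>
    ('b::topological_space, 'k, 'n::finite) weyl \<Rightarrow> ('a \<Rightarrow> 'b) \<Rightarrow> ('a, 'k) vfield \<Rightarrow> ('a, 'k) vfield \<Rightarrow>
    ('a, 'k) vfield" where
  "bott M N \<phi> X U p = vpart M N \<phi> p (lie_bracket (atlas M) X U p)"

definition gram_det :: "('a, 'k::real_or_complex) metric \<Rightarrow> nat \<Rightarrow> (nat \<Rightarrow> ('a, 'k) vfield) \<Rightarrow> 'a \<Rightarrow> 'k" where
  "gram_det g r U q = (\<Sum>\<pi> | \<pi> permutes {..<r}. of_int (sign \<pi>) * (\<Prod>i<r. g q (U i q) (U (\<pi> i) q)))"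

text \<open>For a local frame \<open>U\<^sub>0, \<dots>, U\<^sub>r\<^sub>-\<^sub>1\<close> of the vertical distribution, \<open>r = m - n\<close>, let
  \<open>u = U\<^sub>0 \<and> \<dots> \<and> U\<^sub>r\<^sub>-\<^sub>1\<close>. If \<open>\<omega>\<close> is the matrix of the Bott partial connection in this
  frame then \<open>D u = (trace \<omega>) u\<close>. The identification of the square of the top exterior power with
  \<open>L\<^sup>2\<^sup>r\<close> sends \<open>u \<otimes> u\<close> to \<open>d s\<^sup>2\<^sup>r\<close>, where \<open>d = det (g (U\<^sub>i, U\<^sub>j))\<close>. Hence the induced
  connection form \<open>b\<close> on \<open>L\<^sup>r\<close> satisfies \<open>d(d) + 2 b d = 2 (trace \<omega>) d\<close>.\<close>

definition bott_on_L_power :: "('a::topological_space, 'k::real_or_complex, 'm::finite) weyl \<Rightarrow>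
    ('b::topological_space, 'k, 'n::finite) weyl \<Rightarrow> ('a \<Rightarrow> 'b) \<Rightarrow> ('a, 'k) conn_forms" where
  "bott_on_L_power M N \<phi> g p x = (let r = CARD('m) - CARD('n) in
     THE b. \<forall>X U \<omega>. hfield_near M N \<phi> p X \<and> X p = x \<and>
       (\<forall>i<r. vfield_near M N \<phi> p (U i)) \<and>
       (\<forall>a. (\<Sum>i<r. a i \<odot> U i p) = 0 \<longrightarrow> (\<forall>i<r. a i = 0)) \<and>
       (\<forall>i<r. bott M N \<phi> X (U i) p = (\<Sum>j<r. \<omega> i j \<odot> U j p)) \<longrightarrow>
       x (gram_det g r U) + 2 * b * gram_det g r U p = 2 * (\<Sum>i<r. \<omega> i i) * gram_det g r U p)"

text \<open>If \<open>m = n\<close> then this is \<open>0\<close>; only its power \<open>0\<close> is relevant in this case.\<close>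

definition bott_on_L :: "('a::topological_space, 'k::real_or_complex, 'm::finite) weyl \<Rightarrow>
    ('b::topological_space, 'k, 'n::finite) weyl \<Rightarrow> ('a \<Rightarrow> 'b) \<Rightarrow> ('a, 'k) conn_forms" where
  "bott_on_L M N \<phi> g p x = bott_on_L_power M N \<phi> g p x / of_nat (CARD('m) - CARD('n))"

end

theory Submission
  imports Defs
begin

text \<open>On horizontal vectors, \<open>Q(X,Y) = D\<^sup>N\<^sub>X Y - \<H>(D\<^sup>M\<^sub>X Y)\<close> represents \<open>D d\<phi>\<close>. It is symmetric
  because \<open>D\<^sup>M\<close> and \<open>D\<^sup>N\<close> are torsion free, and \<open>g(Q(X,Y),Z) + g(Y,Q(X,Z)) = 2 \<beta>(X) g(Y,Z)\<close> with
  \<open>\<beta> = \<alpha>\<^sup>N - \<alpha>\<^sup>M\<close> because both are conformal; hence its trace over \<open>\<H>\<close> is \<open>(2 - n) \<beta>\<close>.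
  On vertical vectors, \<open>D d\<phi>(U,U) = - d\<phi>(D\<^sup>M\<^sub>U U)\<close>. On the other hand, Jacobi's formula for the Gram
  determinant of a vertical frame and \<open>D\<^sup>M\<^sub>X U = [X,U] + D\<^sup>M\<^sub>U X\<close> show that the Bott form on
  \<open>L\<^sup>m\<^sup>-\<^sup>n\<close> is \<open>(m - n) \<alpha>\<^sup>M(X)\<close> plus the vertical trace of \<open>g(D\<^sup>M\<^sub>U U, X)\<close>. As the trace of
  \<open>D d\<phi>\<close> is a conformally invariant linear form, the formula also yields the behaviour of the Bott
  form under changes of the representative.\<close>


section \<open>Calculus over the ground field\<close>

text \<open>\<open>orthonormal_frame\<close> provides frames of the whole tangent space, which need
  not be adapted to the splitting into horizontal and vertical vectors, and over the complex numbers
  isotropic vectors obstruct a direct orthogonalisation. Partial traces are therefore formed with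
  the projections of an arbitrary frame: self-adjointness of the projections makes the mixed terms
  cancel, and n enters as the trace of the horizontal projection. The factor 2 - n comes from
  polarisation. Conformality with the arguments (e, e, x) and (x, e, e), together with the symmetry
  of Q, gives g(Q(e,e),x) = 2 \<beta>(e) g(e,x) - \<beta>(x) g(e,e), and the two terms contract to 2
  \<beta>(x) and n \<beta>(x). The other obstacle is that the objects of the statement are definite
  descriptions quantified over local fields or frames. For each of them a value must be found that
  serves all choices at once, and its uniqueness requires enough smooth horizontal and vertical
  fields with prescribed values at a point.\<close>

definition pd :: "'m \<Rightarrow> ('k::real_or_complex ^ 'm::finite \<Rightarrow> 'k) \<Rightarrow> 'k ^ 'm \<Rightarrow> 'k" where
  "pd i f z = frechet_derivative f (at z) (axis i 1)"

lemma sum_axis_mult: "(\<Sum>i\<in>UNIV. axis j (1::'k::comm_semiring_1) $ i * c i) = c (j::'m::finite)"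
  by (simp add: axis_def if_distrib[of "\<lambda>t. t * _"] cong: if_cong)

lemma pd_unique:
  assumes "(f has_derivative (\<lambda>v. \<Sum>i\<in>UNIV. v $ i * c i)) (at z)"
  shows "pd i f z = c i"
  unfolding pd_def frechet_derivative_at[OF assms, symmetric] by (rule sum_axis_mult)

lemma has_derivative_cong_open:
  assumes "open U" "z \<in> U" "\<And>z. z \<in> U \<Longrightarrow> f z = g z"
  shows "(f has_derivative D) (at z) \<longleftrightarrow> (g has_derivative D) (at z)"
  using has_derivative_transform_within_open[of f D z UNIV U g]
    has_derivative_transform_within_open[of g D z UNIV U f] assms by auto

lemma Ck_cong:
  assumes "open U" "\<And>z. z \<in> U \<Longrightarrow> f z = g z"
  shows "Ck k U f \<longleftrightarrow> Ck k U g"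
proof (cases k)
  case 0
  then show ?thesis using assms by (simp cong: continuous_on_cong)
next
  case (Suc l)
  have "\<And>D z. z \<in> U \<Longrightarrow> (f has_derivative D) (at z) \<longleftrightarrow> (g has_derivative D) (at z)"
    using has_derivative_cong_open assms by blast
  then show ?thesis unfolding Suc Ck.simps by simp
qed

text \<open>Derivatives are unique, so on \<open>U\<close> any witness in the definition of
  \<open>Ck\<close> agrees with \<open>pd i f\<close>; openness lets \<open>Ck_cong\<close> carry
  the regularity over.\<close>

lemma Ck_Suc_iff:
  assumes "open U"
  shows "Ck (Suc k) U f \<longleftrightarrow>
    (\<forall>z\<in>U. (f has_derivative (\<lambda>v. \<Sum>i\<in>UNIV. v $ i * pd i f z)) (at z)) \<and> (\<forall>i. Ck k U (pd i f))"
    (is "?L \<longleftrightarrow> ?R")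
proof
  assume ?L
  then obtain f' where f': "\<forall>z\<in>U. (f has_derivative (\<lambda>v. \<Sum>i\<in>UNIV. v $ i * f' i z)) (at z)"
    "\<forall>i. Ck k U (f' i)" by auto
  have eq: "pd i f z = f' i z" if "z \<in> U" for i z
    using pd_unique f' that by fastforce
  show ?R
    using f' eq Ck_cong[OF assms, of "pd i f" "f' i" k for i] by simp
next
  assume ?R
  then show ?L by auto
qed

lemma Ck_Suc_D: "Ck (Suc k) U f \<Longrightarrow> Ck k U f"
proof (induction k arbitrary: f)
  case 0
  then have "\<forall>z\<in>U. isCont f z" using has_derivative_continuous by fastforce
  then show ?case by (simp add: continuous_at_imp_continuous_on)
next
  case (Suc k)
  from Suc.prems[unfolded Ck.simps(2)[of "Suc k"]] Suc.IH show ?case unfolding Ck.simps(2)[of k] by blast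
qed

lemma Ck_subset: "Ck k U f \<Longrightarrow> V \<subseteq> U \<Longrightarrow> Ck k V f"
proof (induction k arbitrary: f)
  case 0
  then show ?case by (auto intro: continuous_on_subset)
next
  case (Suc k)
  then show ?case unfolding Ck.simps by blast
qed

text \<open>With \<open>pd\<close> as canonical witness, the derivatives found on the various
  neighbourhoods glue automatically.\<close>

lemma Ck_local:
  assumes "open U" "\<And>z. z \<in> U \<Longrightarrow> \<exists>V. open V \<and> z \<in> V \<and> V \<subseteq> U \<and> Ck k V f"
  shows "Ck k U f"
  using assms(2)
proof (induction k arbitrary: f)
  case 0
  then have "\<forall>z\<in>U. isCont f z" using continuous_on_eq_continuous_at by (metis Ck.simps(1))
  then show ?case by (simp add: continuous_at_imp_continuous_on)
next
  case (Suc k)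
  have V: "\<exists>V. open V \<and> z \<in> V \<and> V \<subseteq> U \<and>
      (f has_derivative (\<lambda>v. \<Sum>i\<in>UNIV. v $ i * pd i f z)) (at z) \<and> (\<forall>i. Ck k V (pd i f))"
    if "z \<in> U" for z
  proof -
    from Suc.prems[OF that] obtain V where "open V" "z \<in> V" "V \<subseteq> U" "Ck (Suc k) V f" by blast
    with Ck_Suc_iff[of V k f] show ?thesis by blast
  qed
  have "Ck k U (pd i f)" for i
    by (rule Suc.IH) (use V in blast)
  with V show ?case unfolding Ck_Suc_iff[OF assms(1)] by blast
qed

lemma Ck_const: "Ck k U (\<lambda>z. c)"
proof (induction k arbitrary: c)
  case (Suc k)
  show ?case unfolding Ck.simps by (rule exI[of _ "\<lambda>i z. 0"]) (simp add: Suc)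
qed simp

lemma Ck_coord: "Ck k U (\<lambda>z::'k::real_or_complex ^ 'm::finite. z $ i)"
proof (cases k)
  case 0
  then show ?thesis by (simp add: continuous_on_component)
next
  case (Suc l)
  have "((\<lambda>z::'k ^ 'm. z $ i) has_derivative (\<lambda>v. \<Sum>j\<in>UNIV. v $ j * (if j = i then 1 else 0))) (at z)" for z
    using bounded_linear_imp_has_derivative[OF bounded_linear_vec_nth[of i], of "at z"]
    by (simp add: if_distrib[of "\<lambda>t. _ * t"] cong: if_cong)
  then show ?thesis unfolding Suc Ck.simps
    by (intro exI[of _ "\<lambda>j z. if j = i then 1 else 0"]) (auto simp: Ck_const)
qed

lemma Ck_add:
  assumes "Ck k U f" "Ck k U g"
  shows "Ck k U (\<lambda>z. f z + g z)"
  using assms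
proof (induction k arbitrary: f g)
  case 0
  then show ?case by (simp add: continuous_on_add)
next
  case (Suc k)
  then obtain f' g' where *: "\<forall>z\<in>U. (f has_derivative (\<lambda>v. \<Sum>i\<in>UNIV. v $ i * f' i z)) (at z)"
    "\<forall>i. Ck k U (f' i)" "\<forall>z\<in>U. (g has_derivative (\<lambda>v. \<Sum>i\<in>UNIV. v $ i * g' i z)) (at z)"
    "\<forall>i. Ck k U (g' i)" by auto
  have "((\<lambda>z. f z + g z) has_derivative (\<lambda>v. \<Sum>i\<in>UNIV. v $ i * (f' i z + g' i z))) (at z)"
    if "z \<in> U" for z
    using has_derivative_add[OF *(1)[rule_format, OF that] *(3)[rule_format, OF that]]
    by (simp add: sum.distrib distrib_left)
  then show ?case unfolding Ck.simps
    by (intro exI[of _ "\<lambda>i z. f' i z + g' i z"]) (use * Suc.IH in auto)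
qed

lemma Ck_mult:
  assumes "Ck k U f" "Ck k U g"
  shows "Ck k U (\<lambda>z. f z * g z)"
  using assms
proof (induction k arbitrary: f g)
  case 0
  then show ?case by (simp add: continuous_on_mult)
next
  case (Suc k)
  then obtain f' g' where *: "\<forall>z\<in>U. (f has_derivative (\<lambda>v. \<Sum>i\<in>UNIV. v $ i * f' i z)) (at z)"
    "\<forall>i. Ck k U (f' i)" "\<forall>z\<in>U. (g has_derivative (\<lambda>v. \<Sum>i\<in>UNIV. v $ i * g' i z)) (at z)"
    "\<forall>i. Ck k U (g' i)" by auto
  have "((\<lambda>z. f z * g z) has_derivative (\<lambda>v. \<Sum>i\<in>UNIV. v $ i * (f z * g' i z + f' i z * g z))) (at z)"
    if "z \<in> U" for z
    using has_derivative_mult[OF *(1)[rule_format, OF that] *(3)[rule_format, OF that]]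
    by (simp add: sum.distrib algebra_simps sum_distrib_left sum_distrib_right)
  \<comment> \<open>The product rule keeps the undifferentiated factors, which are needed one order
    lower.\<close>
  moreover have "Ck k U f" "Ck k U g" using Suc.prems Ck_Suc_D by blast+
  ultimately show ?case unfolding Ck.simps
    by (intro exI[of _ "\<lambda>i z. f z * g' i z + f' i z * g z"] conjI ballI allI Ck_add Suc.IH)
      (use * in blast)+
qed

lemma Ck_inverse:
  assumes "Ck k U f" "\<And>z. z \<in> U \<Longrightarrow> f z \<noteq> 0"
  shows "Ck k U (\<lambda>z. inverse (f z))"
  using assms
proof (induction k arbitrary: f)
  case 0
  then show ?case by (simp add: continuous_on_inverse)
next
  case (Suc k)
  then obtain f' where *: "\<forall>z\<in>U. (f has_derivative (\<lambda>v. \<Sum>i\<in>UNIV. v $ i * f' i z)) (at z)"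
    "\<forall>i. Ck k U (f' i)" by auto
  have "((\<lambda>z. inverse (f z)) has_derivative
      (\<lambda>v. \<Sum>i\<in>UNIV. v $ i * ((- 1) * (f' i z * (inverse (f z) * inverse (f z)))))) (at z)"
    if "z \<in> U" for z
    using Deriv.has_derivative_inverse[OF Suc.prems(2)[OF that] *(1)[rule_format, OF that]]
    by (simp add: sum_negf algebra_simps sum_distrib_left sum_distrib_right)
  moreover have "Ck k U (\<lambda>z. inverse (f z))"
    using Suc Ck_Suc_D by blast
  ultimately show ?case unfolding Ck.simps
    by (intro exI[of _ "\<lambda>i z. (- 1) * (f' i z * (inverse (f z) * inverse (f z)))"]
      conjI ballI allI Ck_mult Ck_const) (use * in blast)+
qed

lemma Ck_sum: "finite I \<Longrightarrow> (\<And>i. i \<in> I \<Longrightarrow> Ck k U (f i)) \<Longrightarrow> Ck k U (\<lambda>z. \<Sum>i\<in>I. f i z)"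
  by (induction I rule: finite_induct) (auto intro: Ck_add Ck_const)

section \<open>The chain rule in components\<close>

lemma bounded_linear_axis: "bounded_linear (axis i :: 'k::real_normed_field \<Rightarrow> 'k ^ 'm::finite)"
proof (rule bounded_linear_intro[where K = 1])
  fix x :: 'k
  have "norm (axis i x :: 'k ^ 'm) \<le> (\<Sum>j\<in>UNIV. norm ((axis i x :: 'k ^ 'm) $ j))"
    unfolding norm_vec_def by (rule L2_set_le_sum) simp
  also have "\<dots> = norm x * 1" by (simp add: axis_def if_distrib[of norm] cong: if_cong)
  finally show "norm (axis i x :: 'k ^ 'm) \<le> norm x * 1" .
qed (simp_all add: axis_def vec_eq_iff)

text \<open>\<open>T z\<close> is the sum of the vectors \<open>axis j (T z $ j)\<close>, and each
  \<open>axis j\<close> is bounded linear over the reals.\<close>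

lemma has_derivative_vecI:
  fixes T :: "'b::real_normed_vector \<Rightarrow> 'k::real_normed_field ^ 'm::finite"
  assumes "\<And>j. ((\<lambda>z. T z $ j) has_derivative (\<lambda>v. T' j v)) F"
  shows "(T has_derivative (\<lambda>v. \<chi> j. T' j v)) F"
proof -
  have e: "v = (\<Sum>j\<in>UNIV. axis j (v $ j))" for v :: "'k ^ 'm"
    by (simp add: vec_eq_iff axis_def cong: if_cong)
  have "((\<lambda>z. \<Sum>j\<in>UNIV. axis j (T z $ j)) has_derivative (\<lambda>v. \<Sum>j\<in>UNIV. axis j (T' j v))) F"
    by (intro has_derivative_sum bounded_linear.has_derivative[OF bounded_linear_axis] assms)
  then show ?thesis using e[of "\<chi> j. T' j v" for v] e[of "T z" for z] by simp
qed

lemma chain_rule: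
  fixes T :: "'k::real_or_complex ^ 'm::finite \<Rightarrow> 'k ^ 'l::finite"
  assumes T: "\<And>j. ((\<lambda>z. T z $ j) has_derivative (\<lambda>v. \<Sum>i\<in>UNIV. v $ i * T' i j)) (at z)"
    and f: "(f has_derivative (\<lambda>v. \<Sum>j\<in>UNIV. v $ j * f' j)) (at (T z))"
  shows "((\<lambda>z. f (T z)) has_derivative (\<lambda>v. \<Sum>i\<in>UNIV. v $ i * (\<Sum>j\<in>UNIV. f' j * T' i j))) (at z)"
proof -
  have "(\<lambda>v::'k^'m. \<Sum>i\<in>UNIV. v $ i * (\<Sum>j\<in>UNIV. f' j * T' i j)) =
      (\<lambda>v. \<Sum>j\<in>UNIV. v $ j * f' j) \<circ> (\<lambda>v. \<chi> j. \<Sum>i\<in>UNIV. v $ i * T' i j)"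
  proof
    fix v :: "'k^'m"
    show "(\<Sum>i\<in>UNIV. v $ i * (\<Sum>j\<in>UNIV. f' j * T' i j)) =
        ((\<lambda>v. \<Sum>j\<in>UNIV. v $ j * f' j) \<circ> (\<lambda>v. \<chi> j. \<Sum>i\<in>UNIV. v $ i * T' i j)) v"
      unfolding comp_def vec_lambda_beta sum_distrib_left sum_distrib_right
      by (subst sum.swap) (simp add: mult_ac)
  qed
  with diff_chain_at[OF has_derivative_vecI[OF T] f] show ?thesis by (simp add: comp_def)
qed

text \<open>Induction on the order: the derivatives of the composite are sums of
  \<open>f' j (T z)\<close> times derivatives of \<open>T\<close>, and the first factor falls under
  the induction hypothesis for \<open>f' j\<close>.\<close>

lemma Ck_compose:
  fixes T :: "'k::real_or_complex ^ 'm::finite \<Rightarrow> 'k ^ 'l::finite"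
  assumes "Ck k V f" "\<And>j. Ck k U (\<lambda>z. T z $ j)" "T ` U \<subseteq> V"
  shows "Ck k U (\<lambda>z. f (T z))"
  using assms(1,2)
proof (induction k arbitrary: f)
  case 0
  have "continuous_on U T"
    unfolding continuous_on_def using 0(2) by (auto simp: continuous_on_def intro!: vec_tendstoI)
  with 0 assms(3) show ?case by (auto intro: continuous_on_compose2)
next
  case (Suc k)
  then obtain f' where f': "\<forall>z\<in>V. (f has_derivative (\<lambda>v. \<Sum>i\<in>UNIV. v $ i * f' i z)) (at z)"
    "\<forall>i. Ck k V (f' i)" by auto
  from Suc.prems(2) have "\<forall>j. \<exists>T'. (\<forall>z\<in>U. ((\<lambda>z. T z $ j) has_derivative (\<lambda>v. \<Sum>i\<in>UNIV. v $ i * T' i z)) (at z))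
    \<and> (\<forall>i. Ck k U (T' i))" by simp
  from choice[OF this] obtain T' where T':
    "\<forall>j. (\<forall>z\<in>U. ((\<lambda>z. T z $ j) has_derivative (\<lambda>v. \<Sum>i\<in>UNIV. v $ i * T' j i z)) (at z))
      \<and> (\<forall>i. Ck k U (T' j i))" by blast
  have "((\<lambda>z. f (T z)) has_derivative (\<lambda>v. \<Sum>i\<in>UNIV. v $ i * (\<Sum>j\<in>UNIV. f' j (T z) * T' j i z))) (at z)"
    if "z \<in> U" for z
    by (rule chain_rule) (use T' f' that assms(3) in auto)
  moreover have "Ck k U (\<lambda>z. \<Sum>j\<in>UNIV. f' j (T z) * T' j i z)" for i
  proof (intro Ck_sum Ck_mult finite)
    fix j
    show "Ck k U (\<lambda>z. f' j (T z))"
      by (rule Suc.IH) (use f' Suc.prems(2) Ck_Suc_D in blast)+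
    show "Ck k U (T' j i)" using T' by blast
  qed
  ultimately show ?case unfolding Ck.simps
    by (intro exI[of _ "\<lambda>i z. \<Sum>j\<in>UNIV. f' j (T z) * T' j i z"]) blast
qed

section \<open>Smooth functions of the coordinates\<close>

definition csmooth :: "('k::real_or_complex ^ 'm::finite) set \<Rightarrow> ('k ^ 'm \<Rightarrow> 'k) \<Rightarrow> bool" where
  "csmooth U f \<longleftrightarrow> (\<forall>k. Ck k U f)"

lemma csmooth_pd: "open U \<Longrightarrow> csmooth U f \<Longrightarrow> csmooth U (pd i f)"
  unfolding csmooth_def using Ck_Suc_iff[of U _ f] by blast

lemma csmooth_has_derivative:
  "csmooth U f \<Longrightarrow> open U \<Longrightarrow> z \<in> U \<Longrightarrow> (f has_derivative (\<lambda>v. \<Sum>i\<in>UNIV. v $ i * pd i f z)) (at z)"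
  unfolding csmooth_def using Ck_Suc_iff[of U _ f] by blast


lemma csmooth_subset: "csmooth U f \<Longrightarrow> V \<subseteq> U \<Longrightarrow> csmooth V f"
  unfolding csmooth_def using Ck_subset by blast

lemma csmooth_cong: "open U \<Longrightarrow> (\<And>z. z \<in> U \<Longrightarrow> f z = g z) \<Longrightarrow> csmooth U f \<longleftrightarrow> csmooth U g"
  unfolding csmooth_def using Ck_cong[of U f g] by simp

lemma csmooth_local:
  "open U \<Longrightarrow> (\<And>z. z \<in> U \<Longrightarrow> \<exists>V. open V \<and> z \<in> V \<and> V \<subseteq> U \<and> csmooth V f) \<Longrightarrow> csmooth U f"
  unfolding csmooth_def using Ck_local[of U _ f] by meson

lemma csmooth_continuous: "csmooth U f \<Longrightarrow> continuous_on U f"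
  unfolding csmooth_def using Ck.simps(1) by blast

lemma csmooth_const: "csmooth U (\<lambda>z. c)"
  and csmooth_coord: "csmooth U (\<lambda>z. z $ i)"
  and csmooth_add: "csmooth U f \<Longrightarrow> csmooth U g \<Longrightarrow> csmooth U (\<lambda>z. f z + g z)"
  and csmooth_mult: "csmooth U f \<Longrightarrow> csmooth U g \<Longrightarrow> csmooth U (\<lambda>z. f z * g z)"
  and csmooth_inverse: "csmooth U f \<Longrightarrow> (\<And>z. z \<in> U \<Longrightarrow> f z \<noteq> 0) \<Longrightarrow> csmooth U (\<lambda>z. inverse (f z))"
  unfolding csmooth_def by (simp_all add: Ck_const Ck_coord Ck_add Ck_mult Ck_inverse)

lemma csmooth_compose:
  "csmooth V f \<Longrightarrow> (\<And>j. csmooth U (\<lambda>z. T z $ j)) \<Longrightarrow> T ` U \<subseteq> V \<Longrightarrow> csmooth U (\<lambda>z. f (T z))"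
  unfolding csmooth_def using Ck_compose[of _ V f U T] by blast

lemma regular_Smooth_iff: "regular Smooth U f \<longleftrightarrow> csmooth U f"
  by (simp add: regular_def csmooth_def)

text \<open>Test functions and local sections are smooth ones in every category, so data of either
  category enter the argument through their smoothness.\<close>

lemma reg_on_imp_Smooth: "reg_on cat \<A> W f \<Longrightarrow> reg_on Smooth \<A> W f"
  unfolding reg_on_def regular_def by auto

lemma sum_fun_apply: "(\<Sum>i\<in>I. F i) x = (\<Sum>i\<in>I. F i x)"
  by (induction I rule: infinite_finite_induct) auto


section \<open>Tangent vectors as derivations\<close>

text \<open>The pointwise operations make all operators on functions one ambient vector space, in
  which tangent, horizontal and vertical spaces are subspaces; spans and independence are taken
  there.\<close>

interpretation tv: vector_space "tscale :: 'k::real_or_complex \<Rightarrow> ('a, 'k) tvec \<Rightarrow> ('a, 'k) tvec"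
  by unfold_locales (auto simp: tscale_def fun_eq_iff algebra_simps)

lemma tscale_apply: "(a \<odot> v) f = a * v f"
  by (simp add: tscale_def)

section \<open>Charts and germs of smooth functions\<close>

locale mfd =
  fixes cat :: category and \<A> :: "('a::topological_space, 'k::real_or_complex, 'm::finite) chart set"
  assumes manifold: "manifold cat \<A>"
begin

lemma chart_props:
  assumes "(U, x) \<in> \<A>"
  shows chart_open: "open U" and chart_image_open: "open (x ` U)"
    and chart_inv: "p \<in> U \<Longrightarrow> inv_into U x (x p) = p"
    and chart_inv': "z \<in> x ` U \<Longrightarrow> x (inv_into U x z) = z"
    and chart_cont: "continuous_on U x"
    and chart_inv_cont: "continuous_on (x ` U) (inv_into U x)"
    and chart_carrier: "U \<subseteq> carrier \<A>"
proof -
  have *: "open U \<and> open (x ` U) \<and> homeomorphism U (x ` U) x (inv_into U x)"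
    using manifold assms unfolding manifold_def by blast
  then show "open U" "open (x ` U)" by auto
  from * have h: "homeomorphism U (x ` U) x (inv_into U x)" by blast
  show "p \<in> U \<Longrightarrow> inv_into U x (x p) = p" "z \<in> x ` U \<Longrightarrow> x (inv_into U x z) = z"
    "continuous_on U x" "continuous_on (x ` U) (inv_into U x)"
    using h by (auto simp: homeomorphism_def inv_into_into f_inv_into_f)
  show "U \<subseteq> carrier \<A>" using assms by (force simp: carrier_def)
qed

lemma chart_image_open_Int:
  assumes "(U, x) \<in> \<A>" "open W"
  shows "open (x ` (U \<inter> W))"
proof -
  have "x ` (U \<inter> W) = inv_into U x -` W \<inter> x ` U"
    using chart_inv[OF assms(1)] by force
  moreover have "open (inv_into U x -` W \<inter> x ` U)"
    using chart_inv_cont[OF assms(1)] chart_image_open[OF assms(1)] assms(2)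
    by (metis continuous_on_open_vimage)
  ultimately show ?thesis by simp
qed

lemma chart_vimage_open:
  assumes "(U, x) \<in> \<A>" "open V"
  shows "open (x -` V \<inter> U)"
  using chart_cont[OF assms(1)] chart_open[OF assms(1)] assms(2) by (metis continuous_on_open_vimage)

lemma carrierE:
  assumes "p \<in> carrier \<A>"
  obtains U x where "(U, x) \<in> \<A>" "p \<in> U"
  using assms by (force simp: carrier_def)

lemma chart_change:
  assumes "(U, x) \<in> \<A>" "(U', x') \<in> \<A>"
  shows "csmooth (x' ` (U' \<inter> U)) (\<lambda>z. x (inv_into U' x' z) $ i)"
proof -
  have "reg_on Smooth \<A> U (\<lambda>p. x p $ i)"
    using manifold assms(1) reg_on_imp_Smooth unfolding manifold_def by blast
  then have "\<forall>(U', x')\<in>\<A>. csmooth (x' ` (U' \<inter> U)) ((\<lambda>p. x p $ i) \<circ> inv_into U' x')"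
    unfolding reg_on_def regular_Smooth_iff by blast
  with assms(2) show ?thesis by (auto simp: comp_def)
qed

text \<open>Smoothness of the coordinate changes lets a single chart at \<open>p\<close>
  decide.\<close>

lemma smooth_at_iff:
  assumes "(U, x) \<in> \<A>" "p \<in> U"
  shows "smooth_at \<A> p f \<longleftrightarrow>
    (\<exists>V. open V \<and> x p \<in> V \<and> V \<subseteq> x ` U \<and> csmooth V (f \<circ> inv_into U x))" (is "_ \<longleftrightarrow> ?R")
proof
  assume "smooth_at \<A> p f"
  then obtain W where W: "p \<in> W" "reg_on Smooth \<A> W f" by (auto simp: smooth_at_def)
  then have "csmooth (x ` (U \<inter> W)) (f \<circ> inv_into U x)" "open W"
    using assms(1) unfolding reg_on_def regular_Smooth_iff by auto
  then show ?R using chart_image_open_Int[OF assms(1)] assms(2) W(1) by blast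
next
  assume ?R
  then obtain V where V: "open V" "x p \<in> V" "V \<subseteq> x ` U" "csmooth V (f \<circ> inv_into U x)" by blast
  let ?W = "x -` V \<inter> U"
  have "csmooth (x' ` (U' \<inter> ?W)) (f \<circ> inv_into U' x')" if "(U', x') \<in> \<A>" for U' x'
  proof -
    have "csmooth (x' ` (U' \<inter> ?W)) (\<lambda>z. (f \<circ> inv_into U x) (x (inv_into U' x' z)))"
      by (rule csmooth_compose[OF V(4) csmooth_subset[OF chart_change[OF assms(1) that]]])
        (use chart_inv[OF that] in auto)
    then show ?thesis
      by (subst csmooth_cong[of _ _ "\<lambda>z. (f \<circ> inv_into U x) (x (inv_into U' x' z))"])
        (use chart_inv[OF that] chart_inv[OF assms(1)] chart_image_open_Int[OF that]
          chart_vimage_open[OF assms(1) V(1)] in auto)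
  qed
  then have "reg_on Smooth \<A> ?W f"
    unfolding reg_on_def regular_Smooth_iff
    using chart_vimage_open[OF assms(1) V(1)] chart_carrier[OF assms(1)] by blast
  then show "smooth_at \<A> p f" unfolding smooth_at_def
    using V(2) assms(2) by (intro exI[of _ ?W]) blast
qed

lemma smooth_at_carrier: "smooth_at \<A> p f \<Longrightarrow> p \<in> carrier \<A>"
  by (auto simp: smooth_at_def reg_on_def)

lemma smooth_at_eventually: "smooth_at \<A> p f \<Longrightarrow> \<forall>\<^sub>F q in nhds p. smooth_at \<A> q f"
  unfolding smooth_at_def eventually_nhds by (metis reg_on_def)

lemma open_carrier: "open (carrier \<A>)"
  unfolding carrier_def using chart_open by force

lemma eventually_carrier: "p \<in> carrier \<A> \<Longrightarrow> \<forall>\<^sub>F q in nhds p. q \<in> carrier \<A>"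
  using open_carrier eventually_nhds by blast

lemma eventually_chart: "(U, x) \<in> \<A> \<Longrightarrow> p \<in> U \<Longrightarrow> \<forall>\<^sub>F q in nhds p. q \<in> U"
  using chart_open eventually_nhds by blast

text \<open>\<open>csmooth_local\<close> glues smoothness near the individual points, which allows
  smoothness to be treated as a property of germs from here on.\<close>

lemma reg_on_Smooth_iff:
  "reg_on Smooth \<A> W f \<longleftrightarrow> open W \<and> W \<subseteq> carrier \<A> \<and> (\<forall>p\<in>W. smooth_at \<A> p f)" (is "_ \<longleftrightarrow> ?R")
proof
  assume "reg_on Smooth \<A> W f"
  then show ?R unfolding smooth_at_def by (auto simp: reg_on_def)
next
  assume R: ?R
  have "csmooth (x ` (U \<inter> W)) (f \<circ> inv_into U x)" if c: "(U, x) \<in> \<A>" for U x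
  proof (rule csmooth_local)
    show "open (x ` (U \<inter> W))" using chart_image_open_Int[OF c] R by blast
    fix z assume z: "z \<in> x ` (U \<inter> W)"
    then obtain p where p: "p \<in> U" "p \<in> W" "z = x p" by blast
    then obtain V where "open V" "x p \<in> V" "V \<subseteq> x ` U" "csmooth V (f \<circ> inv_into U x)"
      using R smooth_at_iff[OF c p(1)] by blast
    then show "\<exists>V. open V \<and> z \<in> V \<and> V \<subseteq> x ` (U \<inter> W) \<and> csmooth V (f \<circ> inv_into U x)"
      using p chart_image_open_Int[OF c, of W] R
      by (intro exI[of _ "V \<inter> x ` (U \<inter> W)"]) (auto intro: csmooth_subset)
  qed
  then show "reg_on Smooth \<A> W f" using R unfolding reg_on_def regular_Smooth_iff by blast
qed

lemma smooth_at_cong: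
  assumes "\<forall>\<^sub>F q in nhds p. f q = g q"
  shows "smooth_at \<A> p f \<longleftrightarrow> smooth_at \<A> p g"
proof -
  have "smooth_at \<A> p g" if ev: "\<forall>\<^sub>F q in nhds p. f q = g q" and sm: "smooth_at \<A> p f" for f g :: "'a \<Rightarrow> 'k"
  proof -
    obtain U x where c: "(U, x) \<in> \<A>" "p \<in> U" using smooth_at_carrier[OF sm] carrierE by blast
    then obtain V where V: "open V" "x p \<in> V" "V \<subseteq> x ` U" "csmooth V (f \<circ> inv_into U x)"
      using sm smooth_at_iff[OF c] by blast
    obtain W where W: "open W" "p \<in> W" "\<forall>q\<in>W. f q = g q" using ev unfolding eventually_nhds by blast
    let ?V = "V \<inter> x ` (U \<inter> W)"
    have "open ?V" using V chart_image_open_Int[OF c(1)] W by blast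
    moreover have "csmooth ?V (g \<circ> inv_into U x)"
      by (subst csmooth_cong[of _ _ "f \<circ> inv_into U x"])
        (use \<open>open ?V\<close> W V chart_inv[OF c(1)] in \<open>auto intro: csmooth_subset\<close>)
    ultimately show ?thesis unfolding smooth_at_iff[OF c] using V W c by blast
  qed
  from this[OF assms] this[of g f] show ?thesis using eventually_mono[OF assms, of "\<lambda>q. g q = f q"] by auto
qed

lemma smooth_at_chart: "(U, x) \<in> \<A> \<Longrightarrow> p \<in> U \<Longrightarrow> smooth_at \<A> p (\<lambda>q. x q $ i)"
  using manifold reg_on_imp_Smooth unfolding manifold_def smooth_at_def by blast

lemma chart_tendsto: "(U, x) \<in> \<A> \<Longrightarrow> p \<in> U \<Longrightarrow> filterlim x (nhds (x p)) (nhds p)"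
  unfolding tendsto_def
proof (intro allI impI)
  fix V assume c: "(U, x) \<in> \<A>" "p \<in> U" and V: "open V" "x p \<in> V"
  show "\<forall>\<^sub>F q in nhds p. x q \<in> V" unfolding eventually_nhds
    by (rule exI[of _ "x -` V \<inter> U"]) (use chart_vimage_open[OF c(1) V(1)] c V in auto)
qed

lemma smooth_at_tendsto:
  assumes "smooth_at \<A> p f"
  shows "filterlim f (nhds (f p)) (nhds p)"
proof -
  obtain U x where c: "(U, x) \<in> \<A>" "p \<in> U" using smooth_at_carrier[OF assms] carrierE by blast
  then obtain V where V: "open V" "x p \<in> V" "V \<subseteq> x ` U" "csmooth V (f \<circ> inv_into U x)"
    using assms smooth_at_iff[OF c] by blast
  have "isCont (f \<circ> inv_into U x) (x p)"
    using csmooth_continuous[OF V(4)] V continuous_on_eq_continuous_at by blast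
  then have "filterlim (f \<circ> inv_into U x) (nhds (f p)) (nhds (x p))"
    unfolding isCont_def tendsto_at_iff_tendsto_nhds by (simp add: chart_inv[OF c])
  then have "filterlim (\<lambda>q. (f \<circ> inv_into U x) (x q)) (nhds (f p)) (nhds p)"
    using chart_tendsto[OF c] filterlim_compose by blast
  moreover have "\<forall>\<^sub>F q in nhds p. (f \<circ> inv_into U x) (x q) = f q"
    using eventually_chart[OF c] chart_inv[OF c(1)] by (auto elim: eventually_mono)
  ultimately show ?thesis by (rule Lim_transform_eventually)
qed

lemma smooth_at_nonzero:
  assumes "smooth_at \<A> p f" "f p \<noteq> 0"
  shows "\<forall>\<^sub>F q in nhds p. f q \<noteq> 0"
proof -
  have "open (- {0::'k})" by auto
  with smooth_at_tendsto[OF assms(1)] assms(2) have "\<forall>\<^sub>F q in nhds p. f q \<in> - {0}"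
    unfolding tendsto_def by blast
  then show ?thesis by simp
qed

text \<open>The common source of smoothness for inverses (\<open>F\<close> the inversion), for
  coordinate derivatives (\<open>t\<close> a chart) and for pull-backs by the submersion
  (\<open>t\<close> the coordinates of the image point).\<close>

lemma smooth_at_csmooth_comp:
  fixes t :: "'a \<Rightarrow> 'k ^ 'l::finite"
  assumes F: "open V" "csmooth V F" "t p \<in> V" and t: "\<And>j. smooth_at \<A> p (\<lambda>q. t q $ j)"
  shows "smooth_at \<A> p (\<lambda>q. F (t q))"
proof -
  obtain U x where c: "(U, x) \<in> \<A>" "p \<in> U" using smooth_at_carrier[OF t] carrierE by blast
  from t have "\<forall>j. \<exists>V. open V \<and> x p \<in> V \<and> V \<subseteq> x ` U \<and> csmooth V ((\<lambda>q. t q $ j) \<circ> inv_into U x)"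
    using smooth_at_iff[OF c] by blast
  from choice[OF this] obtain S where S: "\<And>j. open (S j)" "\<And>j. x p \<in> S j" "\<And>j. S j \<subseteq> x ` U"
    "\<And>j. csmooth (S j) ((\<lambda>q. t q $ j) \<circ> inv_into U x)" by blast
  let ?S = "\<Inter>j. S j"
  have "open ?S" using S(1) by (intro open_INT) auto
  have ct: "csmooth ?S (\<lambda>z. t (inv_into U x z) $ j)" for j
    using csmooth_subset[OF S(4)[of j], of ?S] by (auto simp: comp_def)
  then have "continuous_on ?S (\<lambda>z. t (inv_into U x z))"
    using csmooth_continuous[OF ct] by (auto simp: continuous_on_def intro!: vec_tendstoI)
  with \<open>open ?S\<close> F(1) have op: "open ((\<lambda>z. t (inv_into U x z)) -` V \<inter> ?S)"
    by (metis continuous_on_open_vimage)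
  have "csmooth ((\<lambda>z. t (inv_into U x z)) -` V \<inter> ?S) (\<lambda>z. F (t (inv_into U x z)))"
    by (rule csmooth_compose[OF F(2) csmooth_subset[OF ct]]) auto
  then show ?thesis unfolding smooth_at_iff[OF c]
    using op S(2) S(3)[THEN subsetD] F(3) chart_inv[OF c]
    by (intro exI[of _ "(\<lambda>z. t (inv_into U x z)) -` V \<inter> ?S"]) (auto simp: comp_def)
qed

lemma smooth_at_const: "p \<in> carrier \<A> \<Longrightarrow> smooth_at \<A> p (\<lambda>q. c)"
  unfolding smooth_at_def reg_on_def regular_Smooth_iff comp_def
  using open_carrier csmooth_const by blast

lemma smooth_at_add: "smooth_at \<A> p (\<lambda>q. f q + g q)" (is ?A)
  and smooth_at_mult: "smooth_at \<A> p (\<lambda>q. f q * g q)" (is ?B)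
  if sm: "smooth_at \<A> p f" "smooth_at \<A> p g"
proof -
  obtain U x where c: "(U, x) \<in> \<A>" "p \<in> U" using smooth_at_carrier[OF sm(1)] carrierE by blast
  obtain V where V: "open V" "x p \<in> V" "V \<subseteq> x ` U" "csmooth V (f \<circ> inv_into U x)"
    using sm smooth_at_iff[OF c] by blast
  obtain V' where V': "open V'" "x p \<in> V'" "V' \<subseteq> x ` U" "csmooth V' (g \<circ> inv_into U x)"
    using sm smooth_at_iff[OF c] by blast
  have "csmooth (V \<inter> V') (f \<circ> inv_into U x)" "csmooth (V \<inter> V') (g \<circ> inv_into U x)"
    using V V' csmooth_subset by blast+
  then show ?A ?B unfolding smooth_at_iff[OF c]
    by (intro exI[of _ "V \<inter> V'"], use V V' in \<open>auto simp: comp_def intro: csmooth_add csmooth_mult\<close>)+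
qed

lemma smooth_at_inverse:
  assumes "smooth_at \<A> p f" "f p \<noteq> 0"
  shows "smooth_at \<A> p (\<lambda>q. inverse (f q))"
proof -
  \<comment> \<open>The scalar function is viewed as a map into the one-dimensional space
    \<open>'k^1\<close>.\<close>
  have op: "open {z::'k^1. z $ 1 \<noteq> 0}"
    by (intro open_Collect_neq continuous_intros)
  have "csmooth {z::'k^1. z $ 1 \<noteq> 0} (\<lambda>z. inverse (z $ 1))"
    by (intro csmooth_inverse csmooth_coord) simp
  from smooth_at_csmooth_comp[OF op this, of "\<lambda>q. vec (f q)"] assms show ?thesis by simp
qed

lemma smooth_at_sum:
  "p \<in> carrier \<A> \<Longrightarrow> (\<And>i. i \<in> I \<Longrightarrow> smooth_at \<A> p (f i)) \<Longrightarrow> smooth_at \<A> p (\<lambda>q. \<Sum>i\<in>I. f i q)"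
  by (induction I rule: infinite_finite_induct) (simp_all add: smooth_at_add smooth_at_const)

lemma smooth_at_prod:
  "p \<in> carrier \<A> \<Longrightarrow> (\<And>i. i \<in> I \<Longrightarrow> smooth_at \<A> p (f i)) \<Longrightarrow> smooth_at \<A> p (\<lambda>q. \<Prod>i\<in>I. f i q)"
  by (induction I rule: infinite_finite_induct) (simp_all add: smooth_at_mult smooth_at_const)

section \<open>Derivation rules and coordinate expansion of tangent vectors\<close>

lemma rep_has_derivative:
  assumes "(U, x) \<in> \<A>" "p \<in> U" "smooth_at \<A> p f"
  shows "((f \<circ> inv_into U x) has_derivative (\<lambda>v. \<Sum>i\<in>UNIV. v $ i * pd i (f \<circ> inv_into U x) (x p))) (at (x p))"
  using assms(3) csmooth_has_derivative unfolding smooth_at_iff[OF assms(1,2)] by blast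

lemma chart_vec_apply:
  assumes "(U, x) \<in> \<A>" "p \<in> U"
  shows "chart_vec \<A> (U, x) p a f =
    (if smooth_at \<A> p f then \<Sum>i\<in>UNIV. a $ i * pd i (f \<circ> inv_into U x) (x p) else 0)"
  using frechet_derivative_at[OF rep_has_derivative[OF assms, of f], symmetric]
  by (simp add: chart_vec_def)

lemma chart_vec_eqI:
  assumes "(U, x) \<in> \<A>" "p \<in> U" "smooth_at \<A> p f"
    "((\<lambda>z. f (inv_into U x z)) has_derivative D) (at (x p))"
  shows "chart_vec \<A> (U, x) p a f = D a"
  using assms(3) frechet_derivative_at[OF assms(4)] by (simp add: chart_vec_def comp_def)

lemma rep_has_derivative':
  assumes "(U, x) \<in> \<A>" "p \<in> U" "smooth_at \<A> p f"
  shows "((\<lambda>z. f (inv_into U x z)) has_derivative (\<lambda>a. chart_vec \<A> (U, x) p a f)) (at (x p))"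
  using rep_has_derivative[OF assms] assms(3) by (simp add: chart_vec_apply[OF assms(1,2)] comp_def)

lemma tangentE:
  assumes "v \<in> tangent_space \<A> p"
  obtains U x a where "(U, x) \<in> \<A>" "p \<in> U" "v = chart_vec \<A> (U, x) p a"
  using assms unfolding tangent_space_def by force

lemma tangent_carrier: "v \<in> tangent_space \<A> p \<Longrightarrow> p \<in> carrier \<A>"
  unfolding tangent_space_def carrier_def by blast

lemma tangent_nonsmooth: "v \<in> tangent_space \<A> p \<Longrightarrow> \<not> smooth_at \<A> p f \<Longrightarrow> v f = 0"
  by (auto simp: tangent_space_def chart_vec_def)

lemma tangent_add:
  assumes "v \<in> tangent_space \<A> p" "smooth_at \<A> p f" "smooth_at \<A> p g"
  shows "v (\<lambda>q. f q + g q) = v f + v g"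
proof -
  from assms(1) obtain U x a where c: "(U, x) \<in> \<A>" "p \<in> U" "v = chart_vec \<A> (U, x) p a"
    by (rule tangentE)
  show ?thesis unfolding c(3)
    by (rule chart_vec_eqI[OF c(1,2) smooth_at_add[OF assms(2,3)]
      has_derivative_add[OF rep_has_derivative'[OF c(1,2) assms(2)] rep_has_derivative'[OF c(1,2) assms(3)]]])
qed

lemma tangent_mult:
  assumes "v \<in> tangent_space \<A> p" "smooth_at \<A> p f" "smooth_at \<A> p g"
  shows "v (\<lambda>q. f q * g q) = f p * v g + v f * g p"
proof -
  from assms(1) obtain U x a where c: "(U, x) \<in> \<A>" "p \<in> U" "v = chart_vec \<A> (U, x) p a"
    by (rule tangentE)
  show ?thesis unfolding c(3)
    using chart_vec_eqI[OF c(1,2) smooth_at_mult[OF assms(2,3)]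
      has_derivative_mult[OF rep_has_derivative'[OF c(1,2) assms(2)] rep_has_derivative'[OF c(1,2) assms(3)]]]
    by (simp add: chart_inv[OF c(1,2)])
qed

lemma tangent_const:
  assumes "v \<in> tangent_space \<A> p"
  shows "v (\<lambda>q. b) = 0"
proof -
  from assms(1) obtain U x a where c: "(U, x) \<in> \<A>" "p \<in> U" "v = chart_vec \<A> (U, x) p a"
    by (rule tangentE)
  show ?thesis unfolding c(3)
    by (rule chart_vec_eqI[OF c(1,2) smooth_at_const[OF tangent_carrier[OF assms]] has_derivative_const])
qed

lemma tangent_cong:
  assumes "v \<in> tangent_space \<A> p" and ev: "\<forall>\<^sub>F q in nhds p. f q = g q"
  shows "v f = v g"
proof (cases "smooth_at \<A> p f")
  \<comment> \<open>Smoothness at \<open>p\<close> depends on the germ alone, and tangent vectors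
    are 0 on all other functions by convention.\<close>
  case False
  then show ?thesis using tangent_nonsmooth[OF assms(1)] smooth_at_cong[OF ev] by simp
next
  case True
  from assms(1) obtain U x a where c: "(U, x) \<in> \<A>" "p \<in> U" "v = chart_vec \<A> (U, x) p a"
    by (rule tangentE)
  from ev obtain W where W: "open W" "p \<in> W" "\<forall>q\<in>W. f q = g q" unfolding eventually_nhds by blast
  have "((\<lambda>z. g (inv_into U x z)) has_derivative (\<lambda>a. chart_vec \<A> (U, x) p a f)) (at (x p))"
    by (rule has_derivative_transform_within_open[OF rep_has_derivative'[OF c(1,2) True]
      chart_image_open_Int[OF c(1) W(1)]]) (use W c chart_inv[OF c(1)] in auto)
  then show ?thesis unfolding c(3)
    using chart_vec_eqI[OF c(1,2)] smooth_at_cong[OF ev] True by simp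
qed

lemma tangent_comp:
  fixes t :: "'a \<Rightarrow> 'k ^ 'l::finite"
  assumes v: "v \<in> tangent_space \<A> p" and F: "open V" "csmooth V F" "t p \<in> V"
    and t: "\<And>j. smooth_at \<A> p (\<lambda>q. t q $ j)"
  shows "v (\<lambda>q. F (t q)) = (\<Sum>j\<in>UNIV. v (\<lambda>q. t q $ j) * pd j F (t p))"
proof -
  from v obtain U x a where c: "(U, x) \<in> \<A>" "p \<in> U" "v = chart_vec \<A> (U, x) p a"
    by (rule tangentE)
  have tp: "t (inv_into U x (x p)) = t p" by (simp add: chart_inv[OF c(1,2)])
  have "((\<lambda>z. t (inv_into U x z)) has_derivative (\<lambda>a. \<chi> j. chart_vec \<A> (U, x) p a (\<lambda>q. t q $ j))) (at (x p))"
    by (rule has_derivative_vecI) (use rep_has_derivative'[OF c(1,2) t] in simp)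
  moreover have "(F has_derivative (\<lambda>v. \<Sum>j\<in>UNIV. v $ j * pd j F (t p))) (at (t (inv_into U x (x p))))"
    unfolding tp by (rule csmooth_has_derivative[OF F(2,1,3)])
  ultimately have "((\<lambda>z. F (t (inv_into U x z))) has_derivative
      (\<lambda>a. \<Sum>j\<in>UNIV. chart_vec \<A> (U, x) p a (\<lambda>q. t q $ j) * pd j F (t p))) (at (x p))"
    using diff_chain_at by (fastforce simp: comp_def)
  then show ?thesis unfolding c(3)
    using chart_vec_eqI[OF c(1,2) smooth_at_csmooth_comp[OF F t]] by blast
qed

lemma coord_field_apply:
  assumes "(U, x) \<in> \<A>" "p \<in> U" "smooth_at \<A> p f"
  shows "coord_field \<A> (U, x) i p f = pd i (f \<circ> inv_into U x) (x p)"
  using assms by (simp add: coord_field_def chart_vec_apply sum_axis_mult)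

lemma coord_field_tangent: "(U, x) \<in> \<A> \<Longrightarrow> p \<in> U \<Longrightarrow> coord_field \<A> (U, x) i p \<in> tangent_space \<A> p"
  unfolding coord_field_def tangent_space_def by force

lemma chart_vec_tangent: "(U, x) \<in> \<A> \<Longrightarrow> p \<in> U \<Longrightarrow> chart_vec \<A> (U, x) p a \<in> tangent_space \<A> p"
  unfolding tangent_space_def by force

lemma coord_field_coord:
  assumes "(U, x) \<in> \<A>" "p \<in> U"
  shows "coord_field \<A> (U, x) i p (\<lambda>q. x q $ j) = (if i = j then 1 else 0)"
proof -
  have "((\<lambda>z. z $ j) has_derivative (\<lambda>v. v $ j)) (at (x p))"
    by (rule bounded_linear_imp_has_derivative[OF bounded_linear_vec_nth])
  then have "((\<lambda>z. x (inv_into U x z) $ j) has_derivative (\<lambda>v. v $ j)) (at (x p))"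
    by (rule has_derivative_transform_within_open[OF _ chart_image_open[OF assms(1)]])
      (use assms chart_inv'[OF assms(1)] in auto)
  from chart_vec_eqI[OF assms smooth_at_chart[OF assms] this, of "axis i 1"] show ?thesis
    by (simp add: coord_field_def axis_def eq_commute)
qed

text \<open>The chain rule for \<open>f\<close> written as its coordinate expression composed with
  \<open>x\<close>. Hence a tangent vector is determined by its values on the coordinates of any
  chart at \<open>p\<close>, whichever chart it was presented in.\<close>

lemma tangent_expand:
  assumes "v \<in> tangent_space \<A> p" "(U, x) \<in> \<A>" "p \<in> U" "smooth_at \<A> p f"
  shows "v f = (\<Sum>i\<in>UNIV. v (\<lambda>q. x q $ i) * coord_field \<A> (U, x) i p f)"
proof -
  obtain V where V: "open V" "x p \<in> V" "V \<subseteq> x ` U" "csmooth V (f \<circ> inv_into U x)"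
    using assms(4) smooth_at_iff[OF assms(2,3)] by blast
  have "v f = v (\<lambda>q. (f \<circ> inv_into U x) (x q))"
    by (rule tangent_cong[OF assms(1)])
      (use eventually_chart[OF assms(2,3)] chart_inv[OF assms(2)] in \<open>auto elim: eventually_mono\<close>)
  also have "\<dots> = (\<Sum>i\<in>UNIV. v (\<lambda>q. x q $ i) * pd i (f \<circ> inv_into U x) (x p))"
    by (rule tangent_comp[OF assms(1) V(1,4,2) smooth_at_chart[OF assms(2,3)]])
  finally show ?thesis using coord_field_apply[OF assms(2-4)] by simp
qed

lemma tangent_eq_sum:
  assumes "v \<in> tangent_space \<A> p" "(U, x) \<in> \<A>" "p \<in> U"
  shows "v = (\<Sum>i\<in>UNIV. v (\<lambda>q. x q $ i) \<odot> coord_field \<A> (U, x) i p)"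
proof
  fix f
  show "v f = (\<Sum>i\<in>UNIV. v (\<lambda>q. x q $ i) \<odot> coord_field \<A> (U, x) i p) f"
    by (cases "smooth_at \<A> p f")
      (simp_all add: sum_fun_apply tscale_apply tangent_expand[OF assms, symmetric] tangent_nonsmooth[OF assms(1)]
        tangent_nonsmooth[OF coord_field_tangent[OF assms(2,3)]])
qed

lemma tangent_eq_chart_vec:
  assumes "v \<in> tangent_space \<A> p" "(U, x) \<in> \<A>" "p \<in> U"
  shows "v = chart_vec \<A> (U, x) p (\<chi> i. v (\<lambda>q. x q $ i))"
proof
  fix f
  show "v f = chart_vec \<A> (U, x) p (\<chi> i. v (\<lambda>q. x q $ i)) f"
    using tangent_expand[OF assms, of f] coord_field_apply[OF assms(2,3), of f] tangent_nonsmooth[OF assms(1), of f]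
    by (cases "smooth_at \<A> p f") (simp_all add: chart_vec_apply[OF assms(2,3)])
qed

lemma tangent_eqI:
  assumes "v \<in> tangent_space \<A> p" "w \<in> tangent_space \<A> p" "(U, x) \<in> \<A>" "p \<in> U"
    "\<And>i. v (\<lambda>q. x q $ i) = w (\<lambda>q. x q $ i)"
  shows "v = w"
  using tangent_eq_chart_vec[OF assms(1,3,4)] tangent_eq_chart_vec[OF assms(2,3,4)] assms(5) by simp

text \<open>Vectors presented in different charts are first rewritten in one fixed chart, where the
  operations become those of the component vectors.\<close>

lemma tangent_subspace:
  assumes "p \<in> carrier \<A>"
  shows "tv.subspace (tangent_space \<A> p)"
proof -
  obtain U x where c: "(U, x) \<in> \<A>" "p \<in> U" using assms by (rule carrierE)
  have add: "chart_vec \<A> (U, x) p a + chart_vec \<A> (U, x) p b = chart_vec \<A> (U, x) p (a + b)" for a b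
    by (rule ext) (simp add: chart_vec_apply[OF c] distrib_right sum.distrib)
  have sc: "s \<odot> chart_vec \<A> (U, x) p a = chart_vec \<A> (U, x) p (s *s a)" for a s
    by (rule ext) (simp add: chart_vec_apply[OF c] tscale_apply sum_distrib_left mult.assoc)
  have z: "chart_vec \<A> (U, x) p 0 = 0"
    by (rule ext) (simp add: chart_vec_apply[OF c])
  show ?thesis
    unfolding tv.subspace_def
    using tangent_eq_chart_vec[OF _ c] chart_vec_tangent[OF c] add sc z by metis
qed

lemma tangent_0: "p \<in> carrier \<A> \<Longrightarrow> 0 \<in> tangent_space \<A> p"
  using tv.subspace_0[OF tangent_subspace] .

lemma tangent_plus: "v \<in> tangent_space \<A> p \<Longrightarrow> w \<in> tangent_space \<A> p \<Longrightarrow> v + w \<in> tangent_space \<A> p"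
  using tv.subspace_add[OF tangent_subspace] tangent_carrier by blast

lemma tangent_minus: "v \<in> tangent_space \<A> p \<Longrightarrow> w \<in> tangent_space \<A> p \<Longrightarrow> v - w \<in> tangent_space \<A> p"
  using tv.subspace_diff[OF tangent_subspace] tangent_carrier by blast

lemma tangent_scale: "v \<in> tangent_space \<A> p \<Longrightarrow> a \<odot> v \<in> tangent_space \<A> p"
  using tv.subspace_scale[OF tangent_subspace] tangent_carrier by blast

lemma tangent_sum: "p \<in> carrier \<A> \<Longrightarrow> (\<And>i. i \<in> I \<Longrightarrow> v i \<in> tangent_space \<A> p) \<Longrightarrow> (\<Sum>i\<in>I. v i) \<in> tangent_space \<A> p"
  using tv.subspace_sum[OF tangent_subspace] by blast

lemma tangent_fsum:
  assumes "v \<in> tangent_space \<A> p" "\<And>i. i \<in> I \<Longrightarrow> smooth_at \<A> p (f i)"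
  shows "v (\<lambda>q. \<Sum>i\<in>I. f i q) = (\<Sum>i\<in>I. v (f i))"
  using assms(2)
  by (induction I rule: infinite_finite_induct)
    (simp_all add: tangent_const[OF assms(1)] tangent_add[OF assms(1)] smooth_at_sum tangent_carrier[OF assms(1)])

lemma tangent_fprod:
  assumes "v \<in> tangent_space \<A> p" "finite I" "\<And>i. i \<in> I \<Longrightarrow> smooth_at \<A> p (f i)"
  shows "v (\<lambda>q. \<Prod>i\<in>I. f i q) = (\<Sum>k\<in>I. v (f k) * (\<Prod>i\<in>I - {k}. f i p))"
  using assms(2,3)
proof (induction I rule: finite_induct)
  case empty
  then show ?case by (simp add: tangent_const[OF assms(1)])
next
  case (insert j I)
  have *: "v (f k) * (\<Prod>i\<in>insert j I - {k}. f i p) = f j p * (v (f k) * (\<Prod>i\<in>I - {k}. f i p))" if "k \<in> I" for k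
  proof -
    have "insert j I - {k} = insert j (I - {k})" using that insert by auto
    then show ?thesis using insert by (simp add: mult_ac)
  qed
  have "insert j I - {j} = I" using insert by auto
  then show ?case using insert
    by (simp add: tangent_mult[OF assms(1)] smooth_at_prod tangent_carrier[OF assms(1)] * sum_distrib_left)
qed

section \<open>Local vector fields\<close>

lemma smooth_at_transfer: "smooth_at \<A> p g \<Longrightarrow> \<forall>\<^sub>F q in nhds p. f q = g q \<Longrightarrow> smooth_at \<A> p f"
  using smooth_at_cong[of f g p] by simp

lemma coord_deriv_smooth:
  assumes "smooth_at \<A> p f" "(U, x) \<in> \<A>" "p \<in> U"
  shows "smooth_at \<A> p (\<lambda>q. coord_field \<A> (U, x) i q f)"
proof -
  obtain V where V: "open V" "x p \<in> V" "V \<subseteq> x ` U" "csmooth V (f \<circ> inv_into U x)"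
    using assms(1) smooth_at_iff[OF assms(2,3)] by blast
  have "smooth_at \<A> p (\<lambda>q. pd i (f \<circ> inv_into U x) (x q))"
    by (rule smooth_at_csmooth_comp[OF V(1) csmooth_pd[OF V(1,4)] V(2) smooth_at_chart[OF assms(2,3)]])
  moreover have "\<forall>\<^sub>F q in nhds p. coord_field \<A> (U, x) i q f = pd i (f \<circ> inv_into U x) (x q)"
    using smooth_at_eventually[OF assms(1)] eventually_chart[OF assms(2,3)]
    by eventually_elim (rule coord_field_apply[OF assms(2)])
  ultimately show ?thesis by (rule smooth_at_transfer)
qed

lemma field_near_eventually: "field_near \<A> p X \<Longrightarrow> \<forall>\<^sub>F q in nhds p. field_near \<A> q X"
  unfolding field_near_def eventually_nhds vfield_on_def by blast

lemma field_near_tangent: "field_near \<A> p X \<Longrightarrow> X p \<in> tangent_space \<A> p"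
  unfolding field_near_def vfield_on_def by blast

lemma field_near_carrier: "field_near \<A> p X \<Longrightarrow> p \<in> carrier \<A>"
  unfolding field_near_def vfield_on_def by blast

lemma field_near_eventually_tangent: "field_near \<A> p X \<Longrightarrow> \<forall>\<^sub>F q in nhds p. X q \<in> tangent_space \<A> q"
  by (drule field_near_eventually) (auto elim: eventually_mono intro: field_near_tangent)

lemma field_near_coord:
  assumes "field_near \<A> p X" "(U, x) \<in> \<A>" "p \<in> U"
  shows "smooth_at \<A> p (\<lambda>q. X q (\<lambda>r. x r $ i))"
proof -
  obtain W where W: "p \<in> W" "vfield_on Smooth \<A> W X" using assms(1) by (auto simp: field_near_def)
  then have "\<forall>i. reg_on Smooth \<A> (W \<inter> U) (\<lambda>p. X p (\<lambda>q. x q $ i))"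
    using assms(2) unfolding vfield_on_def by blast
  then show ?thesis using W(1) assms(3) unfolding smooth_at_def by blast
qed

lemma field_near_smooth:
  assumes "field_near \<A> p X" "smooth_at \<A> p f"
  shows "smooth_at \<A> p (\<lambda>q. X q f)"
proof -
  obtain U x where c: "(U, x) \<in> \<A>" "p \<in> U" using field_near_carrier[OF assms(1)] carrierE by blast
  have "smooth_at \<A> p (\<lambda>q. \<Sum>i\<in>UNIV. X q (\<lambda>r. x r $ i) * coord_field \<A> (U, x) i q f)"
    by (intro smooth_at_sum smooth_at_mult field_near_coord[OF assms(1) c] coord_deriv_smooth[OF assms(2) c]
      field_near_carrier[OF assms(1)])
  moreover have "\<forall>\<^sub>F q in nhds p. X q f = (\<Sum>i\<in>UNIV. X q (\<lambda>r. x r $ i) * coord_field \<A> (U, x) i q f)"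
    using field_near_eventually_tangent[OF assms(1)] eventually_chart[OF c] smooth_at_eventually[OF assms(2)]
    by eventually_elim (rule tangent_expand[OF _ c(1)])
  ultimately show ?thesis by (rule smooth_at_transfer)
qed

text \<open>The components in another chart are obtained from those in the given one by
  \<open>tangent_expand\<close>, with coordinate derivatives of the new coordinates as smooth
  coefficients.\<close>

lemma field_nearI:
  assumes c: "(U, x) \<in> \<A>" "p \<in> U" and T: "\<forall>\<^sub>F q in nhds p. X q \<in> tangent_space \<A> q"
    and S: "\<And>i. smooth_at \<A> p (\<lambda>q. X q (\<lambda>r. x r $ i))"
  shows "field_near \<A> p X"
proof -
  have "\<forall>\<^sub>F q in nhds p. \<forall>i. smooth_at \<A> q (\<lambda>q. X q (\<lambda>r. x r $ i))"
    by (rule eventually_all_finite) (rule smooth_at_eventually[OF S])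
  with T eventually_chart[OF c] have "\<forall>\<^sub>F q in nhds p. X q \<in> tangent_space \<A> q \<and> q \<in> U \<and>
      (\<forall>i. smooth_at \<A> q (\<lambda>q. X q (\<lambda>r. x r $ i)))"
    by eventually_elim blast
  then obtain W where W: "open W" "p \<in> W" "\<And>q. q \<in> W \<Longrightarrow> X q \<in> tangent_space \<A> q"
    "W \<subseteq> U" "\<And>q i. q \<in> W \<Longrightarrow> smooth_at \<A> q (\<lambda>q. X q (\<lambda>r. x r $ i))"
    unfolding eventually_nhds by blast
  have "smooth_at \<A> q (\<lambda>q. X q (\<lambda>r. x' r $ j))" if c': "(U', x') \<in> \<A>" "q \<in> U'" and q: "q \<in> W" for U' x' q j
  proof -
    have cq: "q \<in> U" "q \<in> carrier \<A>" using q W(4) chart_carrier[OF c(1)] by auto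
    have "smooth_at \<A> q (\<lambda>q. \<Sum>i\<in>UNIV. X q (\<lambda>r. x r $ i) * coord_field \<A> (U, x) i q (\<lambda>r. x' r $ j))"
      by (intro smooth_at_sum smooth_at_mult W(5)[OF q] coord_deriv_smooth[OF smooth_at_chart[OF c'] c(1) cq(1)] cq(2))
    moreover have "\<forall>\<^sub>F q in nhds q. X q (\<lambda>r. x' r $ j) =
        (\<Sum>i\<in>UNIV. X q (\<lambda>r. x r $ i) * coord_field \<A> (U, x) i q (\<lambda>r. x' r $ j))"
    proof -
      have "\<forall>\<^sub>F q in nhds q. q \<in> W" using W(1) q eventually_nhds by blast
      with eventually_chart[OF c'] show ?thesis
        by eventually_elim (use W(3,4) in \<open>blast intro: tangent_expand[OF _ c(1)] smooth_at_chart[OF c'(1)]\<close>)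
    qed
    ultimately show ?thesis by (rule smooth_at_transfer)
  qed
  then have "vfield_on Smooth \<A> W X"
    unfolding vfield_on_def reg_on_Smooth_iff using W chart_carrier chart_open c(1) by blast
  then show ?thesis unfolding field_near_def using W(2) by blast
qed

lemma coord_field_near:
  assumes "(U, x) \<in> \<A>" "p \<in> U"
  shows "field_near \<A> p (coord_field \<A> (U, x) i)"
  by (rule field_nearI[OF assms])
    (use eventually_chart[OF assms] coord_field_tangent[OF assms(1)] coord_deriv_smooth[OF smooth_at_chart[OF assms] assms]
      in \<open>auto elim: eventually_mono\<close>)

lemma field_near_add:
  assumes "field_near \<A> p X" "field_near \<A> p Y"
  shows "field_near \<A> p (\<lambda>q. X q + Y q)"
proof -
  obtain U x where c: "(U, x) \<in> \<A>" "p \<in> U" using field_near_carrier[OF assms(1)] carrierE by blast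
  show ?thesis
  proof (rule field_nearI[OF c])
    show "\<forall>\<^sub>F q in nhds p. X q + Y q \<in> tangent_space \<A> q"
      using field_near_eventually_tangent[OF assms(1)] field_near_eventually_tangent[OF assms(2)]
      by eventually_elim (rule tangent_plus)
  qed (simp add: smooth_at_add field_near_coord[OF assms(1) c] field_near_coord[OF assms(2) c])
qed

lemma field_near_scale:
  assumes "smooth_at \<A> p f" "field_near \<A> p X"
  shows "field_near \<A> p (\<lambda>q. f q \<odot> X q)"
proof -
  obtain U x where c: "(U, x) \<in> \<A>" "p \<in> U" using field_near_carrier[OF assms(2)] carrierE by blast
  show ?thesis
  proof (rule field_nearI[OF c])
    show "\<forall>\<^sub>F q in nhds p. f q \<odot> X q \<in> tangent_space \<A> q"
      using field_near_eventually_tangent[OF assms(2)] by eventually_elim (rule tangent_scale)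
  qed (simp add: tscale_apply smooth_at_mult assms field_near_coord[OF assms(2) c])
qed

lemma field_near_zero:
  assumes "p \<in> carrier \<A>"
  shows "field_near \<A> p (\<lambda>q. 0)"
proof -
  obtain U x where c: "(U, x) \<in> \<A>" "p \<in> U" using assms carrierE by blast
  show ?thesis
    by (rule field_nearI[OF c])
      (use assms eventually_carrier[OF assms] in \<open>auto elim: eventually_mono intro: tangent_0 smooth_at_const\<close>)
qed

lemma field_near_sum:
  assumes "p \<in> carrier \<A>" "\<And>i. i \<in> I \<Longrightarrow> field_near \<A> p (X i)"
  shows "field_near \<A> p (\<lambda>q. \<Sum>i\<in>I. X i q)"
  using assms(2)
  by (induction I rule: infinite_finite_induct) (simp_all add: field_near_zero[OF assms(1)] field_near_add)

lemma field_near_diff: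
  assumes "field_near \<A> p X" "field_near \<A> p Y"
  shows "field_near \<A> p (\<lambda>q. X q - Y q)"
proof -
  have "(\<lambda>q. X q - Y q) = (\<lambda>q. X q + (\<lambda>q. -1) q \<odot> Y q)"
    by (rule ext)+ (simp add: tscale_apply)
  then show ?thesis
    using field_near_add[OF assms(1) field_near_scale[OF smooth_at_const[OF field_near_carrier[OF assms(1)]] assms(2)]]
    by metis
qed

text \<open>The extension has constant components in a chart. It allows quantities that depend on
  the value of a field at \<open>p\<close> to be treated as functions of tangent vectors.\<close>

lemma field_extension:
  assumes "v \<in> tangent_space \<A> p"
  obtains X where "field_near \<A> p X" "X p = v"
proof -
  obtain U x where c: "(U, x) \<in> \<A>" "p \<in> U" using tangent_carrier[OF assms] carrierE by blast
  show ?thesis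
    by (rule that[of "\<lambda>q. \<Sum>i\<in>UNIV. (\<lambda>q. v (\<lambda>q. x q $ i)) q \<odot> coord_field \<A> (U, x) i q"])
      (use c tangent_carrier[OF assms] tangent_eq_sum[OF assms c] in
        \<open>auto intro!: field_near_sum field_near_scale smooth_at_const coord_field_near\<close>)
qed

lemma vfield_on_subset:  assumes "vfield_on Smooth \<A> W X" "open V" "V \<subseteq> W"
  shows "vfield_on Smooth \<A> V X"
  unfolding vfield_on_def
proof (intro conjI)
  show "open V" by (rule assms(2))
  show "V \<subseteq> carrier \<A>" using assms unfolding vfield_on_def by blast
  show "\<forall>p\<in>V. X p \<in> tangent_space \<A> p" using assms unfolding vfield_on_def by blast
  have *: "\<forall>(U, x)\<in>\<A>. \<forall>i. reg_on Smooth \<A> (W \<inter> U) (\<lambda>p. X p (\<lambda>q. x q $ i))"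
    using assms(1) unfolding vfield_on_def by (elim conjE)
  show "\<forall>(U, x)\<in>\<A>. \<forall>i. reg_on Smooth \<A> (V \<inter> U) (\<lambda>p. X p (\<lambda>q. x q $ i))"
  proof (clarify)
    fix U x i assume c: "(U, x) \<in> \<A>"
    with * have "reg_on Smooth \<A> (W \<inter> U) (\<lambda>p. X p (\<lambda>q. x q $ i))" by fast
    then show "reg_on Smooth \<A> (V \<inter> U) (\<lambda>p. X p (\<lambda>q. x q $ i))"
      unfolding reg_on_Smooth_iff using assms(2,3) chart_open[OF c] by blast
  qed
qed

lemma field_near_Ball:
  assumes "field_near \<A> p X" "\<forall>\<^sub>F q in nhds p. P q"
  shows "\<exists>W. p \<in> W \<and> vfield_on Smooth \<A> W X \<and> (\<forall>q\<in>W. P q)"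
proof -
  obtain W where W: "p \<in> W" "vfield_on Smooth \<A> W X" using assms(1) unfolding field_near_def by (elim exE conjE)
  obtain V where V: "open V" "p \<in> V" "\<forall>q\<in>V. P q" using assms(2) unfolding eventually_nhds by (elim exE conjE)
  have "open W" using W(2) unfolding vfield_on_def by (elim conjE)
  then have "vfield_on Smooth \<A> (W \<inter> V) X" by (intro vfield_on_subset[OF W(2)]) (use V(1) in auto)
  then show ?thesis using W(1) V by (intro exI[of _ "W \<inter> V"]) auto
qed

text \<open>\<open>hfield_near\<close> and \<open>vfield_near\<close> have the shape of the left
  side; separating the smooth field from the pointwise condition permits arguments with eventual
  properties.\<close>

lemma field_near_iff_Ball:
  "(\<exists>W. p \<in> W \<and> vfield_on Smooth \<A> W X \<and> (\<forall>q\<in>W. P q)) \<longleftrightarrow> field_near \<A> p X \<and> (\<forall>\<^sub>F q in nhds p. P q)"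
    (is "?L \<longleftrightarrow> ?R")
proof
  assume ?L
  then obtain W where W: "p \<in> W" "vfield_on Smooth \<A> W X" "\<forall>q\<in>W. P q" by (elim exE conjE)
  have "open W" using W(2) unfolding vfield_on_def by (elim conjE)
  with W(1,3) have "\<forall>\<^sub>F q in nhds p. P q" unfolding eventually_nhds by blast
  with W(1,2) show ?R unfolding field_near_def by blast
next
  assume ?R
  then show ?L using field_near_Ball[of p X P] by (elim conjE)
qed

section \<open>Linear systems with smooth coefficients\<close>

lemma smooth_at_det:
  fixes B :: "'i::finite \<Rightarrow> 'i \<Rightarrow> 'a \<Rightarrow> 'k"
  assumes "p \<in> carrier \<A>" "\<And>i j. smooth_at \<A> p (B i j)"
  shows "smooth_at \<A> p (\<lambda>q. det (\<chi> i j. B i j q))"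
  unfolding det_def
  by (simp, intro smooth_at_sum smooth_at_mult smooth_at_const smooth_at_prod assms)

text \<open>Cramer's rule: the solution is rational in the coefficients, hence smooth where the
  determinant does not vanish. It produces gradients and the horizontal parts of vector
  fields.\<close>

lemma smooth_solve:
  fixes B :: "'i::finite \<Rightarrow> 'i \<Rightarrow> 'a \<Rightarrow> 'k"
  assumes p: "p \<in> carrier \<A>" and B: "\<And>i j. smooth_at \<A> p (B i j)" and b: "\<And>i. smooth_at \<A> p (b i)"
    and nz: "det (\<chi> i j. B i j p) \<noteq> 0"
  obtains c where "\<And>i. smooth_at \<A> p (c i)" "\<forall>\<^sub>F q in nhds p. \<forall>i. (\<Sum>j\<in>UNIV. B i j q * c j q) = b i q"
proof
  let ?c = "\<lambda>k q. det (\<chi> i j. if j = k then b i q else B i j q) * inverse (det (\<chi> i j. B i j q))"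
  show "smooth_at \<A> p (?c k)" for k
  proof (intro smooth_at_mult smooth_at_inverse smooth_at_det p B nz)
    show "smooth_at \<A> p (\<lambda>q. if j = k then b i q else B i j q)" for i j
      using B b by (cases "j = k") simp_all
  qed
  show "\<forall>\<^sub>F q in nhds p. \<forall>i. (\<Sum>j\<in>UNIV. B i j q * ?c j q) = b i q"
    using smooth_at_nonzero[OF smooth_at_det[OF p B] nz]
  proof eventually_elim
    case (elim q)
    have "(\<chi> k. ?c k q) = (\<chi> k. det (\<chi> i j. if j = k then (\<chi> i. b i q) $ i else (\<chi> i j. B i j q) $ i $ j) / det (\<chi> i j. B i j q))"
      by (simp add: divide_inverse cong: if_cong)
    then have "(\<chi> i j. B i j q) *v (\<chi> k. ?c k q) = (\<chi> i. b i q)"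
      using cramer[OF elim, of "\<chi> k. ?c k q" "\<chi> i. b i q"] by blast
    then show ?case by (simp add: matrix_vector_mult_def vec_eq_iff)
  qed
qed

end


section \<open>Jacobi's formula for Gram determinants\<close>

text \<open>The sum is a determinant whose row \<open>k\<close> has been replaced by row
  \<open>j\<close>. Composing a permutation with the transposition of \<open>k\<close> and
  \<open>j\<close> preserves the product and reverses the sign, so the sum equals its own
  negative.\<close>

lemma det_replaced_row:
  fixes G :: "nat \<Rightarrow> nat \<Rightarrow> 'k::field_char_0"
  assumes "k < r" "j < r" "k \<noteq> j"
  shows "(\<Sum>\<pi> | \<pi> permutes {..<r}. of_int (sign \<pi>) * (G j (\<pi> k) * (\<Prod>i\<in>{..<r} - {k}. G i (\<pi> i)))) = 0"
    (is "sum ?f _ = 0")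
proof -
  let ?q = "Transposition.transpose k j"
  have q: "?q permutes {..<r}" using assms by (intro permutes_swap_id) auto
  have neg: "?f (\<pi> \<circ> ?q) = - ?f \<pi>" if "\<pi> permutes {..<r}" for \<pi>
  proof -
    have sg: "sign (\<pi> \<circ> ?q) = - sign \<pi>"
      using sign_compose[of \<pi> ?q] that q assms(3) permutation_permutes[of \<pi>] permutation_permutes[of ?q]
      by (auto simp: sign_swap_id)
    have "(\<Prod>i\<in>{..<r} - {k}. G i ((\<pi> \<circ> ?q) i)) = G j (\<pi> k) * (\<Prod>i\<in>{..<r} - {k} - {j}. G i ((\<pi> \<circ> ?q) i))"
      using assms by (subst prod.remove[of _ j]) auto
    also have "(\<Prod>i\<in>{..<r} - {k} - {j}. G i ((\<pi> \<circ> ?q) i)) = (\<Prod>i\<in>{..<r} - {k} - {j}. G i (\<pi> i))"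
      by (rule prod.cong) (auto simp: transpose_def)
    finally have 1: "(\<Prod>i\<in>{..<r} - {k}. G i ((\<pi> \<circ> ?q) i)) = G j (\<pi> k) * (\<Prod>i\<in>{..<r} - {k} - {j}. G i (\<pi> i))" .
    have 2: "(\<Prod>i\<in>{..<r} - {k}. G i (\<pi> i)) = G j (\<pi> j) * (\<Prod>i\<in>{..<r} - {k} - {j}. G i (\<pi> i))"
      using assms by (subst prod.remove[of _ j]) auto
    show ?thesis unfolding sg 1 2 by simp
  qed
  have "sum ?f {\<pi>. \<pi> permutes {..<r}} = (\<Sum>\<pi> | \<pi> permutes {..<r}. ?f (\<pi> \<circ> ?q))"
    by (rule sum_permutations_compose_right[OF q])
  also have "\<dots> = - sum ?f {\<pi>. \<pi> permutes {..<r}}"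
    unfolding sum_negf[symmetric] by (rule sum.cong) (use neg in auto)
  finally show ?thesis by simp
qed

text \<open>In the \<open>k\<close>-th summand row \<open>k\<close> is replaced by the combination
  of all rows \<open>j\<close> with coefficients \<open>C k j\<close>; by
  \<open>det_replaced_row\<close> only \<open>j = k\<close> contributes.\<close>

lemma jacobi_rows:
  fixes G :: "nat \<Rightarrow> nat \<Rightarrow> 'k::field_char_0"
  shows "(\<Sum>\<pi> | \<pi> permutes {..<r}. of_int (sign \<pi>) *
      (\<Sum>k<r. (\<Sum>j<r. C k j * G j (\<pi> k)) * (\<Prod>i\<in>{..<r} - {k}. G i (\<pi> i)))) =
    (\<Sum>k<r. C k k) * (\<Sum>\<pi> | \<pi> permutes {..<r}. of_int (sign \<pi>) * (\<Prod>i<r. G i (\<pi> i)))"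
proof -
  let ?P = "{\<pi>. \<pi> permutes {..<r}}"
  let ?D = "\<lambda>k j. \<Sum>\<pi>\<in>?P. of_int (sign \<pi>) * (G j (\<pi> k) * (\<Prod>i\<in>{..<r} - {k}. G i (\<pi> i)))"
  have "(\<Sum>\<pi>\<in>?P. of_int (sign \<pi>) * (\<Sum>k<r. (\<Sum>j<r. C k j * G j (\<pi> k)) * (\<Prod>i\<in>{..<r} - {k}. G i (\<pi> i)))) =
      (\<Sum>\<pi>\<in>?P. \<Sum>k<r. \<Sum>j<r. C k j * (of_int (sign \<pi>) * (G j (\<pi> k) * (\<Prod>i\<in>{..<r} - {k}. G i (\<pi> i)))))"
    by (simp add: sum_distrib_left sum_distrib_right mult_ac)
  also have "\<dots> = (\<Sum>k<r. \<Sum>j<r. \<Sum>\<pi>\<in>?P. C k j * (of_int (sign \<pi>) * (G j (\<pi> k) * (\<Prod>i\<in>{..<r} - {k}. G i (\<pi> i)))))"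
    by (subst sum.swap, rule sum.cong[OF refl], rule sum.swap)
  also have "\<dots> = (\<Sum>k<r. \<Sum>j<r. C k j * ?D k j)"
    by (simp add: sum_distrib_left)
  also have "\<dots> = (\<Sum>k<r. C k k * ?D k k)"
  proof (rule sum.cong[OF refl])
    fix k assume k: "k \<in> {..<r}"
    have "(\<Sum>j<r. C k j * ?D k j) = (\<Sum>j<r. if j = k then C k k * ?D k k else 0)"
      by (rule sum.cong[OF refl]) (use det_replaced_row[of k r _ G] k in auto)
    then show "(\<Sum>j<r. C k j * ?D k j) = C k k * ?D k k" using k by simp
  qed
  also have "\<dots> = (\<Sum>k<r. C k k) * (\<Sum>\<pi>\<in>?P. of_int (sign \<pi>) * (\<Prod>i<r. G i (\<pi> i)))"
    unfolding sum_distrib_right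
    by (rule sum.cong[OF refl]) (simp add: prod.remove[of "{..<r}"])
  finally show ?thesis .
qed

text \<open>Passing to inverse permutations exchanges rows and columns, and the symmetry of
  \<open>G\<close> turns the outcome into \<open>jacobi_rows\<close>.\<close>

lemma jacobi_columns:
  fixes G :: "nat \<Rightarrow> nat \<Rightarrow> 'k::field_char_0"
  assumes sym: "\<And>i j. i < r \<Longrightarrow> j < r \<Longrightarrow> G i j = G j i"
  shows "(\<Sum>\<pi> | \<pi> permutes {..<r}. of_int (sign \<pi>) *
      (\<Sum>k<r. (\<Sum>j<r. C (\<pi> k) j * G j k) * (\<Prod>i\<in>{..<r} - {k}. G i (\<pi> i)))) =
    (\<Sum>k<r. C k k) * (\<Sum>\<pi> | \<pi> permutes {..<r}. of_int (sign \<pi>) * (\<Prod>i<r. G i (\<pi> i)))" (is "sum ?f _ = _")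
proof -
  have "?f (inv \<pi>) = of_int (sign \<pi>) *
      (\<Sum>k<r. (\<Sum>j<r. C k j * G j (\<pi> k)) * (\<Prod>i\<in>{..<r} - {k}. G i (\<pi> i)))" if p: "\<pi> permutes {..<r}" for \<pi>
  proof -
    have sg: "sign (inv \<pi>) = sign \<pi>"
      using p by (metis finite_lessThan permutation_permutes sign_inverse)
    have ip: "inv \<pi> (\<pi> i) = i" for i using p permutes_inverses(2) by fast
    have lt: "i < r \<Longrightarrow> \<pi> i < r" for i using permutes_in_image[OF p, of i] by simp
    have bij: "bij_betw \<pi> {..<r} {..<r}" using permutes_imp_bij[OF p] .
    have "(\<Sum>k<r. (\<Sum>j<r. C (inv \<pi> k) j * G j k) * (\<Prod>i\<in>{..<r} - {k}. G i (inv \<pi> i))) =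
        (\<Sum>k<r. (\<Sum>j<r. C (inv \<pi> (\<pi> k)) j * G j (\<pi> k)) * (\<Prod>i\<in>{..<r} - {\<pi> k}. G i (inv \<pi> i)))"
      by (rule sum.reindex_bij_betw[OF bij, symmetric])
    also have "\<dots> = (\<Sum>k<r. (\<Sum>j<r. C k j * G j (\<pi> k)) * (\<Prod>i\<in>{..<r} - {k}. G i (\<pi> i)))"
    proof (rule sum.cong[OF refl])
      fix k assume k: "k \<in> {..<r}"
      have "bij_betw \<pi> ({..<r} - {k}) ({..<r} - {\<pi> k})"
        using bij k by (intro bij_betw_DiffI) (auto simp: bij_betw_def)
      then have "(\<Prod>i\<in>{..<r} - {\<pi> k}. G i (inv \<pi> i)) = (\<Prod>i\<in>{..<r} - {k}. G (\<pi> i) (inv \<pi> (\<pi> i)))"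
        by (rule prod.reindex_bij_betw[symmetric])
      also have "\<dots> = (\<Prod>i\<in>{..<r} - {k}. G i (\<pi> i))"
        by (rule prod.cong[OF refl]) (use ip sym lt in auto)
      finally show "(\<Sum>j<r. C (inv \<pi> (\<pi> k)) j * G j (\<pi> k)) * (\<Prod>i\<in>{..<r} - {\<pi> k}. G i (inv \<pi> i)) =
          (\<Sum>j<r. C k j * G j (\<pi> k)) * (\<Prod>i\<in>{..<r} - {k}. G i (\<pi> i))" by (simp add: ip)
    qed
    finally show ?thesis by (simp add: sg)
  qed
  then have "(\<Sum>\<pi> | \<pi> permutes {..<r}. ?f (inv \<pi>)) = (\<Sum>\<pi> | \<pi> permutes {..<r}. of_int (sign \<pi>) *
      (\<Sum>k<r. (\<Sum>j<r. C k j * G j (\<pi> k)) * (\<Prod>i\<in>{..<r} - {k}. G i (\<pi> i))))"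
    by (intro sum.cong[OF refl]) blast
  then show ?thesis
    unfolding sum_permutations_inverse[of ?f] jacobi_rows .
qed

section \<open>Orthonormal frames and projections\<close>

text \<open>A dimension count: otherwise \<open>v\<close> could be adjoined to the family, giving
  more independent vectors than there are members in the spanning family \<open>w\<close>.\<close>

lemma independent_family_spans:
  fixes u :: "'i \<Rightarrow> ('a, 'k::real_or_complex) tvec"
  assumes fin: "finite I" "finite J" and card: "card J \<le> card I"
    and sp: "\<And>i. i \<in> I \<Longrightarrow> u i \<in> tv.span (w ` J)"
    and ind: "\<And>a. (\<Sum>i\<in>I. a i \<odot> u i) = 0 \<Longrightarrow> \<forall>i\<in>I. a i = 0"
    and v: "v \<in> tv.span (w ` J)"
  obtains c where "v = (\<Sum>i\<in>I. c i \<odot> u i)"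
proof -
  have inj: "inj_on u I"
  proof (rule inj_onI, rule ccontr)
    fix i j assume ij: "i \<in> I" "j \<in> I" "u i = u j" "i \<noteq> j"
    \<comment> \<open>Independence is assumed for the indexed family, so a repeated vector has to be
      excluded: the coefficients 1 and -1 at its two indices would give a vanishing
      combination.\<close>
    let ?a = "\<lambda>k. if k = i then 1 else if k = j then -1 else (0::'k)"
    have "(\<Sum>k\<in>I. ?a k \<odot> u k) = (\<Sum>k\<in>{i, j}. ?a k \<odot> u k)"
      using ij(1,2) fin(1) by (intro sum.mono_neutral_right) auto
    also have "\<dots> = 1 \<odot> u i + (-1) \<odot> u j" using ij(4) by simp
    also have "\<dots> = 0" unfolding ij(3) by (rule ext) (simp add: tscale_apply)
    finally have "\<forall>k\<in>I. ?a k = 0" by (rule ind)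
    then have "?a i = 0" using ij(1) by (rule bspec)
    then show False by simp
  qed
  have ind': "tv.independent (u ` I)"
  proof
    assume dep: "tv.dependent (u ` I)"
    have "\<exists>a. (\<exists>v\<in>u ` I. a v \<noteq> 0) \<and> (\<Sum>v\<in>u ` I. a v \<odot> v) = 0"
      by (rule tv.dependent_finite[OF finite_imageI[OF fin(1)], THEN iffD1, OF dep])
    then obtain a where a: "\<exists>v\<in>u ` I. a v \<noteq> 0" "(\<Sum>v\<in>u ` I. a v \<odot> v) = 0" by (elim exE conjE)
    from a(2) have "(\<Sum>i\<in>I. a (u i) \<odot> u i) = 0" unfolding sum.reindex[OF inj] comp_def .
    from ind[OF this] a(1) show False by blast
  qed
  have "v \<in> tv.span (u ` I)"
  proof (rule ccontr)
    assume nv: "v \<notin> tv.span (u ` I)"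
    then have "v \<notin> u ` I" using tv.span_base[of v "u ` I"] by (rule contrapos_nn)
    have "tv.independent (insert v (u ` I))" by (rule tv.independent_insertI[OF nv ind'])
    moreover have "insert v (u ` I) \<subseteq> tv.span (w ` J)"
      by (rule insert_subsetI[OF v image_subsetI]) (rule sp)
    ultimately have "card (insert v (u ` I)) \<le> card (w ` J)"
      using tv.independent_span_bound[OF finite_imageI[OF fin(2)]] by blast
    also have "\<dots> \<le> card J" by (rule card_image_le[OF fin(2)])
    finally show False using \<open>v \<notin> u ` I\<close> fin(1) card by (simp add: card_image[OF inj])
  qed
  then obtain a where "v = (\<Sum>v\<in>u ` I. a v \<odot> v)"
    unfolding tv.span_finite[OF finite_imageI[OF fin(1)]] by (elim rangeE)
  then have "v = (\<Sum>i\<in>I. a (u i) \<odot> u i)" unfolding sum.reindex[OF inj] comp_def .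
  then show ?thesis by (rule that)
qed

section \<open>Symmetric forms and linear functions on a subspace\<close>

locale symmetric_form =
  fixes T :: "('a, 'k::real_or_complex) tvec set" and g :: "('a, 'k) tvec \<Rightarrow> ('a, 'k) tvec \<Rightarrow> 'k"
  assumes sub: "tv.subspace T"
    and sym: "x \<in> T \<Longrightarrow> y \<in> T \<Longrightarrow> g x y = g y x"
    and lin: "x \<in> T \<Longrightarrow> y \<in> T \<Longrightarrow> z \<in> T \<Longrightarrow> g (a \<odot> x + b \<odot> y) z = a * g x z + b * g y z"
begin

text \<open>A metric is constrained on tangent vectors alone, while its arguments range over all
  operators on functions; linearity is therefore relative to \<open>T\<close>.\<close>

definition linear_on :: "(('a, 'k) tvec \<Rightarrow> 'k) \<Rightarrow> bool" where
  "linear_on L \<longleftrightarrow> (\<forall>x\<in>T. \<forall>y\<in>T. \<forall>a b. L (a \<odot> x + b \<odot> y) = a * L x + b * L y)"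

lemma linear_onD: "linear_on L \<Longrightarrow> x \<in> T \<Longrightarrow> y \<in> T \<Longrightarrow> L (a \<odot> x + b \<odot> y) = a * L x + b * L y"
  unfolding linear_on_def by blast

lemma linear_on_0: "linear_on L \<Longrightarrow> L 0 = 0"
  using linear_onD[of L 0 0 0 0] tv.subspace_0[OF sub] by simp

lemma linear_on_add: "linear_on L \<Longrightarrow> x \<in> T \<Longrightarrow> y \<in> T \<Longrightarrow> L (x + y) = L x + L y"
  using linear_onD[of L x y 1 1] by simp

lemma linear_on_scale: "linear_on L \<Longrightarrow> x \<in> T \<Longrightarrow> L (a \<odot> x) = a * L x"
  using linear_onD[of L x x a 0] by simp

lemma linear_on_diff:
  assumes "linear_on L" "x \<in> T" "y \<in> T"
  shows "L (x - y) = L x - L y"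
proof -
  have e: "x - y = 1 \<odot> x + (-1) \<odot> y" by (rule ext) (simp add: tscale_apply)
  have "L (1 \<odot> x + (-1) \<odot> y) = 1 * L x + (-1) * L y" using assms unfolding linear_on_def by blast
  then show ?thesis unfolding e by simp
qed

lemma linear_on_sum:
  assumes "linear_on L" "\<And>i. i \<in> I \<Longrightarrow> x i \<in> T"
  shows "L (\<Sum>i\<in>I. a i \<odot> x i) = (\<Sum>i\<in>I. a i * L (x i))"
  using assms(2)
proof (induction I rule: infinite_finite_induct)
  case (insert i I)
  have "L (a i \<odot> x i + (\<Sum>i\<in>I. a i \<odot> x i)) = L (a i \<odot> x i) + L (\<Sum>i\<in>I. a i \<odot> x i)"
    by (rule linear_on_add[OF assms(1)]) (use insert in \<open>auto intro!: tv.subspace_sum[OF sub] tv.subspace_scale[OF sub]\<close>)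
  also have "\<dots> = a i * L (x i) + (\<Sum>i\<in>I. a i * L (x i))"
    using insert linear_on_scale[OF assms(1)] by simp
  finally show ?case unfolding sum.insert[OF insert.hyps(1,2)] .
qed (simp_all add: linear_on_0[OF assms(1)])

lemma linear_on_sum1:  assumes "linear_on L" "\<And>i. i \<in> I \<Longrightarrow> x i \<in> T"
  shows "L (\<Sum>i\<in>I. x i) = (\<Sum>i\<in>I. L (x i))"
  using linear_on_sum[OF assms, where a = "\<lambda>i. 1"] unfolding tv.scale_one mult_1 .

lemma linear_on_sum2:
  assumes L: "linear_on L" and x: "\<And>i. i \<in> I \<Longrightarrow> x i \<in> T" and y: "\<And>i. i \<in> I \<Longrightarrow> y i \<in> T"
  shows "L (\<Sum>i\<in>I. a i \<odot> x i + b i \<odot> y i) = (\<Sum>i\<in>I. a i * L (x i) + b i * L (y i))"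
proof -
  have "a i \<odot> x i + b i \<odot> y i \<in> T" if "i \<in> I" for i
    by (intro tv.subspace_add[OF sub] tv.subspace_scale[OF sub] x y that)
  then have "L (\<Sum>i\<in>I. a i \<odot> x i + b i \<odot> y i) = (\<Sum>i\<in>I. L (a i \<odot> x i + b i \<odot> y i))"
    by (rule linear_on_sum1[OF L])
  also have "\<dots> = (\<Sum>i\<in>I. a i * L (x i) + b i * L (y i))"
    by (rule sum.cong[OF refl]) (rule linear_onD[OF L x y])
  finally show ?thesis .
qed

lemma linear_g1: "y \<in> T \<Longrightarrow> linear_on (\<lambda>x. g x y)"
  unfolding linear_on_def using lin by blast

lemma linear_g2: "x \<in> T \<Longrightarrow> linear_on (g x)"
  unfolding linear_on_def
proof (intro ballI allI)
  fix y z a b assume x: "x \<in> T" and yz: "y \<in> T" "z \<in> T"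
  have "a \<odot> y + b \<odot> z \<in> T" using yz by (intro tv.subspace_add[OF sub] tv.subspace_scale[OF sub])
  then have "g x (a \<odot> y + b \<odot> z) = g (a \<odot> y + b \<odot> z) x" by (rule sym[OF x])
  also have "\<dots> = a * g x y + b * g x z" using lin[OF yz x] sym[OF x] yz by simp
  finally show "g x (a \<odot> y + b \<odot> z) = a * g x y + b * g x z" .
qed

definition bilinear_on :: "(('a, 'k) tvec \<Rightarrow> ('a, 'k) tvec \<Rightarrow> 'k) \<Rightarrow> bool" where
  "bilinear_on S \<longleftrightarrow> (\<forall>x\<in>T. linear_on (S x) \<and> linear_on (\<lambda>y. S y x))"

lemma bilinear_g: "bilinear_on g"
  unfolding bilinear_on_def using linear_g1 linear_g2 by blast

end

text \<open>Contractions rest on the resolution of the identity by the frame, so this is its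
  defining property here; orthonormality is assumed separately where a computation asks for
  it.\<close>

locale frame = symmetric_form T g
  for T :: "('a, 'k::real_or_complex) tvec set" and g +
  fixes e :: "'m::finite \<Rightarrow> ('a, 'k) tvec"
  assumes eT: "e i \<in> T"
    and expand: "x \<in> T \<Longrightarrow> x = (\<Sum>i\<in>UNIV. g x (e i) \<odot> e i)"
begin

lemma nondegenerate: "x \<in> T \<Longrightarrow> (\<And>y. y \<in> T \<Longrightarrow> g x y = 0) \<Longrightarrow> x = 0"
  using expand[of x] eT by simp

text \<open>The trace with respect to \<open>\<mu> g\<close>; for \<open>\<mu> = 1\<close> this is the independence of the frame.\<close>

lemma trace_conformal:
  fixes e' :: "'m \<Rightarrow> ('a, 'k) tvec"
  assumes S: "bilinear_on S" and e': "\<And>i. e' i \<in> T" and mu: "\<mu> \<noteq> 0"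
    and ex': "\<And>x. x \<in> T \<Longrightarrow> x = (\<Sum>i\<in>UNIV. (\<mu> * g x (e' i)) \<odot> e' i)"
    and on: "\<And>i j. g (e i) (e j) = (if i = j then 1 else 0)"
  shows "\<mu> * (\<Sum>i\<in>UNIV. S (e' i) (e' i)) = (\<Sum>i\<in>UNIV. S (e i) (e i))"
proof -
  \<comment> \<open>The transition matrix \<open>g (e' i) (e j)\<close> is orthogonal up to the
    factor \<open>\<mu>\<close>, as follows by inserting the expansion of \<open>e j\<close> in the
    frame \<open>e'\<close> into \<open>g (e j) (e k)\<close>.\<close>
  have 1: "\<mu> * (\<Sum>i\<in>UNIV. g (e' i) (e j) * g (e' i) (e k)) = (if j = k then 1 else 0)" for j k
  proof -
    have "g (e j) (e k) = g (\<Sum>i\<in>UNIV. (\<mu> * g (e j) (e' i)) \<odot> e' i) (e k)"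
      using ex'[OF eT, of j] by simp
    also have "\<dots> = (\<Sum>i\<in>UNIV. (\<mu> * g (e j) (e' i)) * g (e' i) (e k))"
      by (rule linear_on_sum[OF linear_g1[OF eT]]) (rule e')
    finally show ?thesis by (simp add: on sum_distrib_left mult.assoc sym[OF eT e'])
  qed
  have "S (e' i) (e' i) = (\<Sum>j\<in>UNIV. \<Sum>k\<in>UNIV. g (e' i) (e j) * g (e' i) (e k) * S (e j) (e k))" for i
  proof -
    have "S (e' i) (e' i) = S (\<Sum>j\<in>UNIV. g (e' i) (e j) \<odot> e j) (e' i)"
      using expand[OF e'] by simp
    also have "\<dots> = (\<Sum>j\<in>UNIV. g (e' i) (e j) * S (e j) (e' i))"
      by (rule linear_on_sum) (use S e' eT in \<open>auto simp: bilinear_on_def\<close>)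
    also have "\<dots> = (\<Sum>j\<in>UNIV. g (e' i) (e j) * S (e j) (\<Sum>k\<in>UNIV. g (e' i) (e k) \<odot> e k))"
      using expand[OF e'] by simp
    also have "\<dots> = (\<Sum>j\<in>UNIV. g (e' i) (e j) * (\<Sum>k\<in>UNIV. g (e' i) (e k) * S (e j) (e k)))"
      using linear_on_sum[of "S (e j)" UNIV e for j] S eT by (simp add: bilinear_on_def)
    finally show ?thesis by (simp add: sum_distrib_left mult.assoc)
  qed
  then have "\<mu> * (\<Sum>i\<in>UNIV. S (e' i) (e' i)) =
      \<mu> * (\<Sum>i\<in>UNIV. \<Sum>j\<in>UNIV. \<Sum>k\<in>UNIV. g (e' i) (e j) * g (e' i) (e k) * S (e j) (e k))" by simp
  also have "\<dots> = \<mu> * (\<Sum>j\<in>UNIV. \<Sum>k\<in>UNIV. \<Sum>i\<in>UNIV. g (e' i) (e j) * g (e' i) (e k) * S (e j) (e k))"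
  proof (rule arg_cong[where f = "(*) \<mu>"])
    show "(\<Sum>i\<in>UNIV. \<Sum>j\<in>UNIV. \<Sum>k\<in>UNIV. g (e' i) (e j) * g (e' i) (e k) * S (e j) (e k)) =
        (\<Sum>j\<in>UNIV. \<Sum>k\<in>UNIV. \<Sum>i\<in>UNIV. g (e' i) (e j) * g (e' i) (e k) * S (e j) (e k))"
      by (subst sum.swap, rule sum.cong[OF refl], rule sum.swap)
  qed
  also have "\<dots> = (\<Sum>j\<in>UNIV. \<Sum>k\<in>UNIV. (\<mu> * (\<Sum>i\<in>UNIV. g (e' i) (e j) * g (e' i) (e k))) * S (e j) (e k))"
    by (simp add: sum_distrib_left sum_distrib_right mult.assoc)
  also have "\<dots> = (\<Sum>i\<in>UNIV. S (e i) (e i))"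
    by (simp add: 1 if_distrib[of "\<lambda>t. t * _"] cong: if_cong)
  finally show ?thesis .
qed

end

text \<open>A self-adjoint projection \<open>\<pi>\<close> onto \<open>B\<close>, applied below both
  to the horizontal and to the vertical space. The vectors \<open>\<pi> (e i)\<close> are in general
  no basis of \<open>B\<close>, but they still resolve its identity and so compute traces over
  \<open>B\<close>.\<close>

locale frame_projection = frame T g e
  for T :: "('a, 'k::real_or_complex) tvec set" and g and e :: "'m::finite \<Rightarrow> ('a, 'k) tvec" +
  fixes B :: "('a, 'k) tvec set" and \<pi> :: "('a, 'k) tvec \<Rightarrow> ('a, 'k) tvec"
  assumes BT: "tv.subspace B" "B \<subseteq> T"
    and pB: "x \<in> T \<Longrightarrow> \<pi> x \<in> B"
    and pid: "x \<in> B \<Longrightarrow> \<pi> x = x"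
    and psym: "x \<in> T \<Longrightarrow> y \<in> T \<Longrightarrow> g (\<pi> x) y = g x (\<pi> y)"
begin

lemma pT: "x \<in> T \<Longrightarrow> \<pi> x \<in> T"
  using pB BT by blast

text \<open>Linearity is a consequence of self-adjointness: pairing the defect with any
  \<open>z\<close> moves \<open>\<pi>\<close> to \<open>z\<close>, where bilinearity of
  \<open>g\<close> makes it 0, and \<open>g\<close> is nondegenerate.\<close>

lemma pi_linear:
  assumes "x \<in> T" "y \<in> T"
  shows "\<pi> (a \<odot> x + b \<odot> y) = a \<odot> \<pi> x + b \<odot> \<pi> y"
proof -
  have s: "a \<odot> x + b \<odot> y \<in> T" "a \<odot> \<pi> x + b \<odot> \<pi> y \<in> T"
    using assms pT by (auto intro!: tv.subspace_add[OF sub] tv.subspace_scale[OF sub])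
  have "\<pi> (a \<odot> x + b \<odot> y) - (a \<odot> \<pi> x + b \<odot> \<pi> y) = 0"
  proof (rule nondegenerate)
    show "\<pi> (a \<odot> x + b \<odot> y) - (a \<odot> \<pi> x + b \<odot> \<pi> y) \<in> T"
      using s pT by (auto intro!: tv.subspace_diff[OF sub])
    fix z assume z: "z \<in> T"
    have "g (\<pi> (a \<odot> x + b \<odot> y) - (a \<odot> \<pi> x + b \<odot> \<pi> y)) z =
        g (\<pi> (a \<odot> x + b \<odot> y)) z - g (a \<odot> \<pi> x + b \<odot> \<pi> y) z"
      by (rule linear_on_diff[OF linear_g1[OF z]]) (use s pT in auto)
    also have "\<dots> = 0" using s assms pT z by (simp add: lin psym)
    finally show "g (\<pi> (a \<odot> x + b \<odot> y) - (a \<odot> \<pi> x + b \<odot> \<pi> y)) z = 0" .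
  qed
  then show ?thesis by (rule eq_iff_diff_eq_0[THEN iffD2])
qed

lemma pi_sum:
  assumes "\<And>i. i \<in> I \<Longrightarrow> x i \<in> T"
  shows "\<pi> (\<Sum>i\<in>I. a i \<odot> x i) = (\<Sum>i\<in>I. a i \<odot> \<pi> (x i))"
  using assms
proof (induction I rule: infinite_finite_induct)
  case (insert i I)
  have "\<pi> (a i \<odot> x i + 1 \<odot> (\<Sum>i\<in>I. a i \<odot> x i)) = a i \<odot> \<pi> (x i) + 1 \<odot> \<pi> (\<Sum>i\<in>I. a i \<odot> x i)"
    by (rule pi_linear) (use insert in \<open>auto intro!: tv.subspace_sum[OF sub] tv.subspace_scale[OF sub]\<close>)
  then show ?case unfolding sum.insert[OF insert.hyps(1,2)]
    using insert by (simp only: tv.scale_one insert_iff simp_thms)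
qed (use pid tv.subspace_0[OF BT(1)] in auto)

lemma expand_B: "b \<in> B \<Longrightarrow> b = (\<Sum>i\<in>UNIV. g b (e i) \<odot> \<pi> (e i))"
  using expand[of b] pid[of b] pi_sum[of UNIV e "\<lambda>i. g b (e i)"] eT BT by auto

lemma contraction:
  assumes "linear_on L" "b \<in> B"
  shows "(\<Sum>i\<in>UNIV. g b (e i) * L (\<pi> (e i))) = L b"
  using expand_B[OF assms(2)] linear_on_sum[OF assms(1), of UNIV "\<lambda>i. \<pi> (e i)" "\<lambda>i. g b (e i)"] pT eT by simp

text \<open>The Riesz representation on \<open>B\<close>; the projected frame supplies the
  representing vector.\<close>

lemma represent:
  assumes "linear_on L"
  obtains z where "z \<in> B" "\<And>w. w \<in> B \<Longrightarrow> L w = g z w"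
proof
  let ?z = "\<Sum>i\<in>UNIV. L (\<pi> (e i)) \<odot> \<pi> (e i)"
  show "?z \<in> B" using pB eT by (auto intro!: tv.subspace_sum[OF BT(1)] tv.subspace_scale[OF BT(1)])
  fix w assume w: "w \<in> B"
  have wT: "w \<in> T" using w BT by blast
  have "g ?z w = (\<Sum>i\<in>UNIV. L (\<pi> (e i)) * g (\<pi> (e i)) w)"
    by (rule linear_on_sum[OF linear_g1[OF wT]]) (rule pT[OF eT])
  also have "\<dots> = (\<Sum>i\<in>UNIV. g w (e i) * L (\<pi> (e i)))"
    by (simp add: psym[OF eT wT] pid[OF w] sym[OF eT wT] mult.commute)
  finally show "L w = g ?z w" using contraction[OF assms w] by simp
qed

lemma nondegenerate_B:
  assumes "b \<in> B" "\<And>w. w \<in> B \<Longrightarrow> g b w = 0"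
  shows "b = 0"
proof (rule nondegenerate)
  show "b \<in> T" using assms BT by blast
  fix y assume "y \<in> T"
  then show "g b y = 0" using psym[of b y] pid[OF assms(1)] assms pB BT by auto
qed

text \<open>Relative to \<open>g\<close> the form \<open>S\<close> is an endomorphism of
  \<open>B\<close>, and \<open>E\<close> is its matrix in the basis \<open>b\<close>. For
  \<open>S = g\<close> and the identity matrix the lemma yields the dimension of
  \<open>B\<close>.\<close>

lemma trace_basis:
  assumes S: "bilinear_on S" and fin: "finite J" and b: "\<And>j. j \<in> J \<Longrightarrow> b j \<in> B"
    and span: "\<And>x. x \<in> B \<Longrightarrow> \<exists>c. x = (\<Sum>j\<in>J. c j \<odot> b j)"
    and ind: "\<And>a. (\<Sum>j\<in>J. a j \<odot> b j) = 0 \<Longrightarrow> \<forall>j\<in>J. a j = 0"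
    and E: "\<And>k w. k \<in> J \<Longrightarrow> w \<in> B \<Longrightarrow> S (b k) w = (\<Sum>l\<in>J. E k l * g (b l) w)"
  shows "(\<Sum>i\<in>UNIV. S (\<pi> (e i)) (\<pi> (e i))) = (\<Sum>k\<in>J. E k k)"
proof -
  have bT: "\<And>j. j \<in> J \<Longrightarrow> b j \<in> T" using b BT by blast
  have "\<forall>i. \<exists>c. \<pi> (e i) = (\<Sum>j\<in>J. c j \<odot> b j)" using span pB eT by blast
  from choice[OF this] obtain \<theta> where th: "\<And>i. \<pi> (e i) = (\<Sum>j\<in>J. \<theta> i j \<odot> b j)" by blast
  \<comment> \<open>The coefficients \<open>\<theta>\<close> of the projected frame provide the dual
    basis: compare the coefficients of the basis in the expansion of \<open>b l\<close> over the
    projected frame.\<close>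
  have dual: "(\<Sum>i\<in>UNIV. g (b l) (e i) * \<theta> i k) = (if k = l then 1 else 0)" if "l \<in> J" "k \<in> J" for l k
  proof -
    have "b l = (\<Sum>i\<in>UNIV. g (b l) (e i) \<odot> (\<Sum>j\<in>J. \<theta> i j \<odot> b j))"
      using expand_B[OF b[OF that(1)]] th by simp
    also have "\<dots> = (\<Sum>i\<in>UNIV. \<Sum>j\<in>J. (g (b l) (e i) * \<theta> i j) \<odot> b j)"
      by (simp add: tv.scale_sum_right)
    also have "\<dots> = (\<Sum>j\<in>J. (\<Sum>i\<in>UNIV. g (b l) (e i) * \<theta> i j) \<odot> b j)"
      by (subst sum.swap) (simp add: tv.scale_sum_left)
    finally have "(\<Sum>j\<in>J. ((\<Sum>i\<in>UNIV. g (b l) (e i) * \<theta> i j) - (if j = l then 1 else 0)) \<odot> b j) = 0"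
      using that(1) fin by (simp add: tv.scale_left_diff_distrib sum_subtractf if_distrib[of "\<lambda>t. t \<odot> _"] cong: if_cong)
    from ind[OF this] that(2) show ?thesis by simp
  qed
  have "(\<Sum>i\<in>UNIV. S (\<pi> (e i)) (\<pi> (e i))) = (\<Sum>i\<in>UNIV. \<Sum>k\<in>J. \<theta> i k * S (b k) (\<pi> (e i)))"
  proof (rule sum.cong[OF refl])
    fix i
    have "S (\<pi> (e i)) (\<pi> (e i)) = S (\<Sum>j\<in>J. \<theta> i j \<odot> b j) (\<pi> (e i))" using th by simp
    also have "\<dots> = (\<Sum>k\<in>J. \<theta> i k * S (b k) (\<pi> (e i)))"
      by (rule linear_on_sum) (use S pT[OF eT] bT in \<open>auto simp: bilinear_on_def\<close>)
    finally show "S (\<pi> (e i)) (\<pi> (e i)) = (\<Sum>k\<in>J. \<theta> i k * S (b k) (\<pi> (e i)))" .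
  qed
  also have "\<dots> = (\<Sum>i\<in>UNIV. \<Sum>k\<in>J. \<Sum>l\<in>J. E k l * (g (b l) (e i) * \<theta> i k))"
  proof (intro sum.cong refl)
    fix i k assume k: "k \<in> J"
    have "g (b l) (\<pi> (e i)) = g (b l) (e i)" if "l \<in> J" for l
      using psym[OF bT[OF that] eT] pid[OF b[OF that]] by simp
    then show "\<theta> i k * S (b k) (\<pi> (e i)) = (\<Sum>l\<in>J. E k l * (g (b l) (e i) * \<theta> i k))"
      by (simp add: E[OF k pB[OF eT]] sum_distrib_left mult_ac)
  qed
  also have "\<dots> = (\<Sum>k\<in>J. \<Sum>l\<in>J. \<Sum>i\<in>UNIV. E k l * (g (b l) (e i) * \<theta> i k))"
    by (subst sum.swap, rule sum.cong[OF refl], rule sum.swap)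
  also have "\<dots> = (\<Sum>k\<in>J. \<Sum>l\<in>J. if l = k then E k k else 0)"
    by (intro sum.cong refl) (simp add: sum_distrib_left[symmetric] dual)
  also have "\<dots> = (\<Sum>k\<in>J. E k k)" using fin by simp
  finally show ?thesis .
qed

text \<open>Under the contraction self-adjointness moves \<open>\<pi>\<close> from the first slot to
  the second, where it meets its own complement and gives 0.\<close>

lemma trace_cross:  assumes S: "bilinear_on S"
  shows "(\<Sum>i\<in>UNIV. S (\<pi> (e i)) (e i - \<pi> (e i))) = 0"
proof -
  have S1: "linear_on (S x)" and S2: "linear_on (\<lambda>y. S y x)" if "x \<in> T" for x
    using S that unfolding bilinear_on_def by simp_all
  have d: "e i - \<pi> (e i) \<in> T" for i by (rule tv.subspace_diff[OF sub eT pT[OF eT]])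
  have gs: "g (\<pi> (e i)) (e j) = g (\<pi> (e j)) (e i)" for i j
    by (rule trans[OF psym[OF eT eT] sym[OF eT pT[OF eT]]])
  have "(\<Sum>i\<in>UNIV. S (\<pi> (e i)) (e i - \<pi> (e i))) =
      (\<Sum>i\<in>UNIV. \<Sum>j\<in>UNIV. g (\<pi> (e j)) (e i) * S (e j) (e i - \<pi> (e i)))"
  proof (rule sum.cong[OF refl])
    fix i
    have "S (\<pi> (e i)) (e i - \<pi> (e i)) = S (\<Sum>j\<in>UNIV. g (\<pi> (e i)) (e j) \<odot> e j) (e i - \<pi> (e i))"
      by (rule arg_cong[where f = "\<lambda>v. S v (e i - \<pi> (e i))", OF expand[OF pT[OF eT]]])
    also have "\<dots> = (\<Sum>j\<in>UNIV. g (\<pi> (e i)) (e j) * S (e j) (e i - \<pi> (e i)))"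
      by (rule linear_on_sum[OF S2[OF d]]) (rule eT)
    also have "\<dots> = (\<Sum>j\<in>UNIV. g (\<pi> (e j)) (e i) * S (e j) (e i - \<pi> (e i)))"
      by (simp only: gs[of i])
    finally show "S (\<pi> (e i)) (e i - \<pi> (e i)) = (\<Sum>j\<in>UNIV. g (\<pi> (e j)) (e i) * S (e j) (e i - \<pi> (e i)))" .
  qed
  also have "\<dots> = (\<Sum>j\<in>UNIV. \<Sum>i\<in>UNIV. g (\<pi> (e j)) (e i) * S (e j) (e i - \<pi> (e i)))"
    by (rule sum.swap)
  also have "\<dots> = (\<Sum>j\<in>(UNIV::'m set). 0)"
  proof (rule sum.cong[OF refl])
    fix j
    have "(\<Sum>i\<in>UNIV. g (\<pi> (e j)) (e i) * S (e j) (e i - \<pi> (e i))) =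
        (\<Sum>i\<in>UNIV. g (\<pi> (e j)) (e i) * S (e j) (e i)) - (\<Sum>i\<in>UNIV. g (\<pi> (e j)) (e i) * S (e j) (\<pi> (e i)))"
      unfolding linear_on_diff[OF S1[OF eT] eT pT[OF eT]] by (simp add: right_diff_distrib sum_subtractf)
    also have "(\<Sum>i\<in>UNIV. g (\<pi> (e j)) (e i) * S (e j) (e i)) = S (e j) (\<Sum>i\<in>UNIV. g (\<pi> (e j)) (e i) \<odot> e i)"
      by (rule linear_on_sum[OF S1[OF eT], symmetric]) (rule eT)
    also have "\<dots> = S (e j) (\<pi> (e j))" by (rule arg_cong[where f = "S (e j)", OF expand[OF pT[OF eT], symmetric]])
    also have "(\<Sum>i\<in>UNIV. g (\<pi> (e j)) (e i) * S (e j) (\<pi> (e i))) = S (e j) (\<pi> (e j))"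
      by (rule contraction[OF S1[OF eT] pB[OF eT]])
    finally show "(\<Sum>i\<in>UNIV. g (\<pi> (e j)) (e i) * S (e j) (e i - \<pi> (e i))) = 0" unfolding diff_self .
  qed
  finally show ?thesis by simp
qed

lemma trace_split:
  assumes S: "bilinear_on S"
  shows "(\<Sum>i\<in>UNIV. S (e i) (e i)) =
    (\<Sum>i\<in>UNIV. S (\<pi> (e i)) (\<pi> (e i))) + (\<Sum>i\<in>UNIV. S (e i - \<pi> (e i)) (e i - \<pi> (e i)))"
proof -
  have S1: "linear_on (S x)" and S2: "linear_on (\<lambda>y. S y x)" if "x \<in> T" for x
    using S that unfolding bilinear_on_def by simp_all
  have d: "e i - \<pi> (e i) \<in> T" for i by (rule tv.subspace_diff[OF sub eT pT[OF eT]])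
  have "bilinear_on (\<lambda>x y. S y x)" using S unfolding bilinear_on_def by simp
  from trace_cross[OF this] have 2: "(\<Sum>i\<in>UNIV. S (e i - \<pi> (e i)) (\<pi> (e i))) = 0" .
  have "S (e i) (e i) = S (\<pi> (e i)) (\<pi> (e i)) + S (\<pi> (e i)) (e i - \<pi> (e i)) +
      (S (e i - \<pi> (e i)) (\<pi> (e i)) + S (e i - \<pi> (e i)) (e i - \<pi> (e i)))" for i
    unfolding linear_on_diff[OF S1[OF pT[OF eT]] eT pT[OF eT]] linear_on_diff[OF S1[OF d] eT pT[OF eT]]
    unfolding linear_on_diff[OF S2[OF eT] eT pT[OF eT]] linear_on_diff[OF S2[OF pT[OF eT]] eT pT[OF eT]] by simp
  then show ?thesis using trace_cross[OF S] 2 by (simp add: sum.distrib)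
qed

text \<open>Gram-Schmidt applied to a given basis may meet isotropic vectors over the complex
  numbers. Instead a longest orthogonal family of non-isotropic vectors is taken; its orthogonal
  complement in \<open>B\<close> consists of isotropic vectors, so by polarisation \<open>g\<close>
  vanishes on it, and nondegeneracy on \<open>B\<close> makes it 0.\<close>

lemma orthogonal_basis:
  obtains r and u :: "nat \<Rightarrow> ('a, 'k) tvec"
  where "\<And>i. i < r \<Longrightarrow> u i \<in> B" "\<And>i j. i < r \<Longrightarrow> j < r \<Longrightarrow> i \<noteq> j \<Longrightarrow> g (u i) (u j) = 0"
    "\<And>i. i < r \<Longrightarrow> g (u i) (u i) \<noteq> 0"
    "\<And>x. x \<in> B \<Longrightarrow> \<exists>c. x = (\<Sum>i<r. c i \<odot> u i)"
    "\<And>a. (\<Sum>i<r. a i \<odot> u i) = 0 \<Longrightarrow> \<forall>i<r. a i = 0"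
proof -
  define P where "P r u \<longleftrightarrow> (\<forall>i<r. u i \<in> B \<and> g (u i) (u i) \<noteq> 0 \<and> (\<forall>j<r. i \<noteq> j \<longrightarrow> g (u i) (u j) = 0))"
    for r :: nat and u :: "nat \<Rightarrow> ('a, 'k) tvec"
  have coef: "g (\<Sum>i<r. a i \<odot> u i) (u j) = a j * g (u j) (u j)" if "P r u" "j < r" for r u a j
  proof -
    have uT: "\<And>i. i < r \<Longrightarrow> u i \<in> T" using that BT unfolding P_def by blast
    have "g (\<Sum>i<r. a i \<odot> u i) (u j) = (\<Sum>i<r. a i * g (u i) (u j))"
      by (rule linear_on_sum[OF linear_g1]) (use uT that in auto)
    also have "\<dots> = (\<Sum>i<r. if i = j then a j * g (u j) (u j) else 0)"
      by (rule sum.cong) (use that in \<open>auto simp: P_def\<close>)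
    finally show ?thesis using that by simp
  qed
  have ind: "\<forall>i<r. a i = 0" if "P r u" "(\<Sum>i<r. a i \<odot> u i) = 0" for r u a
  proof (intro allI impI)
    fix i assume i: "i < r"
    then have "u i \<in> T" using that(1) BT unfolding P_def by blast
    then have "g 0 (u i) = 0" using linear_on_0[OF linear_g1] by blast
    then show "a i = 0" using coef[OF that(1) i, of a] that i unfolding P_def by auto
  qed
  \<comment> \<open>In a longer family the first \<open>CARD('m)\<close> members would span
    \<open>T\<close>, so that the next one would be orthogonal to itself.\<close>
  have bound: "r \<le> CARD('m)" if "P r u" for r u
  proof (rule ccontr)
    assume r: "\<not> r \<le> CARD('m)"
    have sp: "x \<in> tv.span (range e)" if "x \<in> T" for x
      by (subst expand[OF that]) (intro tv.span_sum tv.span_scale tv.span_base rangeI)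
    have uT: "\<And>i. i < r \<Longrightarrow> u i \<in> T" using that BT unfolding P_def by blast
    obtain c where c: "u (CARD('m)) = (\<Sum>i<CARD('m). c i \<odot> u i)"
    proof (rule independent_family_spans[of "{..<CARD('m)}" UNIV u e "u (CARD('m))"])
      show "\<forall>i\<in>{..<CARD('m)}. a i = 0" if "(\<Sum>i<CARD('m). a i \<odot> u i) = 0" for a
        using ind[of "CARD('m)" u a] that \<open>P r u\<close> r unfolding P_def by auto
      show "u i \<in> tv.span (range e)" if "i \<in> {..<CARD('m)}" for i
        using sp[OF uT, of i] that r by simp
      show "u (CARD('m)) \<in> tv.span (range e)" using sp[OF uT] r by simp
    qed simp_all
    have "g (\<Sum>i<CARD('m). c i \<odot> u i) (u (CARD('m))) = (\<Sum>i<CARD('m). c i * g (u i) (u (CARD('m))))"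
      by (rule linear_on_sum[OF linear_g1]) (use uT r in auto)
    also have "\<dots> = 0" using that r unfolding P_def by (intro sum.neutral) auto
    finally have "g (u (CARD('m))) (u (CARD('m))) = 0" unfolding c[symmetric] .
    then show False using that r unfolding P_def by auto
  qed
  have "P 0 u" for u unfolding P_def by simp
  \<comment> \<open>The maximum exists because \<open>bound\<close> limits the length and the empty
    family is admissible.\<close>
  define r where "r = (GREATEST r. \<exists>u. P r u)"
  have b: "\<forall>s. (\<exists>u. P s u) \<longrightarrow> s \<le> CARD('m)" using bound by blast
  have r: "\<exists>u. P r u" "\<And>s. \<exists>u. P s u \<Longrightarrow> s \<le> r"
    unfolding r_def
    using GreatestI_nat[of "\<lambda>r. \<exists>u. P r u" 0 "CARD('m)"] Greatest_le_nat[of "\<lambda>r. \<exists>u. P r u" _ "CARD('m)"]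
      \<open>\<And>u. P 0 u\<close> b by blast+
  then obtain u where u: "P r u" by blast
  have uB: "\<And>i. i < r \<Longrightarrow> u i \<in> B" using u unfolding P_def by blast
  have uT: "\<And>i. i < r \<Longrightarrow> u i \<in> T" using uB BT by blast
  have unz: "\<And>i. i < r \<Longrightarrow> g (u i) (u i) \<noteq> 0" using u unfolding P_def by blast
  have uorth: "\<And>i j. i < r \<Longrightarrow> j < r \<Longrightarrow> i \<noteq> j \<Longrightarrow> g (u i) (u j) = 0" using u unfolding P_def by blast
  let ?f = "\<lambda>x. \<Sum>i<r. (g x (u i) / g (u i) (u i)) \<odot> u i"
  have fB: "?f x \<in> B" for x
    using uB by (auto intro!: tv.subspace_sum[OF BT(1)] tv.subspace_scale[OF BT(1)])
  have diff: "g (x - y) z = g x z - g y z" if "x \<in> T" "y \<in> T" "z \<in> T" for x y z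
    by (rule linear_on_diff[OF linear_g1[OF that(3)] that(1,2)])
  have orth: "g (x - ?f x) (u i) = 0" if "x \<in> B" "i < r" for x i
  proof -
    have "g (x - ?f x) (u i) = g x (u i) - g (?f x) (u i)"
      by (rule diff) (use that BT fB[of x] uT in blast)+
    also have "\<dots> = g x (u i) - g x (u i) / g (u i) (u i) * g (u i) (u i)"
      unfolding coef[OF u that(2), of "\<lambda>i. g x (u i) / g (u i) (u i)"] ..
    also have "\<dots> = 0" using unz that(2) by simp
    finally show ?thesis .
  qed
  \<comment> \<open>Otherwise \<open>w\<close> could be appended to the family, against its
    maximality.\<close>
  have iso: "g w w = 0" if w: "w \<in> B" "\<And>i. i < r \<Longrightarrow> g w (u i) = 0" for w
  proof (rule ccontr)
    assume nz: "g w w \<noteq> 0"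
    have wT: "w \<in> T" using w BT by blast
    have "P (Suc r) (u(r := w))"
      unfolding P_def
    proof (intro allI impI conjI)
      fix i assume i: "i < Suc r"
      show "(u(r := w)) i \<in> B" "g ((u(r := w)) i) ((u(r := w)) i) \<noteq> 0"
        using i nz w(1) uB unz by (cases "i = r"; simp)+
      fix j assume j: "j < Suc r" "i \<noteq> j"
      show "g ((u(r := w)) i) ((u(r := w)) j) = 0"
      proof (cases "i = r \<or> j = r")
        case True
        then show ?thesis using i j w(2) sym[OF uT wT] by auto
      next
        case False
        then show ?thesis using i j uorth[of i j] by simp
      qed
    qed
    then have "Suc r \<le> r" by (intro r(2)) blast
    then show False by simp
  qed
  have perp: "g w (?f y) = 0" if w: "w \<in> B" "\<And>i. i < r \<Longrightarrow> g w (u i) = 0" for w y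
  proof -
    have "w \<in> T" using w(1) BT by blast
    from linear_on_sum[OF linear_g2[OF this], of "{..<r}" u "\<lambda>i. g y (u i) / g (u i) (u i)"] uT w(2)
    show ?thesis by simp
  qed
  obtain f where f: "\<And>x. x \<in> B \<Longrightarrow> f x \<in> B" "\<And>x i. x \<in> B \<Longrightarrow> i < r \<Longrightarrow> g (x - f x) (u i) = 0"
    "\<And>w y. w \<in> B \<Longrightarrow> (\<And>i. i < r \<Longrightarrow> g w (u i) = 0) \<Longrightarrow> g w (f y) = 0"
    "\<And>x. \<exists>c. f x = (\<Sum>i<r. c i \<odot> u i)"
  proof (rule that[of ?f])
    show "\<exists>c. ?f x = (\<Sum>i<r. c i \<odot> u i)" for x by (rule exI, rule refl)
    show "?f x \<in> B" for x by (rule fB)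
    show "g (x - ?f x) (u i) = 0" if "x \<in> B" "i < r" for x i by (rule orth[OF that])
    show "g w (?f y) = 0" if "w \<in> B" "\<And>i. i < r \<Longrightarrow> g w (u i) = 0" for w y by (rule perp[OF that])
  qed
  have span: "x = f x" if x: "x \<in> B" for x
  proof -
    define w where "w = x - f x"
    have w: "w \<in> B" unfolding w_def using x f(1) by (intro tv.subspace_diff[OF BT(1)])
    have ow: "g w (u i) = 0" if "i < r" for i using f(2)[OF x that] unfolding w_def .
    have "w = 0"
    proof (rule nondegenerate_B[OF w])
      fix y assume y: "y \<in> B"
      define z where "z = y - f y"
      have z: "z \<in> B" unfolding z_def using y f(1) by (intro tv.subspace_diff[OF BT(1)])
      have oz: "g z (u i) = 0" if "i < r" for i using f(2)[OF y that] unfolding z_def .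
      have s: "w + z \<in> B" by (rule tv.subspace_add[OF BT(1) w z])
      have T: "w \<in> T" "z \<in> T" "w + z \<in> T" using w z s BT by blast+
      have lw: "g (w + z) v = g w v + g z v" if "v \<in> T" for v
        by (rule linear_on_add[OF linear_g1[OF that] T(1,2)])
      \<comment> \<open>Polarisation: since \<open>w\<close>, \<open>z\<close> and
        \<open>w + z\<close> are isotropic, \<open>2 * g w z\<close> vanishes. As \<open>w\<close>
        is also orthogonal to the family, it is orthogonal to all of \<open>B\<close>.\<close>
      have "g (w + z) (w + z) = 0"
      proof (rule iso[OF s])
        fix i assume "i < r"
        then show "g (w + z) (u i) = 0" unfolding lw[OF uT[OF \<open>i < r\<close>]] using ow oz by simp
      qed
      then have "g w w + g w z + (g z w + g z z) = 0"
        unfolding lw[OF T(3)] linear_on_add[OF linear_g2[OF T(1)] T(1,2)] linear_on_add[OF linear_g2[OF T(2)] T(1,2)] .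
      moreover have "g w w = 0" "g z z = 0" using iso[OF w] iso[OF z] ow oz by blast+
      ultimately have wz: "g w z = 0" using sym[OF T(1,2)] by simp
      have "g w z = g w y - g w (f y)" unfolding z_def
        by (rule linear_on_diff[OF linear_g2[OF T(1)]]) (use y f(1) BT in blast)+
      then show "g w y = 0" using wz f(3)[OF w ow] by simp
    qed
    then show ?thesis unfolding w_def by (rule eq_iff_diff_eq_0[THEN iffD2])
  qed
  show ?thesis
  proof (rule that[of r u])
    show "\<exists>c. x = (\<Sum>i<r. c i \<odot> u i)" if "x \<in> B" for x using f(4)[of x] span[OF that] by simp
    show "\<forall>i<r. a i = 0" if "(\<Sum>i<r. a i \<odot> u i) = 0" for a by (rule ind[OF u that])
  qed (use uB uorth unz in blast)+
qed

end


lemma det_nonzeroI: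
  fixes B :: "'i::finite \<Rightarrow> 'i \<Rightarrow> 'k::field"
  assumes "\<And>c j. (\<And>i. (\<Sum>j\<in>UNIV. B i j * c j) = 0) \<Longrightarrow> c j = 0"
  shows "det (\<chi> i j. B i j) \<noteq> 0"
proof -
  have "\<forall>x. (\<chi> i j. B i j) *v x = 0 \<longrightarrow> x = 0"
  proof (intro allI impI)
    fix x :: "'k ^ 'i" assume "(\<chi> i j. B i j) *v x = 0"
    then have "\<And>i. (\<Sum>j\<in>UNIV. B i j * x $ j) = 0"
      by (simp add: matrix_vector_mult_def vec_eq_iff)
    then show "x = 0" using assms[of "\<lambda>j. x $ j"] by (simp add: vec_eq_iff)
  qed
  then show ?thesis
    using matrix_left_invertible_ker invertible_left_inverse invertible_det_nz by blast
qed


section \<open>Weyl spaces\<close>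

locale weyl =
  fixes cat :: category and M :: "('a::topological_space, 'k::real_or_complex, 'm::finite) weyl"
  assumes weyl: "weyl_space cat M"
begin

sublocale mfd cat "atlas M"
  using weyl by unfold_locales (simp add: weyl_space_def)

lemma confD:
  assumes "(W, g) \<in> conf M"
  shows conf_local_metric: "local_metric cat (atlas M) W g"
    and conf_conformal_on: "(W', g') \<in> conf M \<Longrightarrow> conformal_on cat (atlas M) (W \<inter> W') g g'"
proof -
  have "conf M = {(W, g). local_metric cat (atlas M) W g \<and> (\<forall>(W', g')\<in>conf M. conformal_on cat (atlas M) (W \<inter> W') g g')}"
    using weyl unfolding weyl_space_def conformal_structure_def by (elim conjE)
  then have "conf M \<subseteq> {(W, g). local_metric cat (atlas M) W g \<and> (\<forall>(W', g')\<in>conf M. conformal_on cat (atlas M) (W \<inter> W') g g')}"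
    by (rule equalityD1)
  from subsetD[OF this assms]
  have *: "local_metric cat (atlas M) W g \<and> (\<forall>(W', g')\<in>conf M. conformal_on cat (atlas M) (W \<inter> W') g g')"
    by simp
  then show "local_metric cat (atlas M) W g" ..
  from * show "(W', g') \<in> conf M \<Longrightarrow> conformal_on cat (atlas M) (W \<inter> W') g g'" by fast
qed

lemma conf_cover:
  assumes "p \<in> points M"
  obtains W g where "(W, g) \<in> conf M" "p \<in> W"
proof -
  have "(\<Union>(W, g)\<in>conf M. W) = points M"
    using weyl unfolding weyl_space_def conformal_structure_def by blast
  with assms show ?thesis using that by blast
qed

lemma conf_conformal:
  assumes "(W, g) \<in> conf M" "(W', g') \<in> conf M" "p \<in> W" "p \<in> W'"
  shows "\<exists>c. c \<noteq> 0 \<and> (\<forall>x\<in>tangent M p. \<forall>y\<in>tangent M p. g' p x y = c * g p x y)"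
proof -
  have "conformal_on cat (atlas M) (W \<inter> W') g g'" by (rule conf_conformal_on[OF assms(1,2)])
  then obtain \<mu> where "\<forall>p\<in>W \<inter> W'. conformal_factor (\<mu> p) \<and>
     (\<forall>x\<in>tangent M p. \<forall>y\<in>tangent M p. g' p x y = \<mu> p * g p x y)"
    unfolding conformal_on_def by blast
  then have "\<mu> p \<noteq> 0" "\<forall>x\<in>tangent M p. \<forall>y\<in>tangent M p. g' p x y = \<mu> p * g p x y"
    using assms(3,4) by (auto simp: conformal_factor_def)
  then show ?thesis by (intro exI conjI)
qed

lemma conf_open: "(W, g) \<in> conf M \<Longrightarrow> open W"
  and conf_points: "(W, g) \<in> conf M \<Longrightarrow> p \<in> W \<Longrightarrow> p \<in> points M"
  using conf_local_metric unfolding local_metric_def by blast+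

lemma conf_eventually: "(W, g) \<in> conf M \<Longrightarrow> p \<in> W \<Longrightarrow> \<forall>\<^sub>F q in nhds p. q \<in> W"
  using conf_open eventually_nhds by blast

lemma conf_form:
  assumes "(W, g) \<in> conf M" "p \<in> W"
  shows "symmetric_form (tangent M p) (g p)"
  using conf_local_metric[OF assms(1)] assms(2) tangent_subspace[OF conf_points[OF assms]]
  unfolding local_metric_def symmetric_form_def by blast

lemma conf_frame_exists:
  assumes "(W, g) \<in> conf M" "p \<in> W"
  obtains e where "orthonormal_frame (atlas M) g p e"
  using conf_local_metric[OF assms(1)] assms(2) unfolding local_metric_def by blast

lemma tangent_span: "v \<in> tangent_space (atlas M) p \<Longrightarrow> (U, x) \<in> atlas M \<Longrightarrow> p \<in> U \<Longrightarrow>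
    v \<in> tv.span (range (\<lambda>i. coord_field (atlas M) (U, x) i p))"
  by (subst tangent_eq_sum, assumption+) (intro tv.span_sum tv.span_scale tv.span_base rangeI)

text \<open>Orthonormal vectors are independent, and there are as many of them as coordinate
  vectors, so they span; pairing with \<open>e j\<close> recovers the coefficients.\<close>

lemma conf_frame:
  assumes "(W, g) \<in> conf M" "p \<in> W" "orthonormal_frame (atlas M) g p e"
  shows "frame (tangent M p) (g p) e"
proof -
  interpret f: symmetric_form "tangent M p" "g p" by (rule conf_form[OF assms(1,2)])
  obtain U x where c: "(U, x) \<in> atlas M" "p \<in> U" using carrierE[OF conf_points[OF assms(1,2)]] .
  have eT: "\<And>i. e i \<in> tangent M p" and on: "\<And>i j. g p (e i) (e j) = (if i = j then 1 else 0)"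
    using assms(3) unfolding orthonormal_frame_def by blast+
  have coef: "g p (\<Sum>i\<in>UNIV. a i \<odot> e i) (e j) = a j" for a j
    using f.linear_on_sum[OF f.linear_g1[OF eT], of UNIV e a j] eT by (simp add: on if_distrib[of "\<lambda>t. _ * t"] cong: if_cong)
  have ind: "\<forall>i\<in>UNIV. a i = 0" if "(\<Sum>i\<in>UNIV. a i \<odot> e i) = 0" for a
    using coef[of a] f.linear_on_0[OF f.linear_g1[OF eT]] unfolding that by simp
  show ?thesis
  proof unfold_locales
    fix v assume v: "v \<in> tangent M p"
    obtain a where a: "v = (\<Sum>i\<in>UNIV. a i \<odot> e i)"
      by (rule independent_family_spans[OF finite finite order_refl _ ind tangent_span[OF v c]])
        (rule tangent_span[OF eT c])
    show "v = (\<Sum>i\<in>UNIV. g p v (e i) \<odot> e i)" unfolding a coef ..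
  qed (rule eT)
qed

lemma conf_nondegenerate:
  assumes "(W, g) \<in> conf M" "p \<in> W" "x \<in> tangent M p" "\<And>y. y \<in> tangent M p \<Longrightarrow> g p x y = 0"
  shows "x = 0"
proof -
  obtain e where "orthonormal_frame (atlas M) g p e" using conf_frame_exists[OF assms(1,2)] .
  then interpret frame "tangent M p" "g p" e by (rule conf_frame[OF assms(1,2)])
  show ?thesis using nondegenerate assms by blast
qed

lemma metric_smooth:
  assumes c: "(W, g) \<in> conf M" "p \<in> W" and Y: "field_near (atlas M) p Y" and Z: "field_near (atlas M) p Z"
  shows "smooth_at (atlas M) p (\<lambda>q. g q (Y q) (Z q))"
proof -
  note pp = conf_points[OF c]
  obtain U x where ch: "(U, x) \<in> atlas M" "p \<in> U" using carrierE[OF pp] .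
  let ?d = "coord_field (atlas M) (U, x)"
  have reg: "reg_on Smooth (atlas M) (W \<inter> U) (\<lambda>p. g p (?d i p) (?d j p))" for i j
  proof -
    have "\<forall>\<kappa>\<in>atlas M. \<forall>i j. reg_on cat (atlas M) (W \<inter> fst \<kappa>)
        (\<lambda>p. g p (coord_field (atlas M) \<kappa> i p) (coord_field (atlas M) \<kappa> j p))"
      using conf_local_metric[OF c(1)] unfolding local_metric_def by (elim conjE)
    from this[rule_format, OF ch(1)] show ?thesis unfolding fst_conv by (rule reg_on_imp_Smooth)
  qed
  then have gs: "smooth_at (atlas M) p (\<lambda>p. g p (?d i p) (?d j p))" for i j
    unfolding reg_on_Smooth_iff using c(2) ch(2) by blast
  have "smooth_at (atlas M) p (\<lambda>q. \<Sum>i\<in>UNIV. Y q (\<lambda>r. x r $ i) * (\<Sum>j\<in>UNIV. Z q (\<lambda>r. x r $ j) * g q (?d i q) (?d j q)))"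
    by (intro smooth_at_sum smooth_at_mult field_near_coord[OF Y ch] field_near_coord[OF Z ch] gs pp)
  moreover have "\<forall>\<^sub>F q in nhds p. g q (Y q) (Z q) =
      (\<Sum>i\<in>UNIV. Y q (\<lambda>r. x r $ i) * (\<Sum>j\<in>UNIV. Z q (\<lambda>r. x r $ j) * g q (?d i q) (?d j q)))"
    using field_near_eventually_tangent[OF Y] field_near_eventually_tangent[OF Z] eventually_chart[OF ch] conf_eventually[OF c]
  proof eventually_elim
    case (elim q)
    interpret f: symmetric_form "tangent M q" "g q" by (rule conf_form[OF c(1) elim(4)])
    have d: "\<And>i. ?d i q \<in> tangent M q" by (rule coord_field_tangent[OF ch(1) elim(3)])
    have "g q (Y q) (Z q) = g q (\<Sum>i\<in>UNIV. Y q (\<lambda>r. x r $ i) \<odot> ?d i q) (Z q)"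
      using tangent_eq_sum[OF elim(1) ch(1) elim(3)] by simp
    also have "\<dots> = (\<Sum>i\<in>UNIV. Y q (\<lambda>r. x r $ i) * g q (?d i q) (Z q))"
      by (rule f.linear_on_sum[OF f.linear_g1[OF elim(2)]]) (rule d)
    also have "\<dots> = (\<Sum>i\<in>UNIV. Y q (\<lambda>r. x r $ i) * g q (?d i q) (\<Sum>j\<in>UNIV. Z q (\<lambda>r. x r $ j) \<odot> ?d j q))"
      using tangent_eq_sum[OF elim(2) ch(1) elim(3)] by simp
    also have "\<dots> = (\<Sum>i\<in>UNIV. Y q (\<lambda>r. x r $ i) * (\<Sum>j\<in>UNIV. Z q (\<lambda>r. x r $ j) * g q (?d i q) (?d j q)))"
      by (intro sum.cong refl arg_cong[where f = "(*) _"] f.linear_on_sum[OF f.linear_g2[OF d]]) (rule d)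
    finally show ?case .
  qed
  ultimately show ?thesis by (rule smooth_at_transfer)
qed

section \<open>Weyl connections: torsion, Lee form and gradients\<close>

lemma conn_props:
  assumes "x \<in> tangent M p" "field_near (atlas M) p Y"
  shows conn_tangent: "conn M p x Y \<in> tangent M p"
    and conn_dir: "x' \<in> tangent M p \<Longrightarrow> conn M p (a \<odot> x + b \<odot> x') Y = a \<odot> conn M p x Y + b \<odot> conn M p x' Y"
    and conn_add: "field_near (atlas M) p Z \<Longrightarrow> conn M p x (\<lambda>q. Y q + Z q) = conn M p x Y + conn M p x Z"
    and conn_scale: "smooth_at (atlas M) p f \<Longrightarrow> conn M p x (\<lambda>q. f q \<odot> Y q) = x f \<odot> Y p + f p \<odot> conn M p x Y"
    and conn_cong: "\<forall>\<^sub>F q in nhds p. Z q = Y q \<Longrightarrow> conn M p x Z = conn M p x Y"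
proof -
  have "linear_connection cat (atlas M) (conn M)" using weyl by (simp add: weyl_space_def)
  then have *: "conn M p x Y \<in> tangent M p \<and>
        (\<forall>x'\<in>tangent M p. \<forall>a b. conn M p (a \<odot> x + b \<odot> x') Y = a \<odot> conn M p x Y + b \<odot> conn M p x' Y) \<and>
        (\<forall>Z. field_near (atlas M) p Z \<longrightarrow> conn M p x (Y + Z) = conn M p x Y + conn M p x Z) \<and>
        (\<forall>f. smooth_at (atlas M) p f \<longrightarrow> conn M p x (\<lambda>q. f q \<odot> Y q) = x f \<odot> Y p + f p \<odot> conn M p x Y) \<and>
        (\<forall>W Z. open W \<and> p \<in> W \<and> (\<forall>q\<in>W. Z q = Y q) \<longrightarrow> conn M p x Z = conn M p x Y)"
    using assms tangent_carrier[OF assms(1)] unfolding linear_connection_def by simp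
  note c = *[THEN conjunct1] *[THEN conjunct2, THEN conjunct1] *[THEN conjunct2, THEN conjunct2, THEN conjunct1]
    *[THEN conjunct2, THEN conjunct2, THEN conjunct2, THEN conjunct1]
    *[THEN conjunct2, THEN conjunct2, THEN conjunct2, THEN conjunct2]
  show "conn M p x Y \<in> tangent M p" by (rule c(1))
  show "x' \<in> tangent M p \<Longrightarrow> conn M p (a \<odot> x + b \<odot> x') Y = a \<odot> conn M p x Y + b \<odot> conn M p x' Y"
    by (rule c(2)[rule_format])
  show "field_near (atlas M) p Z \<Longrightarrow> conn M p x (\<lambda>q. Y q + Z q) = conn M p x Y + conn M p x Z"
    using c(3)[rule_format, of Z] unfolding plus_fun_def[of Y Z] .
  show "smooth_at (atlas M) p f \<Longrightarrow> conn M p x (\<lambda>q. f q \<odot> Y q) = x f \<odot> Y p + f p \<odot> conn M p x Y"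
    by (rule c(4)[rule_format])
  assume "\<forall>\<^sub>F q in nhds p. Z q = Y q"
  then obtain O' where "open O'" "p \<in> O'" "\<forall>q\<in>O'. Z q = Y q" unfolding eventually_nhds by (elim exE conjE)
  then show "conn M p x Z = conn M p x Y" using c(5)[rule_format, of O' Z] by blast
qed

lemma conn_dir_0:
  assumes "field_near (atlas M) p Y"
  shows "conn M p 0 Y = 0"
proof -
  have z: "0 \<in> tangent M p" by (rule tangent_0[OF field_near_carrier[OF assms]])
  from conn_dir[OF z assms z, of 0 0] show ?thesis by (simp only: tv.scale_zero_left add_0_left)
qed

lemma conn_dir_sum:
  assumes Y: "field_near (atlas M) p Y" and "finite I" and v: "\<And>i. i \<in> I \<Longrightarrow> v i \<in> tangent M p"
  shows "conn M p (\<Sum>i\<in>I. a i \<odot> v i) Y = (\<Sum>i\<in>I. a i \<odot> conn M p (v i) Y)"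
  using assms(2) v
proof (induction I rule: finite_induct)
  case empty
  show ?case by (simp only: sum.empty conn_dir_0[OF Y])
next
  case (insert i I)
  have vi: "v i \<in> tangent M p" by (rule insert.prems) (rule insertI1)
  have vI: "\<And>j. j \<in> I \<Longrightarrow> v j \<in> tangent M p" by (rule insert.prems) (rule insertI2)
  have s: "(\<Sum>i\<in>I. a i \<odot> v i) \<in> tangent M p"
    by (rule tangent_sum[OF field_near_carrier[OF Y] tangent_scale[OF vI]])
  have IH: "conn M p (\<Sum>i\<in>I. a i \<odot> v i) Y = (\<Sum>i\<in>I. a i \<odot> conn M p (v i) Y)"
    by (rule insert.IH) (rule vI)
  from conn_dir[OF vi Y s, of "a i" 1] show ?case
    unfolding sum.insert[OF insert.hyps] IH tv.scale_one .
qed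

lemma torsion:
  assumes "field_near (atlas M) p X" "field_near (atlas M) p Y"
  shows "conn M p (X p) Y - conn M p (Y p) X = lie_bracket (atlas M) X Y p"
proof -
  have "torsion_free (atlas M) (conn M)" using weyl by (simp add: weyl_space_def)
  then show ?thesis using assms field_near_carrier[OF assms(1)] unfolding torsion_free_def by blast
qed

lemma lie_bracket_tangent:
  assumes "field_near (atlas M) p X" "field_near (atlas M) p Y"
  shows "lie_bracket (atlas M) X Y p \<in> tangent M p"
  unfolding torsion[OF assms, symmetric]
  by (rule tangent_minus[OF conn_tangent[OF field_near_tangent[OF assms(1)] assms(2)]
    conn_tangent[OF field_near_tangent[OF assms(2)] assms(1)]])

text \<open>The symmetry of second derivatives is not needed here: by torsion-freeness the bracket is a
  tangent vector, so that it suffices to evaluate it on the coordinates.\<close>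

lemma coord_bracket:
  assumes "(U, x) \<in> atlas M" "p \<in> U"
  shows "conn M p (coord_field (atlas M) (U, x) i p) (coord_field (atlas M) (U, x) j) =
    conn M p (coord_field (atlas M) (U, x) j p) (coord_field (atlas M) (U, x) i)"
proof -
  let ?d = "coord_field (atlas M) (U, x)"
  note d = coord_field_near[OF assms]
  have c: "?d i p (\<lambda>q. ?d j q (\<lambda>q. x q $ k)) = 0" for i j k
  proof -
    have "?d i p (\<lambda>q. ?d j q (\<lambda>q. x q $ k)) = ?d i p (\<lambda>q. if j = k then 1 else 0)"
      by (rule tangent_cong[OF field_near_tangent[OF d]], rule eventually_mono[OF eventually_chart[OF assms]])
        (rule coord_field_coord[OF assms(1)])
    then show ?thesis using tangent_const[OF field_near_tangent[OF d]] by simp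
  qed
  have "lie_bracket (atlas M) (?d i) (?d j) p = 0"
    by (rule tangent_eqI[OF lie_bracket_tangent[OF d d] tangent_0 assms])
      (use chart_carrier assms c smooth_at_chart[OF assms] in \<open>auto simp: lie_bracket_def\<close>)
  then have "conn M p (?d i p) (?d j) - conn M p (?d j p) (?d i) = 0"
    unfolding torsion[OF d d] .
  then show ?thesis by (rule eq_iff_diff_eq_0[THEN iffD2])
qed

lemma lee_form:
  assumes "(W, g) \<in> conf M" "p \<in> W" "x \<in> tangent M p"
  obtains a where "\<And>Y Z. field_near (atlas M) p Y \<Longrightarrow> field_near (atlas M) p Z \<Longrightarrow>
    x (\<lambda>q. g q (Y q) (Z q)) = g p (conn M p x Y) (Z p) + g p (Y p) (conn M p x Z) - 2 * a * g p (Y p) (Z p)"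
proof -
  have "\<forall>(W, g)\<in>conf M. \<forall>p\<in>W. \<forall>x\<in>tangent M p. \<exists>a. \<forall>Y Z.
        field_near (atlas M) p Y \<and> field_near (atlas M) p Z \<longrightarrow>
        x (\<lambda>q. g q (Y q) (Z q)) - g p (conn M p x Y) (Z p) - g p (Y p) (conn M p x Z)
          = - 2 * a * g p (Y p) (Z p)"
    using weyl unfolding weyl_space_def by blast
  then have "\<exists>a. \<forall>Y Z. field_near (atlas M) p Y \<and> field_near (atlas M) p Z \<longrightarrow>
        x (\<lambda>q. g q (Y q) (Z q)) - g p (conn M p x Y) (Z p) - g p (Y p) (conn M p x Z)
          = - 2 * a * g p (Y p) (Z p)"
    using assms by blast
  then obtain a where a: "\<forall>Y Z. field_near (atlas M) p Y \<and> field_near (atlas M) p Z \<longrightarrow>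
        x (\<lambda>q. g q (Y q) (Z q)) - g p (conn M p x Y) (Z p) - g p (Y p) (conn M p x Z)
          = - 2 * a * g p (Y p) (Z p)" ..
  show ?thesis
  proof (rule that[of a])
    fix Y Z assume "field_near (atlas M) p Y" "field_near (atlas M) p Z"
    with a have "x (\<lambda>q. g q (Y q) (Z q)) - g p (conn M p x Y) (Z p) - g p (Y p) (conn M p x Z)
          = - 2 * a * g p (Y p) (Z p)" by blast
    then show "x (\<lambda>q. g q (Y q) (Z q)) = g p (conn M p x Y) (Z p) + g p (Y p) (conn M p x Z) - 2 * a * g p (Y p) (Z p)"
      by (simp add: algebra_simps)
  qed
qed

text \<open>In a chart the components of the gradient solve the linear system whose matrix is that
  of the metric. These fields are the building blocks of smooth horizontal fields.\<close>

lemma gradient: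
  assumes c: "(W, g) \<in> conf M" "p \<in> W" and f: "smooth_at (atlas M) p f"
  obtains G where "field_near (atlas M) p G" "\<forall>\<^sub>F q in nhds p. \<forall>w\<in>tangent M q. g q (G q) w = w f"
proof -
  note pp = conf_points[OF c]
  obtain U x where ch: "(U, x) \<in> atlas M" "p \<in> U" using carrierE[OF pp] .
  let ?d = "coord_field (atlas M) (U, x)"
  note d = coord_field_near[OF ch]
  \<comment> \<open>A vector in the kernel of the matrix would be the component vector of a tangent
    vector orthogonal to all tangent vectors.\<close>
  have nz: "det (\<chi> i j. g p (?d i p) (?d j p)) \<noteq> 0"
  proof (rule det_nonzeroI)
    fix c j assume h: "\<And>i. (\<Sum>j\<in>UNIV. g p (?d i p) (?d j p) * c j) = 0"
    interpret f: symmetric_form "tangent M p" "g p" by (rule conf_form[OF assms(1,2)])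
    let ?v = "\<Sum>j\<in>UNIV. c j \<odot> ?d j p"
    have dT: "\<And>i. ?d i p \<in> tangent M p" by (rule field_near_tangent[OF d])
    have vT: "?v \<in> tangent M p" by (intro tangent_sum[OF pp] tangent_scale dT)
    have gd: "g p (?d i p) ?v = 0" for i
      using f.linear_on_sum[OF f.linear_g2[OF dT], of UNIV "\<lambda>j. ?d j p" i c] dT h[of i] by (simp add: mult.commute)
    have "?v = 0"
    proof (rule conf_nondegenerate[OF assms(1,2) vT])
      fix y assume y: "y \<in> tangent M p"
      have "g p ?v y = g p y ?v" by (rule f.sym[OF vT y])
      also have "\<dots> = g p (\<Sum>i\<in>UNIV. y (\<lambda>q. x q $ i) \<odot> ?d i p) ?v"
        using tangent_eq_sum[OF y ch] by simp
      also have "\<dots> = (\<Sum>i\<in>UNIV. y (\<lambda>q. x q $ i) * g p (?d i p) ?v)"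
        by (rule f.linear_on_sum[OF f.linear_g1[OF vT]]) (rule dT)
      finally show "g p ?v y = 0" by (simp add: gd)
    qed
    then have "?v (\<lambda>q. x q $ j) = 0" by simp
    then show "c j = 0"
      by (simp add: sum_fun_apply tscale_apply coord_field_coord[OF ch] if_distrib[of "\<lambda>t. _ * t"] cong: if_cong)
  qed
  obtain c where cs: "\<And>i. smooth_at (atlas M) p (c i)"
    and ceq: "\<forall>\<^sub>F q in nhds p. \<forall>i. (\<Sum>j\<in>UNIV. g q (?d i q) (?d j q) * c j q) = ?d i q f"
    by (rule smooth_solve[where b = "\<lambda>i q. ?d i q f", OF pp metric_smooth[OF assms(1,2) d d] coord_deriv_smooth[OF f ch] nz]) (rule that; assumption)
  show ?thesis
  proof (rule that[of "\<lambda>q. \<Sum>j\<in>UNIV. c j q \<odot> ?d j q"])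
    show "field_near (atlas M) p (\<lambda>q. \<Sum>j\<in>UNIV. c j q \<odot> ?d j q)"
      by (rule field_near_sum[OF pp], rule field_near_scale[OF cs d])
    show "\<forall>\<^sub>F q in nhds p. \<forall>w\<in>tangent M q. g q (\<Sum>j\<in>UNIV. c j q \<odot> ?d j q) w = w f"
      using ceq eventually_chart[OF ch] conf_eventually[OF assms(1,2)] smooth_at_eventually[OF f]
    proof eventually_elim
      case (elim q)
      interpret f: symmetric_form "tangent M q" "g q" by (rule conf_form[OF assms(1) elim(3)])
      have dT: "\<And>i. ?d i q \<in> tangent M q" by (rule coord_field_tangent[OF ch(1) elim(2)])
      let ?v = "\<Sum>j\<in>UNIV. c j q \<odot> ?d j q"
      have vT: "?v \<in> tangent M q" by (intro tangent_sum[OF conf_points[OF assms(1) elim(3)]] tangent_scale dT)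
      have gd: "g q (?d i q) ?v = ?d i q f" for i
        using f.linear_on_sum[OF f.linear_g2[OF dT], of UNIV "\<lambda>j. ?d j q" i "\<lambda>j. c j q"] dT elim(1) by (simp add: mult.commute)
      show ?case
      proof
        fix w assume w: "w \<in> tangent M q"
        have "g q ?v w = g q w ?v" by (rule f.sym[OF vT w])
        also have "\<dots> = g q (\<Sum>i\<in>UNIV. w (\<lambda>q. x q $ i) \<odot> ?d i q) ?v"
          using tangent_eq_sum[OF w ch(1) elim(2)] by simp
        also have "\<dots> = (\<Sum>i\<in>UNIV. w (\<lambda>q. x q $ i) * g q (?d i q) ?v)"
          by (rule f.linear_on_sum[OF f.linear_g1[OF vT]]) (rule dT)
        also have "\<dots> = w f" unfolding gd by (rule tangent_expand[OF w ch(1) elim(2,4), symmetric])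
        finally show "g q ?v w = w f" .
      qed
    qed
  qed
qed

end


section \<open>Horizontally conformal submersions\<close>

locale weyl_submersion =
  fixes cat :: category
    and M :: "('a::t2_space, 'k::real_or_complex, 'm::finite) weyl"
    and N :: "('b::topological_space, 'k, 'n::finite) weyl"
    and \<phi> :: "'a \<Rightarrow> 'b"
  assumes wM: "weyl_space cat M" and wN: "weyl_space cat N"
    and subm: "submersion cat M N \<phi>"
    and nondeg: "nowhere_degenerate_fibres M N \<phi>"
    and hconf: "horizontally_conformal cat M N \<phi>"
begin

sublocale M: weyl cat M using wM by unfold_locales
sublocale N: weyl cat N using wN by unfold_locales

abbreviation "d\<phi> \<equiv> differential N \<phi>"
abbreviation "Hor \<equiv> horizontal M N \<phi>"
abbreviation "Ver \<equiv> vertical M N \<phi>"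
abbreviation "hp \<equiv> hpart M N \<phi>"
abbreviation "lift \<equiv> hlift M N \<phi>"
abbreviation "smM \<equiv> smooth_at (atlas M)"
abbreviation "smN \<equiv> smooth_at (atlas N)"
abbreviation "fieldM \<equiv> field_near (atlas M)"

lemma phi_points: "p \<in> points M \<Longrightarrow> \<phi> p \<in> points N"
proof -
  have "\<phi> ` points M \<subseteq> points N" using subm unfolding submersion_def by (elim conjE)
  then show "p \<in> points M \<Longrightarrow> \<phi> p \<in> points N" by blast
qed

lemma phi_tendsto:
  assumes "p \<in> points M"
  shows "filterlim \<phi> (nhds (\<phi> p)) (nhds p)"
proof -
  have "isCont \<phi> p"
  proof -
    have "continuous_on (points M) \<phi>" using subm unfolding submersion_def by (elim conjE)
    then show ?thesis unfolding continuous_on_eq_continuous_at[OF M.open_carrier] using assms by (rule bspec)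
  qed
  then show ?thesis unfolding isCont_def tendsto_at_iff_tendsto_nhds .
qed

lemma phi_eventually: "p \<in> points M \<Longrightarrow> \<forall>\<^sub>F r in nhds (\<phi> p). P r \<Longrightarrow> \<forall>\<^sub>F q in nhds p. P (\<phi> q)"
  using phi_tendsto[of p] unfolding filterlim_def le_filter_def eventually_filtermap by simp

lemma smooth_coord:
  assumes "p \<in> points M" "(V, y) \<in> atlas N" "\<phi> p \<in> V"
  shows "smM p (\<lambda>q. y (\<phi> q) $ j)"
proof -
  have "\<forall>(V, y)\<in>atlas N. \<forall>j. reg_on cat (atlas M) (points M \<inter> \<phi> -` V) (\<lambda>p. y (\<phi> p) $ j)"
    using subm unfolding submersion_def by (elim conjE)
  then have "reg_on cat (atlas M) (points M \<inter> \<phi> -` V) (\<lambda>p. y (\<phi> p) $ j)" using assms(2) by fast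
  then have "reg_on Smooth (atlas M) (points M \<inter> \<phi> -` V) (\<lambda>p. y (\<phi> p) $ j)" by (rule reg_on_imp_Smooth)
  then show ?thesis unfolding M.reg_on_Smooth_iff using assms(1,3) by blast
qed

lemma smooth_pullback:
  assumes "p \<in> points M" "smN (\<phi> p) f"
  shows "smM p (f \<circ> \<phi>)"
proof -
  obtain V y where c: "(V, y) \<in> atlas N" "\<phi> p \<in> V" using N.carrierE[OF phi_points[OF assms(1)]] .
  obtain S where S: "open S" "y (\<phi> p) \<in> S" "S \<subseteq> y ` V" "csmooth S (f \<circ> inv_into V y)"
    using assms(2) unfolding N.smooth_at_iff[OF c] by (elim exE conjE)
  have "smM p (\<lambda>q. (f \<circ> inv_into V y) (y (\<phi> q)))"
    by (rule M.smooth_at_csmooth_comp[where t = "\<lambda>q. y (\<phi> q)", OF S(1,4,2)]) (rule smooth_coord[OF assms(1) c])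
  moreover have "\<forall>\<^sub>F q in nhds p. (f \<circ> \<phi>) q = (f \<circ> inv_into V y) (y (\<phi> q))"
    using phi_eventually[OF assms(1) N.eventually_chart[OF c]]
    by (rule eventually_mono) (simp add: N.chart_inv[OF c(1)])
  ultimately show ?thesis by (rule M.smooth_at_transfer)
qed

lemma diff_tangent: "v \<in> tangent M p \<Longrightarrow> d\<phi> p v \<in> tangent N (\<phi> p)"
proof -
  assume v: "v \<in> tangent M p"
  have "\<forall>p\<in>points M. d\<phi> p ` tangent M p = tangent N (\<phi> p)"
    using subm unfolding submersion_def by (elim conjE)
  then show ?thesis using M.tangent_carrier[OF v] v by blast
qed

lemma diff_surj:
  assumes "p \<in> points M" "w \<in> tangent N (\<phi> p)"
  obtains v where "v \<in> tangent M p" "d\<phi> p v = w"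
proof -
  have "\<forall>p\<in>points M. d\<phi> p ` tangent M p = tangent N (\<phi> p)"
    using subm unfolding submersion_def by (elim conjE)
  then have "w \<in> d\<phi> p ` tangent M p" using assms by simp
  then show ?thesis using that by blast
qed

lemma diff_linear: "d\<phi> p (a \<odot> v + b \<odot> w) = a \<odot> d\<phi> p v + b \<odot> d\<phi> p w"
  by (rule ext) (simp add: differential_def tscale_apply)

lemma diff_add: "d\<phi> p (v + w) = d\<phi> p v + d\<phi> p w"
  by (rule ext) (simp add: differential_def)

lemma diff_scale: "d\<phi> p (a \<odot> v) = a \<odot> d\<phi> p v"
  by (rule ext) (simp add: differential_def tscale_apply)

lemma diff_diff: "d\<phi> p (v - w) = d\<phi> p v - d\<phi> p w"
  by (rule ext) (simp add: differential_def)

lemma diff_0: "d\<phi> p 0 = 0"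
  by (rule ext) (simp add: differential_def)

lemma diff_coord:
  assumes "(V, y) \<in> atlas N" "\<phi> p \<in> V"
  shows "d\<phi> p v (\<lambda>r. y r $ j) = v (\<lambda>q. y (\<phi> q) $ j)"
  using N.smooth_at_chart[OF assms] by (simp add: differential_def comp_def)

lemma diff_eqI:
  assumes "v \<in> tangent M p" "w \<in> tangent N (\<phi> p)" "(V, y) \<in> atlas N" "\<phi> p \<in> V"
    "\<And>j. v (\<lambda>q. y (\<phi> q) $ j) = w (\<lambda>r. y r $ j)"
  shows "d\<phi> p v = w"
  by (rule N.tangent_eqI[OF diff_tangent[OF assms(1)] assms(2-4)]) (simp only: diff_coord[OF assms(3,4)] assms(5))

section \<open>The vertical and horizontal distributions\<close>

lemma V_tangent: "u \<in> Ver p \<Longrightarrow> u \<in> tangent M p" and V_diff: "u \<in> Ver p \<Longrightarrow> d\<phi> p u = 0"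
  unfolding vertical_def by simp_all

lemma VI: "u \<in> tangent M p \<Longrightarrow> d\<phi> p u = 0 \<Longrightarrow> u \<in> Ver p"
  unfolding vertical_def by simp

lemma V_subspace: "p \<in> points M \<Longrightarrow> tv.subspace (Ver p)"
  unfolding tv.subspace_def
proof (intro conjI ballI allI)
  assume pp: "p \<in> points M"
  show "0 \<in> Ver p" by (rule VI[OF M.tangent_0[OF pp] diff_0])
  fix u assume u: "u \<in> Ver p"
  show "u + v \<in> Ver p" if "v \<in> Ver p" for v
    by (rule VI[OF M.tangent_plus[OF V_tangent[OF u] V_tangent[OF that]]])
      (simp only: diff_add V_diff[OF u] V_diff[OF that] add_0_left)
  show "a \<odot> u \<in> Ver p" for a
    by (rule VI[OF M.tangent_scale[OF V_tangent[OF u]]]) (simp only: diff_scale V_diff[OF u] tv.scale_zero_right)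
qed

lemma H_tangent: "x \<in> Hor p \<Longrightarrow> x \<in> tangent M p"
  unfolding horizontal_def by (elim CollectE conjE)

text \<open>The representatives are proportional at \<open>p\<close>, so orthogonality for one of
  them decides for all.\<close>

lemma H_iff:
  assumes "(W, g) \<in> conf M" "p \<in> W"
  shows "x \<in> Hor p \<longleftrightarrow> x \<in> tangent M p \<and> (\<forall>u\<in>Ver p. g p x u = 0)"
proof
  assume "x \<in> Hor p"
  note h = this[unfolded horizontal_def mem_Collect_eq]
  have "p \<in> W \<longrightarrow> (\<forall>u\<in>Ver p. g p x u = 0)"
    using bspec[OF conjunct2[OF h] assms(1)] unfolding prod.case .
  with conjunct1[OF h] assms(2) show "x \<in> tangent M p \<and> (\<forall>u\<in>Ver p. g p x u = 0)" by simp
next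
  assume x: "x \<in> tangent M p \<and> (\<forall>u\<in>Ver p. g p x u = 0)"
  have *: "g' p x u = 0" if c': "(W', g') \<in> conf M" "p \<in> W'" and u: "u \<in> Ver p" for W' g' u
  proof -
    from M.conf_conformal[OF assms(1) c'(1) assms(2) c'(2)] obtain c
      where "\<forall>x\<in>tangent M p. \<forall>y\<in>tangent M p. g' p x y = c * g p x y" by (elim exE conjE)
    then have "g' p x u = c * g p x u" using conjunct1[OF x] V_tangent[OF u] by simp
    then show ?thesis using bspec[OF conjunct2[OF x] u] by simp
  qed
  have "case c of (W, g) \<Rightarrow> p \<in> W \<longrightarrow> (\<forall>u\<in>Ver p. g p x u = 0)" if c: "c \<in> conf M" for c
  proof -
    obtain W' g' where e: "c = (W', g')" by (cases c)
    show ?thesis unfolding e prod.case using *[OF c[unfolded e]] by simp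
  qed
  then show "x \<in> Hor p" unfolding horizontal_def mem_Collect_eq
    by (intro conjI[OF conjunct1[OF x]] ballI)
qed

lemma H_orth:
  assumes "(W, g) \<in> conf M" "p \<in> W" "x \<in> Hor p" "u \<in> Ver p"
  shows "g p x u = 0"
  using assms(3,4) unfolding H_iff[OF assms(1,2)] by blast

lemma H_orth':
  assumes "(W, g) \<in> conf M" "p \<in> W" "x \<in> Hor p" "u \<in> Ver p"
  shows "g p u x = 0"
  unfolding symmetric_form.sym[OF M.conf_form[OF assms(1,2)] V_tangent[OF assms(4)] H_tangent[OF assms(3)]]
  by (rule H_orth[OF assms])

lemma H_subspace:
  assumes "p \<in> points M"
  shows "tv.subspace (Hor p)"
proof -
  obtain W g where c: "(W, g) \<in> conf M" "p \<in> W" using M.conf_cover[OF assms] .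
  interpret f: symmetric_form "tangent M p" "g p" by (rule M.conf_form[OF c])
  have l: "f.linear_on (\<lambda>x. g p x u)" if "u \<in> Ver p" for u by (rule f.linear_g1[OF V_tangent[OF that]])
  show ?thesis
    unfolding tv.subspace_def
  proof (intro conjI ballI allI)
    show "0 \<in> Hor p" unfolding H_iff[OF c] using M.tangent_0[OF assms] f.linear_on_0[OF l] by blast
    fix x assume x: "x \<in> Hor p"
    show "x + y \<in> Hor p" if y: "y \<in> Hor p" for y unfolding H_iff[OF c]
      using M.tangent_plus[OF H_tangent[OF x] H_tangent[OF y]] f.linear_on_add[OF l H_tangent[OF x] H_tangent[OF y]]
        H_orth[OF c x] H_orth[OF c y] by simp
    show "a \<odot> x \<in> Hor p" for a unfolding H_iff[OF c]
      using M.tangent_scale[OF H_tangent[OF x]] f.linear_on_scale[OF l H_tangent[OF x]] H_orth[OF c x] by simp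
  qed
qed

lemma H_V_0:
  assumes "x \<in> Hor p" "x \<in> Ver p"
  shows "x = 0"
proof -
  have pp: "p \<in> points M" by (rule M.tangent_carrier[OF H_tangent[OF assms(1)]])
  obtain W g where c: "(W, g) \<in> conf M" "p \<in> W" using M.conf_cover[OF pp] .
  have "\<forall>(W, g)\<in>conf M. \<forall>p\<in>W. \<forall>u\<in>Ver p. (\<forall>v\<in>Ver p. g p u v = 0) \<longrightarrow> u = 0"
    using nondeg unfolding nowhere_degenerate_fibres_def .
  then have "\<forall>u\<in>Ver p. (\<forall>v\<in>Ver p. g p u v = 0) \<longrightarrow> u = 0" using c by fast
  then show ?thesis using assms(2) H_orth[OF c assms(1)] by blast
qed

text \<open>The gradients of the coordinates of \<open>N\<close> pulled back by \<open>\<phi>\<close> span the horizontal distribution.\<close>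

lemma field_decomposition:
  assumes Y: "fieldM p Y"
  obtains X where "fieldM p X" "\<forall>\<^sub>F q in nhds p. X q \<in> Hor q \<and> Y q - X q \<in> Ver q"
proof -
  note pp = M.field_near_carrier[OF Y]
  obtain W g where c: "(W, g) \<in> conf M" "p \<in> W" using M.conf_cover[OF pp] .
  obtain S y where ch: "(S, y) \<in> atlas N" "\<phi> p \<in> S" using N.carrierE[OF phi_points[OF pp]] .
  let ?t = "\<lambda>j q. y (\<phi> q) $ j"
  have ts: "smM p (?t j)" for j by (rule smooth_coord[OF pp ch])
  define G where "G j = (SOME G. fieldM p G \<and> (\<forall>\<^sub>F q in nhds p. \<forall>w\<in>tangent M q. g q (G q) w = w (?t j)))" for j
  have "fieldM p (G j) \<and> (\<forall>\<^sub>F q in nhds p. \<forall>w\<in>tangent M q. g q (G j q) w = w (?t j))" for j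
  proof -
    obtain X where "fieldM p X" "\<forall>\<^sub>F q in nhds p. \<forall>w\<in>tangent M q. g q (X q) w = w (?t j)"
      using M.gradient[OF c ts] .
    from someI[of "\<lambda>G. fieldM p G \<and> (\<forall>\<^sub>F q in nhds p. \<forall>w\<in>tangent M q. g q (G q) w = w (?t j))", OF conjI[OF this]]
    show ?thesis unfolding G_def .
  qed
  note G = this[THEN conjunct1] this[THEN conjunct2]
  have Gev: "\<forall>\<^sub>F q in nhds p. \<forall>j. \<forall>w\<in>tangent M q. g q (G j q) w = w (?t j)"
    by (rule eventually_all_finite) (rule G(2))
  have GT: "\<forall>\<^sub>F q in nhds p. \<forall>j. G j q \<in> tangent M q"
    by (rule eventually_all_finite) (rule M.field_near_eventually_tangent[OF G(1)])
  have Sev: "\<forall>\<^sub>F q in nhds p. \<phi> q \<in> S" by (rule phi_eventually[OF pp N.eventually_chart[OF ch]])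
  have comb: "(\<Sum>j\<in>UNIV. a j \<odot> G j q) \<in> Hor q" if q: "\<forall>j. \<forall>w\<in>tangent M q. g q (G j q) w = w (?t j)"
    "\<forall>j. G j q \<in> tangent M q" "\<phi> q \<in> S" "q \<in> W" for a q
    unfolding H_iff[OF c(1) q(4)]
  proof (intro conjI ballI)
    interpret f: symmetric_form "tangent M q" "g q" by (rule M.conf_form[OF c(1) q(4)])
    show "(\<Sum>j\<in>UNIV. a j \<odot> G j q) \<in> tangent M q"
      by (rule M.tangent_sum[OF M.conf_points[OF c(1) q(4)] M.tangent_scale[OF q(2)[rule_format]]])
    fix u assume u: "u \<in> Ver q"
    have "g q (\<Sum>j\<in>UNIV. a j \<odot> G j q) u = (\<Sum>j\<in>UNIV. a j * g q (G j q) u)"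
      by (rule f.linear_on_sum[OF f.linear_g1[OF V_tangent[OF u]]]) (rule q(2)[rule_format])
    also have "\<dots> = (\<Sum>j\<in>UNIV. a j * d\<phi> q u (\<lambda>r. y r $ j))"
      unfolding diff_coord[OF ch(1) q(3)] q(1)[rule_format, OF V_tangent[OF u]] ..
    finally show "g q (\<Sum>j\<in>UNIV. a j \<odot> G j q) u = 0" unfolding V_diff[OF u] by simp
  qed
  have at_p: "\<forall>j. \<forall>w\<in>tangent M p. g p (G j p) w = w (?t j)" "\<forall>j. G j p \<in> tangent M p"
    using eventually_nhds_x_imp_x[OF Gev] eventually_nhds_x_imp_x[OF GT] by simp_all
  \<comment> \<open>A relation among the columns gives a combination of gradients that is horizontal
    and, being annihilated by \<open>d\<phi>\<close>, also vertical; hence it is 0.\<close>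
  have nz: "det (\<chi> i j. g p (G i p) (G j p)) \<noteq> 0"
  proof (rule det_nonzeroI)
    fix a j assume h: "\<And>i. (\<Sum>j\<in>UNIV. g p (G i p) (G j p) * a j) = 0"
    interpret f: symmetric_form "tangent M p" "g p" by (rule M.conf_form[OF c])
    let ?v = "\<Sum>j\<in>UNIV. a j \<odot> G j p"
    have vH: "?v \<in> Hor p" by (rule comb[OF at_p ch(2) c(2)])
    have "d\<phi> p ?v = 0"
    proof (rule diff_eqI[OF H_tangent[OF vH] N.tangent_0[OF phi_points[OF pp]] ch])
      fix i
      have "?v (?t i) = g p (G i p) ?v" by (rule at_p(1)[rule_format, OF H_tangent[OF vH], symmetric])
      also have "\<dots> = (\<Sum>j\<in>UNIV. a j * g p (G i p) (G j p))"
        by (rule f.linear_on_sum[OF f.linear_g2[OF at_p(2)[rule_format]] at_p(2)[rule_format]])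
      also have "\<dots> = 0" using h[of i] by (simp only: mult.commute)
      finally show "?v (?t i) = 0 (\<lambda>r. y r $ i)" unfolding zero_fun_apply .
    qed
    then have "?v \<in> Ver p" by (rule VI[OF H_tangent[OF vH]])
    with vH have v0: "?v = 0" by (rule H_V_0)
    \<comment> \<open>By surjectivity of \<open>d\<phi>\<close> there is a vector over the
      \<open>j\<close>-th coordinate vector; pairing the vanishing combination with it extracts the
      coefficient \<open>a j\<close>.\<close>
    obtain w where w: "w \<in> tangent M p" "d\<phi> p w = coord_field (atlas N) (S, y) j (\<phi> p)"
      using diff_surj[OF pp N.coord_field_tangent[OF ch]] .
    have "0 = g p ?v w" unfolding v0 by (rule f.linear_on_0[OF f.linear_g1[OF w(1)], symmetric])
    also have "\<dots> = (\<Sum>i\<in>UNIV. a i * g p (G i p) w)"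
      by (rule f.linear_on_sum[OF f.linear_g1[OF w(1)]]) (rule at_p(2)[rule_format])
    also have "\<dots> = (\<Sum>i\<in>UNIV. a i * d\<phi> p w (\<lambda>r. y r $ i))"
      unfolding diff_coord[OF ch] at_p(1)[rule_format, OF w(1)] ..
    also have "\<dots> = a j"
      unfolding w(2) by (simp add: N.coord_field_coord[OF ch] if_distrib[of "\<lambda>t. _ * t"] cong: if_cong)
    finally show "a j = 0" ..
  qed
  \<comment> \<open>With these coefficients the combination of gradients has the same image under
    \<open>d\<phi>\<close> as \<open>Y\<close>, which makes the remainder vertical.\<close>
  obtain a where as: "\<And>i. smM p (a i)"
    and aeq: "\<forall>\<^sub>F q in nhds p. \<forall>i. (\<Sum>j\<in>UNIV. g q (G i q) (G j q) * a j q) = Y q (?t i)"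
    by (rule M.smooth_solve[where b = "\<lambda>i q. Y q (?t i)", OF pp M.metric_smooth[OF c G(1) G(1)] M.field_near_smooth[OF Y ts] nz])
      (rule that; assumption)
  show ?thesis
  proof (rule that[of "\<lambda>q. \<Sum>j\<in>UNIV. a j q \<odot> G j q"])
    show "fieldM p (\<lambda>q. \<Sum>j\<in>UNIV. a j q \<odot> G j q)"
      by (rule M.field_near_sum[OF pp], rule M.field_near_scale[OF as G(1)])
    show "\<forall>\<^sub>F q in nhds p. (\<Sum>j\<in>UNIV. a j q \<odot> G j q) \<in> Hor q \<and> Y q - (\<Sum>j\<in>UNIV. a j q \<odot> G j q) \<in> Ver q"
      using aeq Gev GT Sev M.conf_eventually[OF c] M.field_near_eventually_tangent[OF Y]
    proof eventually_elim
      case (elim q)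
      interpret f: symmetric_form "tangent M q" "g q" by (rule M.conf_form[OF c(1) elim(5)])
      let ?v = "\<Sum>j\<in>UNIV. a j q \<odot> G j q"
      have vH: "?v \<in> Hor q" by (rule comb[OF elim(2-5)])
      have dT: "Y q - ?v \<in> tangent M q" by (rule M.tangent_minus[OF elim(6) H_tangent[OF vH]])
      have "d\<phi> q (Y q - ?v) = 0"
      proof (rule diff_eqI[OF dT N.tangent_0[OF phi_points[OF M.conf_points[OF c(1) elim(5)]]] ch(1) elim(4)])
        fix i
        have "?v (?t i) = g q (G i q) ?v" by (rule elim(2)[rule_format, OF H_tangent[OF vH], symmetric])
        also have "\<dots> = (\<Sum>j\<in>UNIV. a j q * g q (G i q) (G j q))"
          by (rule f.linear_on_sum[OF f.linear_g2[OF elim(3)[rule_format]] elim(3)[rule_format]])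
        also have "\<dots> = Y q (?t i)" using elim(1)[rule_format, of i] by (simp only: mult.commute)
        finally have "?v (?t i) = Y q (?t i)" .
        then show "(Y q - ?v) (?t i) = 0 (\<lambda>r. y r $ i)"
          unfolding zero_fun_apply minus_apply by (simp only: diff_self)
      qed
      then have "Y q - ?v \<in> Ver q" by (rule VI[OF dT])
      with vH show ?case ..
    qed
  qed
qed

lemma decomposition_unique:
  assumes "x \<in> Hor p" "v - x \<in> Ver p" "x' \<in> Hor p" "v - x' \<in> Ver p"
  shows "x = x'"
proof -
  have pp: "p \<in> points M" by (rule M.tangent_carrier[OF H_tangent[OF assms(1)]])
  have "x - x' \<in> Hor p" by (rule tv.subspace_diff[OF H_subspace[OF pp] assms(1,3)])
  moreover have "(v - x') - (v - x) \<in> Ver p" by (rule tv.subspace_diff[OF V_subspace[OF pp] assms(4,2)])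
  moreover have "(v - x') - (v - x) = x - x'" by (rule ext) simp
  ultimately have "x - x' \<in> Hor p" "x - x' \<in> Ver p" by (simp_all only:)
  then have "x - x' = 0" by (rule H_V_0)
  then show ?thesis by (rule eq_iff_diff_eq_0[THEN iffD2])
qed

lemma hpart_eqI: "x \<in> Hor p \<Longrightarrow> v - x \<in> Ver p \<Longrightarrow> hp p v = x"
  unfolding hpart_def by (rule the_equality) (blast, blast intro: decomposition_unique)

text \<open>The pointwise splitting is read off at \<open>p\<close> from the smooth splitting of an
  extension of \<open>v\<close>.\<close>

lemma hpart_props:
  assumes "v \<in> tangent M p"
  shows hpart_H: "hp p v \<in> Hor p" and vpart_V: "v - hp p v \<in> Ver p"
proof -
  obtain Y where Y: "fieldM p Y" "Y p = v" using M.field_extension[OF assms] .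
  obtain X where X: "fieldM p X" "\<forall>\<^sub>F q in nhds p. X q \<in> Hor q \<and> Y q - X q \<in> Ver q"
    using field_decomposition[OF Y(1)] .
  have *: "X p \<in> Hor p" "v - X p \<in> Ver p" using eventually_nhds_x_imp_x[OF X(2)] Y(2) by simp_all
  show "hp p v \<in> Hor p" "v - hp p v \<in> Ver p" unfolding hpart_eqI[OF *] by (fact *)+
qed

lemma hpart_id: "x \<in> Hor p \<Longrightarrow> hp p x = x"
  by (rule hpart_eqI) (simp_all add: tv.subspace_0[OF V_subspace] M.tangent_carrier[OF H_tangent])

lemma hpart_V: "u \<in> Ver p \<Longrightarrow> hp p u = 0"
  by (rule hpart_eqI) (simp_all add: tv.subspace_0[OF H_subspace] M.tangent_carrier[OF V_tangent])

lemma diff_hpart: "v \<in> tangent M p \<Longrightarrow> d\<phi> p (hp p v) = d\<phi> p v"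
  using V_diff[OF vpart_V, of v p] unfolding diff_diff by (simp only: right_minus_eq)

lemma hpart_orth:
  assumes "(W, g) \<in> conf M" "p \<in> W" "v \<in> tangent M p" "x \<in> Hor p"
  shows "g p (hp p v) x = g p v x"
proof -
  interpret f: symmetric_form "tangent M p" "g p" by (rule M.conf_form[OF assms(1,2)])
  have "g p (v - hp p v) x = g p v x - g p (hp p v) x"
    by (rule f.linear_on_diff[OF f.linear_g1[OF H_tangent[OF assms(4)]] assms(3) H_tangent[OF hpart_H[OF assms(3)]]])
  then show ?thesis using H_orth'[OF assms(1,2,4) vpart_V[OF assms(3)]] by simp
qed

lemma H_projection:
  assumes "(W, g) \<in> conf M" "p \<in> W" "orthonormal_frame (atlas M) g p e"
  shows "frame_projection (tangent M p) (g p) e (Hor p) (hp p)"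
proof -
  interpret frame "tangent M p" "g p" e by (rule M.conf_frame[OF assms])
  have pp: "p \<in> points M" by (rule M.conf_points[OF assms(1,2)])
  show ?thesis
  proof unfold_locales
    fix x y assume xy: "x \<in> tangent M p" "y \<in> tangent M p"
    have "g p (hp p x) y = g p y (hp p x)" by (rule sym[OF H_tangent[OF hpart_H[OF xy(1)]] xy(2)])
    also have "\<dots> = g p (hp p y) (hp p x)" by (rule hpart_orth[OF assms(1,2) xy(2) hpart_H[OF xy(1)], symmetric])
    also have "\<dots> = g p (hp p x) (hp p y)" by (rule sym) (intro H_tangent hpart_H xy)+
    also have "\<dots> = g p x (hp p y)" by (rule hpart_orth[OF assms(1,2) xy(1) hpart_H[OF xy(2)]])
    finally show "g p (hp p x) y = g p x (hp p y)" .
  qed (fact H_subspace[OF pp] | blast intro: H_tangent | erule hpart_H | erule hpart_id)+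
qed

lemma V_projection:
  assumes "(W, g) \<in> conf M" "p \<in> W" "orthonormal_frame (atlas M) g p e"
  shows "frame_projection (tangent M p) (g p) e (Ver p) (vpart M N \<phi> p)"
proof -
  interpret h: frame_projection "tangent M p" "g p" e "Hor p" "hp p" by (rule H_projection[OF assms])
  have pp: "p \<in> points M" by (rule M.conf_points[OF assms(1,2)])
  show ?thesis
    unfolding vpart_def
  proof unfold_locales
    fix x y assume xy: "x \<in> tangent M p" "y \<in> tangent M p"
    show "g p (x - hp p x) y = g p x (y - hp p y)"
      unfolding h.linear_on_diff[OF h.linear_g1[OF xy(2)] xy(1) h.pT[OF xy(1)]]
        h.linear_on_diff[OF h.linear_g2[OF xy(1)] xy(2) h.pT[OF xy(2)]] h.psym[OF xy] ..
  next
    fix u assume "u \<in> Ver p"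
    then show "u - hp p u = u" by (simp add: hpart_V)
  qed (fact V_subspace[OF pp] | blast intro: V_tangent | erule vpart_V)+
qed

lemma hlift_eqI:
  assumes "x \<in> Hor p" "d\<phi> p x = w"
  shows "lift p w = x"
  unfolding hlift_def
proof (rule the_equality)
  show "x \<in> Hor p \<and> d\<phi> p x = w" using assms by blast
  fix x' assume x': "x' \<in> Hor p \<and> d\<phi> p x' = w"
  have pp: "p \<in> points M" by (rule M.tangent_carrier[OF H_tangent[OF assms(1)]])
  have "x' - x \<in> Hor p" by (rule tv.subspace_diff[OF H_subspace[OF pp]]) (use x' assms in blast)+
  moreover from this have "x' - x \<in> Ver p"
    by (intro VI H_tangent) (use x' assms in \<open>simp_all add: diff_diff\<close>)
  ultimately have "x' - x = 0" by (rule H_V_0)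
  then show "x' = x" by (rule eq_iff_diff_eq_0[THEN iffD2])
qed

lemma hlift_diff: "v \<in> tangent M p \<Longrightarrow> lift p (d\<phi> p v) = hp p v"
  by (rule hlift_eqI[OF hpart_H diff_hpart])

lemma hlift_props:
  assumes "p \<in> points M" "w \<in> tangent N (\<phi> p)"
  shows hlift_H: "lift p w \<in> Hor p" and diff_hlift: "d\<phi> p (lift p w) = w"
proof -
  obtain v where v: "v \<in> tangent M p" "d\<phi> p v = w" using diff_surj[OF assms] .
  show "lift p w \<in> Hor p" "d\<phi> p (lift p w) = w"
    using hlift_diff[OF v(1)] v hpart_H[OF v(1)] diff_hpart[OF v(1)] by simp_all
qed

lemma hlift_linear:
  assumes "p \<in> points M" "v \<in> tangent N (\<phi> p)" "w \<in> tangent N (\<phi> p)"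
  shows "lift p (a \<odot> v + b \<odot> w) = a \<odot> lift p v + b \<odot> lift p w"
  by (rule hlift_eqI)
    (simp_all only: diff_linear diff_hlift[OF assms(1,2)] diff_hlift[OF assms(1,3)] tv.subspace_add[OF H_subspace[OF assms(1)]]
      tv.subspace_scale[OF H_subspace[OF assms(1)]] hlift_H[OF assms(1,2)] hlift_H[OF assms(1,3)])

lemma hfield_near_iff: "hfield_near M N \<phi> p X \<longleftrightarrow> fieldM p X \<and> (\<forall>\<^sub>F q in nhds p. X q \<in> Hor q)"
  unfolding hfield_near_def by (rule M.field_near_iff_Ball)

lemma vfield_near_iff: "vfield_near M N \<phi> p X \<longleftrightarrow> fieldM p X \<and> (\<forall>\<^sub>F q in nhds p. X q \<in> Ver q)"
  unfolding vfield_near_def by (rule M.field_near_iff_Ball)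

text \<open>The horizontal part of any extension of \<open>x\<close> still has the value
  \<open>x\<close> at \<open>p\<close>, because \<open>x\<close> is its own horizontal part.\<close>

lemma hfield_extension:
  assumes "x \<in> Hor p"
  obtains X where "hfield_near M N \<phi> p X" "X p = x"
proof -
  obtain Y where Y: "fieldM p Y" "Y p = x" using M.field_extension[OF H_tangent[OF assms]] .
  obtain X where X: "fieldM p X" "\<forall>\<^sub>F q in nhds p. X q \<in> Hor q \<and> Y q - X q \<in> Ver q"
    using field_decomposition[OF Y(1)] .
  have "X p \<in> Hor p" "x - X p \<in> Ver p" using eventually_nhds_x_imp_x[OF X(2)] Y(2) by simp_all
  from hpart_eqI[OF this] have "X p = x" using hpart_id[OF assms] by simp
  moreover have "hfield_near M N \<phi> p X"
    unfolding hfield_near_iff by (rule conjI[OF X(1) eventually_mono[OF X(2) conjunct1]])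
  ultimately show ?thesis by (rule that[rotated])
qed

lemma vfield_extension:
  assumes "u \<in> Ver p"
  obtains U where "vfield_near M N \<phi> p U" "U p = u"
proof -
  obtain Y where Y: "fieldM p Y" "Y p = u" using M.field_extension[OF V_tangent[OF assms]] .
  obtain X where X: "fieldM p X" "\<forall>\<^sub>F q in nhds p. X q \<in> Hor q \<and> Y q - X q \<in> Ver q"
    using field_decomposition[OF Y(1)] .
  have "X p \<in> Hor p" "u - X p \<in> Ver p" using eventually_nhds_x_imp_x[OF X(2)] Y(2) by simp_all
  from hpart_eqI[OF this] have "X p = 0" using hpart_V[OF assms] by simp
  then have e: "Y p - X p = u" using Y(2) by simp
  have "vfield_near M N \<phi> p (\<lambda>q. Y q - X q)"
    unfolding vfield_near_iff
    by (rule conjI[OF M.field_near_diff[OF Y(1) X(1)] eventually_mono[OF X(2) conjunct2]])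
  from that[OF this e] show ?thesis .
qed

section \<open>The second fundamental form\<close>

text \<open>Opens the choice of the chart once. The same chart serves all directions and sections at
  \<open>p\<close>, so that several values of the pull-back connection can be compared in one
  frame.\<close>

lemma pullback_chart:
  assumes "p \<in> points M"
  obtains S y where "(S, y) \<in> atlas N" "\<phi> p \<in> S"
    "\<And>x \<sigma>. pullback_conn N \<phi> p x \<sigma> = (\<Sum>j\<in>UNIV. x (\<lambda>q. \<sigma> q (\<lambda>r. y r $ j)) \<odot> coord_field (atlas N) (S, y) j (\<phi> p) +
        \<sigma> p (\<lambda>r. y r $ j) \<odot> conn N (\<phi> p) (d\<phi> p x) (coord_field (atlas N) (S, y) j))"
proof -
  define \<kappa> where "\<kappa> = (SOME \<kappa>. \<kappa> \<in> atlas N \<and> \<phi> p \<in> fst \<kappa>)"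
  obtain S y where "(S, y) \<in> atlas N" "\<phi> p \<in> S" using N.carrierE[OF phi_points[OF assms]] .
  then have "(S, y) \<in> atlas N \<and> \<phi> p \<in> fst (S, y)" by simp
  then have k: "\<kappa> \<in> atlas N \<and> \<phi> p \<in> fst \<kappa>" unfolding \<kappa>_def by (rule someI)
  show ?thesis
  proof (rule that[of "fst \<kappa>" "snd \<kappa>"])
    show "(fst \<kappa>, snd \<kappa>) \<in> atlas N" "\<phi> p \<in> fst \<kappa>" using k by simp_all
    show "pullback_conn N \<phi> p x \<sigma> = (\<Sum>j\<in>UNIV. x (\<lambda>q. \<sigma> q (\<lambda>r. snd \<kappa> r $ j)) \<odot> coord_field (atlas N) (fst \<kappa>, snd \<kappa>) j (\<phi> p) +
        \<sigma> p (\<lambda>r. snd \<kappa> r $ j) \<odot> conn N (\<phi> p) (d\<phi> p x) (coord_field (atlas N) (fst \<kappa>, snd \<kappa>) j))" for x \<sigma>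
      unfolding pullback_conn_def Let_def \<kappa>_def[symmetric] prod.collapse ..
  qed
qed

abbreviation pb :: "'a \<Rightarrow> ('a, 'k) tvec \<Rightarrow> ('a, 'k) vfield \<Rightarrow> ('b, 'k) tvec" where
  "pb p x Y \<equiv> pullback_conn N \<phi> p x (\<lambda>q. d\<phi> q (Y q))"

text \<open>The components of the image of \<open>Y\<close> are expressed by letting
  \<open>Y\<close> act on the coordinates of \<open>N\<close> pulled back to \<open>M\<close>, so
  that the derivation rules on \<open>M\<close> apply to them.\<close>

definition pb_coord :: "'a \<Rightarrow> 'b set \<Rightarrow> ('b \<Rightarrow> 'k ^ 'n) \<Rightarrow> ('a, 'k) tvec \<Rightarrow> ('a, 'k) vfield \<Rightarrow> ('b, 'k) tvec" where
  "pb_coord p S y x Y = (\<Sum>j\<in>UNIV. x (\<lambda>q. Y q (\<lambda>q. y (\<phi> q) $ j)) \<odot> coord_field (atlas N) (S, y) j (\<phi> p) +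
        Y p (\<lambda>q. y (\<phi> q) $ j) \<odot> conn N (\<phi> p) (d\<phi> p x) (coord_field (atlas N) (S, y) j))"

lemma pb_chart:
  assumes "p \<in> points M"
  obtains S y where "(S, y) \<in> atlas N" "\<phi> p \<in> S"
    "\<And>x Y. x \<in> tangent M p \<Longrightarrow> pb p x Y = pb_coord p S y x Y"
proof -
  obtain S y where c: "(S, y) \<in> atlas N" "\<phi> p \<in> S" and
    e: "\<And>x \<sigma>. pullback_conn N \<phi> p x \<sigma> = (\<Sum>j\<in>UNIV. x (\<lambda>q. \<sigma> q (\<lambda>r. y r $ j)) \<odot> coord_field (atlas N) (S, y) j (\<phi> p) +
        \<sigma> p (\<lambda>r. y r $ j) \<odot> conn N (\<phi> p) (d\<phi> p x) (coord_field (atlas N) (S, y) j))"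
    by (rule pullback_chart[OF assms]) (rule that; assumption)
  show ?thesis
  proof (rule that[OF c])
    fix x Y assume x: "x \<in> tangent M p"
    have "x (\<lambda>q. d\<phi> q (Y q) (\<lambda>r. y r $ j)) = x (\<lambda>q. Y q (\<lambda>q. y (\<phi> q) $ j))" for j
      by (rule M.tangent_cong[OF x], rule eventually_mono[OF phi_eventually[OF assms N.eventually_chart[OF c]]])
        (rule diff_coord[OF c(1)])
    then show "pb p x Y = pb_coord p S y x Y"
      unfolding e pb_coord_def by (simp only: diff_coord[OF c])
  qed
qed

lemma pb_tangent:
  assumes "x \<in> tangent M p"
  shows "pb p x Y \<in> tangent N (\<phi> p)"
proof -
  note pp = M.tangent_carrier[OF assms]
  obtain S y where c: "(S, y) \<in> atlas N" "\<phi> p \<in> S" and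
    e0: "\<And>x Y. x \<in> tangent M p \<Longrightarrow> pb p x Y = pb_coord p S y x Y"
    by (rule pb_chart[OF pp]) (rule that; assumption)
  note e = e0[unfolded pb_coord_def]
  show ?thesis unfolding e[OF assms]
    by (intro N.tangent_sum[OF phi_points[OF pp]] N.tangent_plus N.tangent_scale N.coord_field_tangent[OF c]
      N.conn_tangent diff_tangent[OF assms] N.coord_field_near[OF c])
qed

text \<open>\<open>D d\<phi>\<close> as an operator on fields \<open>Y\<close>, before it is known
  to depend on the value of \<open>Y\<close> at \<open>p\<close> alone; \<open>sff_tensorial\<close>
  then gives a value to the description in \<open>D_differential\<close>.\<close>

definition sff :: "'a \<Rightarrow> ('a, 'k) tvec \<Rightarrow> ('a, 'k) vfield \<Rightarrow> ('b, 'k) tvec" where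
  "sff p x Y = pb p x Y - d\<phi> p (conn M p x Y)"

lemma sff_tangent: "x \<in> tangent M p \<Longrightarrow> fieldM p Y \<Longrightarrow> sff p x Y \<in> tangent N (\<phi> p)"
  unfolding sff_def by (intro N.tangent_minus pb_tangent diff_tangent M.conn_tangent)

lemma pb_cong:
  assumes "x \<in> tangent M p" "\<forall>\<^sub>F q in nhds p. Z q = Y q"
  shows "pb p x Z = pb p x Y"
proof -
  obtain S y where c: "(S, y) \<in> atlas N" "\<phi> p \<in> S" and
    e0: "\<And>x Y. x \<in> tangent M p \<Longrightarrow> pb p x Y = pb_coord p S y x Y"
    by (rule pb_chart[OF M.tangent_carrier[OF assms(1)]]) (rule that; assumption)
  note e = e0[unfolded pb_coord_def]
  have "x (\<lambda>q. Z q (\<lambda>q. y (\<phi> q) $ j)) = x (\<lambda>q. Y q (\<lambda>q. y (\<phi> q) $ j))" for j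
    by (rule M.tangent_cong[OF assms(1)], rule eventually_mono[OF assms(2)]) (simp only:)
  moreover have "Z p = Y p" by (rule eventually_nhds_x_imp_x[OF assms(2)])
  ultimately show ?thesis unfolding e[OF assms(1)] by (simp only:)
qed

lemma sff_cong:
  assumes "x \<in> tangent M p" "fieldM p Y" "\<forall>\<^sub>F q in nhds p. Z q = Y q"
  shows "sff p x Z = sff p x Y"
  unfolding sff_def pb_cong[OF assms(1,3)] M.conn_cong[OF assms] ..

lemma sff_add:
  assumes x: "x \<in> tangent M p" and Y: "fieldM p Y" and Z: "fieldM p Z"
  shows "sff p x (\<lambda>q. Y q + Z q) = sff p x Y + sff p x Z"
proof -
  note pp = M.tangent_carrier[OF x]
  obtain S y where c: "(S, y) \<in> atlas N" "\<phi> p \<in> S" and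
    e0: "\<And>x Y. x \<in> tangent M p \<Longrightarrow> pb p x Y = pb_coord p S y x Y"
    by (rule pb_chart[OF pp]) (rule that; assumption)
  note e = e0[unfolded pb_coord_def]
  let ?t = "\<lambda>j q. y (\<phi> q) $ j"
  have t: "smM p (?t j)" for j by (rule smooth_coord[OF pp c])
  have xs: "x (\<lambda>q. Y q (?t j) + Z q (?t j)) = x (\<lambda>q. Y q (?t j)) + x (\<lambda>q. Z q (?t j))" for j
    by (rule M.tangent_add[OF x M.field_near_smooth[OF Y t] M.field_near_smooth[OF Z t]])
  show ?thesis
  proof
    fix f
    show "sff p x (\<lambda>q. Y q + Z q) f = (sff p x Y + sff p x Z) f"
      unfolding sff_def e[OF x] unfolding M.conn_add[OF x Y Z] diff_add
      by (simp add: sum_fun_apply tscale_apply xs sum.distrib algebra_simps)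
  qed
qed

lemma diff_eq_sum:
  assumes "v \<in> tangent M p" "(S, y) \<in> atlas N" "\<phi> p \<in> S"
  shows "d\<phi> p v = (\<Sum>j\<in>UNIV. v (\<lambda>q. y (\<phi> q) $ j) \<odot> coord_field (atlas N) (S, y) j (\<phi> p))"
  using N.tangent_eq_sum[OF diff_tangent[OF assms(1)] assms(2,3)] unfolding diff_coord[OF assms(2,3)] .

text \<open>Both connections contribute the same Leibniz term, the derivative of \<open>h\<close>
  times the image of \<open>Y p\<close>, and these cancel.\<close>

lemma sff_scale:
  assumes x: "x \<in> tangent M p" and Y: "fieldM p Y" and h: "smM p h"
  shows "sff p x (\<lambda>q. h q \<odot> Y q) = h p \<odot> sff p x Y"
proof -
  note pp = M.tangent_carrier[OF x]
  obtain S y where c: "(S, y) \<in> atlas N" "\<phi> p \<in> S" and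
    e0: "\<And>x Y. x \<in> tangent M p \<Longrightarrow> pb p x Y = pb_coord p S y x Y"
    by (rule pb_chart[OF pp]) (rule that; assumption)
  note e = e0[unfolded pb_coord_def]
  let ?t = "\<lambda>j q. y (\<phi> q) $ j"
  have t: "smM p (?t j)" for j by (rule smooth_coord[OF pp c])
  have xs: "x (\<lambda>q. h q * Y q (?t j)) = h p * x (\<lambda>q. Y q (?t j)) + x h * Y p (?t j)" for j
    by (rule M.tangent_mult[OF x h M.field_near_smooth[OF Y t]])
  have dY: "d\<phi> p (Y p) f = (\<Sum>j\<in>UNIV. Y p (?t j) * coord_field (atlas N) (S, y) j (\<phi> p) f)" for f
    unfolding diff_eq_sum[OF M.field_near_tangent[OF Y] c] by (simp only: sum_fun_apply tscale_apply)
  show ?thesis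
  proof
    fix f
    show "sff p x (\<lambda>q. h q \<odot> Y q) f = (h p \<odot> sff p x Y) f"
      unfolding sff_def e[OF x] unfolding M.conn_scale[OF x Y h] diff_add diff_scale
      by (simp add: sum_fun_apply tscale_apply xs dY sum.distrib sum_distrib_left algebra_simps)
  qed
qed

lemma sff_sum:
  assumes x: "x \<in> tangent M p" and fin: "finite I" and Y: "\<And>i. i \<in> I \<Longrightarrow> fieldM p (Y i)"
    and h: "\<And>i. i \<in> I \<Longrightarrow> smM p (h i)"
  shows "sff p x (\<lambda>q. \<Sum>i\<in>I. h i q \<odot> Y i q) = (\<Sum>i\<in>I. h i p \<odot> sff p x (Y i))"
  using fin Y h
proof (induction I rule: finite_induct)
  case empty
  note pp = M.tangent_carrier[OF x]
  have "sff p x (\<lambda>q. (\<lambda>q. 0) q \<odot> (\<lambda>q. 0) q) = 0 \<odot> sff p x (\<lambda>q. 0)"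
    by (rule sff_scale[OF x M.field_near_zero[OF pp] M.smooth_at_const[OF pp]])
  then show ?case by (simp only: sum.empty tv.scale_zero_left)
next
  case (insert i I)
  have Yi: "fieldM p (Y i)" "smM p (h i)" by (rule insert.prems, rule insertI1)+
  have YI: "\<And>j. j \<in> I \<Longrightarrow> fieldM p (Y j)" "\<And>j. j \<in> I \<Longrightarrow> smM p (h j)"
    by (rule insert.prems, erule insertI2)+
  have IH: "sff p x (\<lambda>q. \<Sum>i\<in>I. h i q \<odot> Y i q) = (\<Sum>i\<in>I. h i p \<odot> sff p x (Y i))"
    by (rule insert.IH[OF YI])
  have "sff p x (\<lambda>q. h i q \<odot> Y i q + (\<Sum>i\<in>I. h i q \<odot> Y i q)) =
      sff p x (\<lambda>q. h i q \<odot> Y i q) + sff p x (\<lambda>q. \<Sum>i\<in>I. h i q \<odot> Y i q)"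
    by (rule sff_add[OF x M.field_near_scale[OF Yi(2,1)]
      M.field_near_sum[OF M.tangent_carrier[OF x] M.field_near_scale[OF YI(2,1)]]])
  then show ?case
    unfolding sum.insert[OF insert.hyps] IH sff_scale[OF x Yi] .
qed

text \<open>Linearity over functions is applied to the expansion of the fields in a coordinate
  frame.\<close>

lemma sff_tensorial:
  assumes x: "x \<in> tangent M p" and Y: "fieldM p Y" and Z: "fieldM p Z" and eq: "Y p = Z p"
  shows "sff p x Y = sff p x Z"
proof -
  obtain U u where c: "(U, u) \<in> atlas M" "p \<in> U" using M.carrierE[OF M.tangent_carrier[OF x]] .
  have "sff p x Y = (\<Sum>i\<in>UNIV. Y p (\<lambda>q. u q $ i) \<odot> sff p x (coord_field (atlas M) (U, u) i))" if Y: "fieldM p Y" for Y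
  proof -
    have "\<forall>\<^sub>F q in nhds p. Y q = (\<Sum>i\<in>UNIV. Y q (\<lambda>q. u q $ i) \<odot> coord_field (atlas M) (U, u) i q)"
      using M.field_near_eventually_tangent[OF Y] M.eventually_chart[OF c]
      by eventually_elim (rule M.tangent_eq_sum[OF _ c(1)])
    moreover have "fieldM p (\<lambda>q. \<Sum>i\<in>UNIV. Y q (\<lambda>q. u q $ i) \<odot> coord_field (atlas M) (U, u) i q)"
      by (rule M.field_near_sum[OF M.tangent_carrier[OF x] M.field_near_scale[OF M.field_near_coord[OF Y c] M.coord_field_near[OF c]]])
    ultimately have "sff p x Y = sff p x (\<lambda>q. \<Sum>i\<in>UNIV. Y q (\<lambda>q. u q $ i) \<odot> coord_field (atlas M) (U, u) i q)"
      by (intro sff_cong[OF x])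
    also have "\<dots> = (\<Sum>i\<in>UNIV. Y p (\<lambda>q. u q $ i) \<odot> sff p x (coord_field (atlas M) (U, u) i))"
      by (rule sff_sum[OF x finite M.coord_field_near[OF c] M.field_near_coord[OF Y c]])
    finally show ?thesis .
  qed
  from this[OF Y] this[OF Z] show ?thesis unfolding eq by (simp only:)
qed

lemma pb_linear:
  assumes x: "x \<in> tangent M p" and x': "x' \<in> tangent M p"
  shows "pb p (a \<odot> x + b \<odot> x') Y = a \<odot> pb p x Y + b \<odot> pb p x' Y"
proof -
  note pp = M.tangent_carrier[OF x]
  obtain S y where c: "(S, y) \<in> atlas N" "\<phi> p \<in> S" and
    e0: "\<And>x Y. x \<in> tangent M p \<Longrightarrow> pb p x Y = pb_coord p S y x Y"
    by (rule pb_chart[OF pp]) (rule that; assumption)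
  note e = e0[unfolded pb_coord_def]
  have s: "a \<odot> x + b \<odot> x' \<in> tangent M p" by (intro M.tangent_plus M.tangent_scale x x')
  show ?thesis
  proof
    fix f
    show "pb p (a \<odot> x + b \<odot> x') Y f = (a \<odot> pb p x Y + b \<odot> pb p x' Y) f"
      unfolding e[OF s] e[OF x] e[OF x'] diff_linear
        N.conn_dir[OF diff_tangent[OF x] N.coord_field_near[OF c] diff_tangent[OF x']]
      by (simp add: sum_fun_apply tscale_apply sum.distrib sum_distrib_left algebra_simps)
  qed
qed

lemma sff_linear:
  assumes x: "x \<in> tangent M p" and x': "x' \<in> tangent M p" and Y: "fieldM p Y"
  shows "sff p (a \<odot> x + b \<odot> x') Y = a \<odot> sff p x Y + b \<odot> sff p x' Y"
  by (rule ext) (simp add: sff_def pb_linear[OF x x'] M.conn_dir[OF x Y x'] diff_linear tscale_apply algebra_simps)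

text \<open>In the pull-back terms the derivatives of the components differ by the image of the
  bracket, which equals the difference of the \<open>D\<^sup>M\<close>-terms by torsion-freeness.
  What remains are the Christoffel terms of \<open>N\<close>, symmetric by
  \<open>coord_bracket\<close>.\<close>

lemma sff_sym:
  assumes X: "fieldM p X" and Y: "fieldM p Y"
  shows "sff p (X p) Y = sff p (Y p) X"
proof -
  note pp = M.field_near_carrier[OF X]
  note Xp = M.field_near_tangent[OF X] and Yp = M.field_near_tangent[OF Y]
  obtain S y where c: "(S, y) \<in> atlas N" "\<phi> p \<in> S" and
    e0: "\<And>x Y. x \<in> tangent M p \<Longrightarrow> pb p x Y = pb_coord p S y x Y"
    by (rule pb_chart[OF pp]) (rule that; assumption)
  note e = e0[unfolded pb_coord_def]
  let ?t = "\<lambda>j q. y (\<phi> q) $ j" and ?d = "coord_field (atlas N) (S, y)"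
  have t: "smM p (?t j)" for j by (rule smooth_coord[OF pp c])
  have D: "conn N (\<phi> p) (d\<phi> p v) (?d j) f = (\<Sum>k\<in>UNIV. v (?t k) * conn N (\<phi> p) (?d k (\<phi> p)) (?d j) f)"
    if v: "v \<in> tangent M p" for v j f
    unfolding diff_eq_sum[OF v c] N.conn_dir_sum[OF N.coord_field_near[OF c] finite N.coord_field_tangent[OF c]]
    by (simp only: sum_fun_apply tscale_apply)
  have br: "d\<phi> p (conn M p (X p) Y) f - d\<phi> p (conn M p (Y p) X) f =
      (\<Sum>j\<in>UNIV. (X p (\<lambda>q. Y q (?t j)) - Y p (\<lambda>q. X q (?t j))) * ?d j (\<phi> p) f)" for f
  proof -
    have "d\<phi> p (conn M p (X p) Y) f - d\<phi> p (conn M p (Y p) X) f = d\<phi> p (lie_bracket (atlas M) X Y p) f"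
      unfolding M.torsion[OF X Y, symmetric] diff_diff by simp
    also have "\<dots> = (\<Sum>j\<in>UNIV. lie_bracket (atlas M) X Y p (?t j) * ?d j (\<phi> p) f)"
      unfolding diff_eq_sum[OF M.lie_bracket_tangent[OF X Y] c] by (simp only: sum_fun_apply tscale_apply)
    finally show ?thesis by (simp add: lie_bracket_def t)
  qed
  have sw: "(\<Sum>j\<in>UNIV. Y p (?t j) * (\<Sum>k\<in>UNIV. X p (?t k) * conn N (\<phi> p) (?d k (\<phi> p)) (?d j) f)) =
      (\<Sum>j\<in>UNIV. X p (?t j) * (\<Sum>k\<in>UNIV. Y p (?t k) * conn N (\<phi> p) (?d k (\<phi> p)) (?d j) f))" for f
    unfolding sum_distrib_left
    by (subst sum.swap) (simp only: N.coord_bracket[OF c] mult.left_commute)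
  show ?thesis
  proof
    fix f
    have "pb p (X p) Y f - pb p (Y p) X f = (\<Sum>j\<in>UNIV. (X p (\<lambda>q. Y q (?t j)) - Y p (\<lambda>q. X q (?t j))) * ?d j (\<phi> p) f)"
      unfolding e[OF Xp] e[OF Yp]
      by (simp add: sum_fun_apply tscale_apply sum.distrib D[OF Xp] D[OF Yp] sw sum_subtractf left_diff_distrib)
    with br[of f] show "sff p (X p) Y f = sff p (Y p) X f" unfolding sff_def minus_apply by (simp add: algebra_simps)
  qed
qed

section \<open>The second fundamental form as a symmetric tensor\<close>

abbreviation "dd \<equiv> D_differential M N \<phi>"

lemma dd_sff:
  assumes "x \<in> tangent M p" "fieldM p Y"
  shows "dd p x (Y p) = sff p x Y"
  unfolding D_differential_def sff_def[symmetric]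
proof (rule the_equality)
  show "\<forall>Z. fieldM p Z \<and> Z p = Y p \<longrightarrow> sff p x Y = sff p x Z"
    using sff_tensorial[OF assms] by simp
  show "w = sff p x Y" if "\<forall>Z. fieldM p Z \<and> Z p = Y p \<longrightarrow> w = sff p x Z" for w
    using that assms(2) by simp
qed

lemma dd_tangent:
  assumes "x \<in> tangent M p" "y \<in> tangent M p"
  shows "dd p x y \<in> tangent N (\<phi> p)"
proof -
  obtain Y where Y: "fieldM p Y" "Y p = y" using M.field_extension[OF assms(2)] .
  show ?thesis using sff_tangent[OF assms(1) Y(1)] unfolding dd_sff[OF assms(1) Y(1), symmetric] Y(2) .
qed

lemma dd_sym:
  assumes "x \<in> tangent M p" "y \<in> tangent M p"
  shows "dd p x y = dd p y x"
proof -
  obtain X where X: "fieldM p X" "X p = x" using M.field_extension[OF assms(1)] .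
  obtain Y where Y: "fieldM p Y" "Y p = y" using M.field_extension[OF assms(2)] .
  show ?thesis using sff_sym[OF X(1) Y(1)] dd_sff[OF assms(1) Y(1)] dd_sff[OF assms(2) X(1)]
    unfolding X(2) Y(2) by (simp only:)
qed

lemma dd_linear:
  assumes "x \<in> tangent M p" "x' \<in> tangent M p" "y \<in> tangent M p"
  shows "dd p (a \<odot> x + b \<odot> x') y = a \<odot> dd p x y + b \<odot> dd p x' y"
proof -
  obtain Y where Y: "fieldM p Y" "Y p = y" using M.field_extension[OF assms(3)] .
  have s: "a \<odot> x + b \<odot> x' \<in> tangent M p" by (intro M.tangent_plus M.tangent_scale assms)
  show ?thesis
    using sff_linear[OF assms(1,2) Y(1), of a b]
    unfolding dd_sff[OF s Y(1), symmetric] dd_sff[OF assms(1) Y(1), symmetric] dd_sff[OF assms(2) Y(1), symmetric] Y(2) .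
qed

section \<open>Conformal partial connections\<close>

abbreviation "hfield \<equiv> hfield_near M N \<phi>"
abbreviation "vfield \<equiv> vfield_near M N \<phi>"

lemma hfieldD: "hfield p Y \<Longrightarrow> fieldM p Y" "hfield p Y \<Longrightarrow> \<forall>\<^sub>F q in nhds p. Y q \<in> Hor q" "hfield p Y \<Longrightarrow> Y p \<in> Hor p"
  unfolding hfield_near_iff by (erule conjunct1, erule conjunct2, erule conjE, rule eventually_nhds_x_imp_x)

lemma vfieldD: "vfield p Y \<Longrightarrow> fieldM p Y" "vfield p Y \<Longrightarrow> \<forall>\<^sub>F q in nhds p. Y q \<in> Ver q" "vfield p Y \<Longrightarrow> Y p \<in> Ver p"
  unfolding vfield_near_iff by (erule conjunct1, erule conjunct2, erule conjE, rule eventually_nhds_x_imp_x)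

text \<open>The image of a field on \<open>M\<close> need not come from a field on \<open>N\<close>,
  so the Weyl property of \<open>D\<^sup>N\<close> is applied to the coordinate fields of
  \<open>N\<close> and extended to all sections by the Leibniz rule. The constant \<open>a\<close>
  is the Lee form of \<open>D\<^sup>N\<close> at the image of \<open>x\<close>.\<close>

lemma pb_conformal:
  assumes ch: "(O1, h) \<in> conf N" "\<phi> p \<in> O1" and x: "x \<in> tangent M p"
  obtains a where "\<And>Y Z. fieldM p Y \<Longrightarrow> fieldM p Z \<Longrightarrow>
    x (\<lambda>q. h (\<phi> q) (d\<phi> q (Y q)) (d\<phi> q (Z q))) =
      h (\<phi> p) (pb p x Y) (d\<phi> p (Z p)) + h (\<phi> p) (d\<phi> p (Y p)) (pb p x Z)
      - 2 * a * h (\<phi> p) (d\<phi> p (Y p)) (d\<phi> p (Z p))"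
proof -
  note pp = M.tangent_carrier[OF x]
  interpret f: symmetric_form "tangent N (\<phi> p)" "h (\<phi> p)" by (rule N.conf_form[OF ch])
  obtain S y where c: "(S, y) \<in> atlas N" "\<phi> p \<in> S" and
    e0: "\<And>x Y. x \<in> tangent M p \<Longrightarrow> pb p x Y = pb_coord p S y x Y"
    by (rule pb_chart[OF pp]) (rule that; assumption)
  note e = e0[unfolded pb_coord_def]
  let ?t = "\<lambda>j q. y (\<phi> q) $ j" and ?d = "coord_field (atlas N) (S, y)"
  let ?E = "\<lambda>j. conn N (\<phi> p) (d\<phi> p x) (?d j)" and ?H = "\<lambda>j k r. h r (?d j r) (?d k r)"
  have t: "smM p (?t j)" for j by (rule smooth_coord[OF pp c])
  note dn = N.coord_field_near[OF c] and dT = N.coord_field_tangent[OF c]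
  have ET: "?E j \<in> tangent N (\<phi> p)" for j by (rule N.conn_tangent[OF diff_tangent[OF x] dn])
  obtain a where a: "\<And>Y Z. field_near (atlas N) (\<phi> p) Y \<Longrightarrow> field_near (atlas N) (\<phi> p) Z \<Longrightarrow>
    d\<phi> p x (\<lambda>q. h q (Y q) (Z q)) = h (\<phi> p) (conn N (\<phi> p) (d\<phi> p x) Y) (Z (\<phi> p)) +
      h (\<phi> p) (Y (\<phi> p)) (conn N (\<phi> p) (d\<phi> p x) Z) - 2 * a * h (\<phi> p) (Y (\<phi> p)) (Z (\<phi> p))"
    by (rule N.lee_form[OF ch diff_tangent[OF x]]) (rule that; assumption)
  have Hs: "smN (\<phi> p) (?H j k)" for j k by (rule N.metric_smooth[OF ch dn dn])
  have Hs': "smM p (\<lambda>q. ?H j k (\<phi> q))" for j k using smooth_pullback[OF pp Hs] unfolding comp_def .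
  \<comment> \<open>The Lee identity on \<open>N\<close>, read on \<open>M\<close>: the image of
    \<open>x\<close> acts on a smooth function as \<open>x\<close> does on its pull-back.\<close>
  have xH: "x (\<lambda>q. ?H j k (\<phi> q)) = h (\<phi> p) (?E j) (?d k (\<phi> p)) + h (\<phi> p) (?d j (\<phi> p)) (?E k) - 2 * a * ?H j k (\<phi> p)" for j k
    using a[OF dn dn, of j k] Hs[of j k] unfolding differential_def comp_def by simp
  show ?thesis
  proof (rule that[of a])
    fix Y Z assume Y: "fieldM p Y" and Z: "fieldM p Z"
    let ?Y = "\<lambda>j. Y p (?t j)" and ?Z = "\<lambda>j. Z p (?t j)"
    let ?Y' = "\<lambda>j. x (\<lambda>q. Y q (?t j))" and ?Z' = "\<lambda>j. x (\<lambda>q. Z q (?t j))"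
    note YT = M.field_near_tangent[OF Y] and ZT = M.field_near_tangent[OF Z]
    have Ys: "smM p (\<lambda>q. Y q (?t j))" and Zs: "smM p (\<lambda>q. Z q (?t j))" for j
      by (rule M.field_near_smooth[OF Y t], rule M.field_near_smooth[OF Z t])
    have hd: "h (\<phi> q) w (d\<phi> q v) = (\<Sum>k\<in>UNIV. v (?t k) * h (\<phi> q) w (?d k (\<phi> q)))"
      if "\<phi> q \<in> O1" "v \<in> tangent M q" "w \<in> tangent N (\<phi> q)" "\<phi> q \<in> S" for q v w
    proof -
      interpret fq: symmetric_form "tangent N (\<phi> q)" "h (\<phi> q)" by (rule N.conf_form[OF ch(1) that(1)])
      show ?thesis unfolding diff_eq_sum[OF that(2) c(1) that(4)]
        by (rule fq.linear_on_sum[OF fq.linear_g2[OF that(3)]]) (rule N.coord_field_tangent[OF c(1) that(4)])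
    qed
    have hdd: "h (\<phi> q) (d\<phi> q (Y q)) (d\<phi> q (Z q)) =
        (\<Sum>j\<in>UNIV. Y q (?t j) * (\<Sum>k\<in>UNIV. Z q (?t k) * ?H j k (\<phi> q)))"
      if "\<phi> q \<in> O1" "Y q \<in> tangent M q" "Z q \<in> tangent M q" "\<phi> q \<in> S" for q
    proof -
      interpret fq: symmetric_form "tangent N (\<phi> q)" "h (\<phi> q)" by (rule N.conf_form[OF ch(1) that(1)])
      have "h (\<phi> q) (d\<phi> q (Y q)) (d\<phi> q (Z q)) = (\<Sum>j\<in>UNIV. Y q (?t j) * h (\<phi> q) (?d j (\<phi> q)) (d\<phi> q (Z q)))"
        unfolding diff_eq_sum[OF that(2) c(1) that(4)]
        by (rule fq.linear_on_sum[OF fq.linear_g1[OF diff_tangent[OF that(3)]]]) (rule N.coord_field_tangent[OF c(1) that(4)])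
      then show ?thesis unfolding hd[OF that(1,3) N.coord_field_tangent[OF c(1) that(4)] that(4)] .
    qed
    have ev: "\<forall>\<^sub>F q in nhds p. h (\<phi> q) (d\<phi> q (Y q)) (d\<phi> q (Z q)) =
        (\<Sum>j\<in>UNIV. Y q (?t j) * (\<Sum>k\<in>UNIV. Z q (?t k) * ?H j k (\<phi> q)))"
      using phi_eventually[OF pp N.conf_eventually[OF ch]] phi_eventually[OF pp N.eventually_chart[OF c]]
        M.field_near_eventually_tangent[OF Y] M.field_near_eventually_tangent[OF Z]
      by eventually_elim (rule hdd)
    \<comment> \<open>\<open>?A\<close> and \<open>?B\<close> collect the derivatives of the
      components of \<open>Y\<close> and \<open>Z\<close>, \<open>?C\<close> and \<open>?D\<close>
      the connection applied to the coordinate fields in the first and in the second slot, and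
      \<open>?G\<close> is the undifferentiated product.\<close>
    let ?A = "\<Sum>j\<in>UNIV. \<Sum>k\<in>UNIV. ?Y' j * ?Z k * ?H j k (\<phi> p)"
    let ?B = "\<Sum>j\<in>UNIV. \<Sum>k\<in>UNIV. ?Y j * ?Z' k * ?H j k (\<phi> p)"
    let ?C = "\<Sum>j\<in>UNIV. \<Sum>k\<in>UNIV. ?Y j * ?Z k * h (\<phi> p) (?E j) (?d k (\<phi> p))"
    let ?D = "\<Sum>j\<in>UNIV. \<Sum>k\<in>UNIV. ?Y j * ?Z k * h (\<phi> p) (?d j (\<phi> p)) (?E k)"
    let ?G = "\<Sum>j\<in>UNIV. \<Sum>k\<in>UNIV. ?Y j * ?Z k * ?H j k (\<phi> p)"
    have s2: "smM p (\<lambda>q. \<Sum>k\<in>UNIV. Z q (?t k) * ?H j k (\<phi> q))" for j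
      by (intro M.smooth_at_sum[OF pp] M.smooth_at_mult Zs Hs')
    have L: "x (\<lambda>q. h (\<phi> q) (d\<phi> q (Y q)) (d\<phi> q (Z q))) = ?A + ?B + ?C + ?D - 2 * a * ?G"
    proof -
      have "x (\<lambda>q. h (\<phi> q) (d\<phi> q (Y q)) (d\<phi> q (Z q))) =
          x (\<lambda>q. \<Sum>j\<in>UNIV. Y q (?t j) * (\<Sum>k\<in>UNIV. Z q (?t k) * ?H j k (\<phi> q)))"
        by (rule M.tangent_cong[OF x ev])
      also have "\<dots> = (\<Sum>j\<in>UNIV. x (\<lambda>q. Y q (?t j) * (\<Sum>k\<in>UNIV. Z q (?t k) * ?H j k (\<phi> q))))"
        by (rule M.tangent_fsum[OF x M.smooth_at_mult[OF Ys s2]])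
      also have "\<dots> = (\<Sum>j\<in>UNIV. ?Y j * x (\<lambda>q. \<Sum>k\<in>UNIV. Z q (?t k) * ?H j k (\<phi> q)) + ?Y' j * (\<Sum>k\<in>UNIV. ?Z k * ?H j k (\<phi> p)))"
        unfolding M.tangent_mult[OF x Ys s2] ..
      also have "\<dots> = (\<Sum>j\<in>UNIV. ?Y j * (\<Sum>k\<in>UNIV. ?Z k * x (\<lambda>q. ?H j k (\<phi> q)) + ?Z' k * ?H j k (\<phi> p)) + ?Y' j * (\<Sum>k\<in>UNIV. ?Z k * ?H j k (\<phi> p)))"
        unfolding M.tangent_fsum[OF x M.smooth_at_mult[OF Zs Hs']] M.tangent_mult[OF x Zs Hs'] ..
      also have "\<dots> = ?A + ?B + ?C + ?D - 2 * a * ?G"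
        unfolding xH by (simp add: sum_distrib_left sum.distrib sum_subtractf algebra_simps)
      finally show ?thesis .
    qed
    have pbh: "h (\<phi> p) (pb p x X) w = (\<Sum>j\<in>UNIV. x (\<lambda>q. X q (?t j)) * h (\<phi> p) (?d j (\<phi> p)) w + X p (?t j) * h (\<phi> p) (?E j) w)"
      if "w \<in> tangent N (\<phi> p)" for X w
      unfolding e[OF x] by (rule f.linear_on_sum2[OF f.linear_g1[OF that]]) (rule dT ET)+
    have R1: "h (\<phi> p) (pb p x Y) (d\<phi> p (Z p)) = ?A + ?C"
      unfolding pbh[OF diff_tangent[OF ZT]] hd[OF ch(2) ZT dT c(2)] hd[OF ch(2) ZT ET c(2)]
      by (simp add: sum_distrib_left sum.distrib mult.assoc)
    have R2: "h (\<phi> p) (d\<phi> p (Y p)) (pb p x Z) = ?B + ?D"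
    proof -
      have "h (\<phi> p) (d\<phi> p (Y p)) (pb p x Z) = h (\<phi> p) (pb p x Z) (d\<phi> p (Y p))"
        by (rule f.sym[OF diff_tangent[OF YT] pb_tangent[OF x]])
      also have "\<dots> = (\<Sum>k\<in>UNIV. \<Sum>j\<in>UNIV. ?Y j * ?Z' k * ?H j k (\<phi> p)) +
          (\<Sum>k\<in>UNIV. \<Sum>j\<in>UNIV. ?Y j * ?Z k * h (\<phi> p) (?d j (\<phi> p)) (?E k))"
        unfolding pbh[OF diff_tangent[OF YT]] hd[OF ch(2) YT dT c(2)] hd[OF ch(2) YT ET c(2)]
        by (simp add: sum_distrib_left sum.distrib f.sym[OF dT dT] f.sym[OF ET dT] mult_ac)
      also have "\<dots> = ?B + ?D" by (rule arg_cong2[where f = "(+)"]; rule sum.swap)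
      finally show ?thesis .
    qed
    have R3: "h (\<phi> p) (d\<phi> p (Y p)) (d\<phi> p (Z p)) = ?G"
      unfolding hdd[OF ch(2) YT ZT c(2)] by (simp add: sum_distrib_left mult.assoc)
    show "x (\<lambda>q. h (\<phi> q) (d\<phi> q (Y q)) (d\<phi> q (Z q))) =
      h (\<phi> p) (pb p x Y) (d\<phi> p (Z p)) + h (\<phi> p) (d\<phi> p (Y p)) (pb p x Z)
      - 2 * a * h (\<phi> p) (d\<phi> p (Y p)) (d\<phi> p (Z p))"
      unfolding L R1 R2 R3 by (simp add: algebra_simps)
  qed
qed

text \<open>The common properties of \<open>HDM\<close> and \<open>HDN\<close> from which linearity
  and conformal behaviour of the induced form are derived once for both. The number \<open>a\<close>
  must serve all pairs of horizontal fields in the given direction.\<close>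

definition conformal_partial :: "('a, 'k) conn \<Rightarrow> bool" where
  "conformal_partial P \<longleftrightarrow>
    (\<forall>p x x' Y a b. x \<in> Hor p \<longrightarrow> x' \<in> Hor p \<longrightarrow> hfield p Y \<longrightarrow>
      P p x Y \<in> Hor p \<and> P p (a \<odot> x + b \<odot> x') Y = a \<odot> P p x Y + b \<odot> P p x' Y) \<and>
    (\<forall>W g p x. (W, g) \<in> conf M \<longrightarrow> p \<in> W \<longrightarrow> x \<in> Hor p \<longrightarrow> (\<exists>a. \<forall>Y Z. hfield p Y \<longrightarrow> hfield p Z \<longrightarrow>
      x (\<lambda>q. g q (Y q) (Z q)) = g p (P p x Y) (Z p) + g p (Y p) (P p x Z) - 2 * a * g p (Y p) (Z p)))"

lemma hpart_linear:
  assumes "v \<in> tangent M p" "w \<in> tangent M p"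
  shows "hp p (a \<odot> v + b \<odot> w) = a \<odot> hp p v + b \<odot> hp p w"
proof -
  obtain W g where c: "(W, g) \<in> conf M" "p \<in> W" using M.conf_cover[OF M.tangent_carrier[OF assms(1)]] .
  obtain e where "orthonormal_frame (atlas M) g p e" using M.conf_frame_exists[OF c] .
  then interpret frame_projection "tangent M p" "g p" e "Hor p" "hp p" by (rule H_projection[OF c])
  show ?thesis by (rule pi_linear[OF assms])
qed

text \<open>A pairing with horizontal vectors does not see the projection, so \<open>HDM\<close>
  inherits the Lee form of \<open>D\<^sup>M\<close>.\<close>

lemma HDM_metric:
  assumes c: "(W, g) \<in> conf M" "p \<in> W" and x: "x \<in> Hor p" and YZ: "hfield p Y" "hfield p Z"
  shows "g p (HDM M N \<phi> p x Y) (Z p) + g p (Y p) (HDM M N \<phi> p x Z) =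
    g p (conn M p x Y) (Z p) + g p (Y p) (conn M p x Z)"
proof -
  interpret f: symmetric_form "tangent M p" "g p" by (rule M.conf_form[OF c])
  note Y = hfieldD[OF YZ(1)] and Z = hfieldD[OF YZ(2)]
  note D = M.conn_tangent[OF H_tangent[OF x] Y(1)] M.conn_tangent[OF H_tangent[OF x] Z(1)]
  have "g p (Y p) (hp p (conn M p x Z)) = g p (hp p (conn M p x Z)) (Y p)"
    by (rule f.sym[OF H_tangent[OF Y(3)] H_tangent[OF hpart_H[OF D(2)]]])
  also have "\<dots> = g p (conn M p x Z) (Y p)" by (rule hpart_orth[OF c D(2) Y(3)])
  also have "\<dots> = g p (Y p) (conn M p x Z)" by (rule f.sym[OF D(2) H_tangent[OF Y(3)]])
  finally show ?thesis unfolding HDM_def hpart_orth[OF c D(1) Z(3)] by (rule arg_cong2[where f = "(+)", OF refl])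
qed

lemma conformal_partial_HDM: "conformal_partial (HDM M N \<phi>)"
  unfolding conformal_partial_def
proof (intro conjI allI impI)
  fix p x x' Y a b assume h: "x \<in> Hor p" "x' \<in> Hor p" "hfield p Y"
  note T = H_tangent[OF h(1)] H_tangent[OF h(2)] hfieldD(1)[OF h(3)]
  show "HDM M N \<phi> p x Y \<in> Hor p" unfolding HDM_def by (rule hpart_H[OF M.conn_tangent[OF T(1,3)]])
  show "HDM M N \<phi> p (a \<odot> x + b \<odot> x') Y = a \<odot> HDM M N \<phi> p x Y + b \<odot> HDM M N \<phi> p x' Y"
    unfolding HDM_def M.conn_dir[OF T(1,3,2)]
    by (rule hpart_linear[OF M.conn_tangent[OF T(1,3)] M.conn_tangent[OF T(2,3)]])
next
  fix W g p x assume c: "(W, g) \<in> conf M" "p \<in> W" and x: "x \<in> Hor p"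
  obtain a where a: "\<And>Y Z. fieldM p Y \<Longrightarrow> fieldM p Z \<Longrightarrow>
    x (\<lambda>q. g q (Y q) (Z q)) = g p (conn M p x Y) (Z p) + g p (Y p) (conn M p x Z) - 2 * a * g p (Y p) (Z p)"
    by (rule M.lee_form[OF c H_tangent[OF x]]) (rule that; assumption)
  have "x (\<lambda>q. g q (Y q) (Z q)) = g p (HDM M N \<phi> p x Y) (Z p) + g p (Y p) (HDM M N \<phi> p x Z) - 2 * a * g p (Y p) (Z p)"
    if "hfield p Y" "hfield p Z" for Y Z
    unfolding HDM_metric[OF c x that] by (rule a[OF hfieldD(1)[OF that(1)] hfieldD(1)[OF that(2)]])
  then show "\<exists>a. \<forall>Y Z. hfield p Y \<longrightarrow> hfield p Z \<longrightarrow>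
      x (\<lambda>q. g q (Y q) (Z q)) = g p (HDM M N \<phi> p x Y) (Z p) + g p (Y p) (HDM M N \<phi> p x Z) - 2 * a * g p (Y p) (Z p)"
    by (intro exI[of _ a] allI impI)
qed

lemma horizontally_conformalE:
  assumes "(W, g) \<in> conf M" "(O1, h) \<in> conf N" "p \<in> W" "\<phi> p \<in> O1"
  obtains l where "smM p l" "l p \<noteq> 0" "\<forall>\<^sub>F q in nhds p. \<forall>x\<in>Hor q. \<forall>y\<in>Hor q. h (\<phi> q) (d\<phi> q x) (d\<phi> q y) = l q * g q x y"
proof -
  have "\<forall>c\<in>conf M. case c of (W, g) \<Rightarrow> \<forall>c'\<in>conf N. case c' of (O1, h) \<Rightarrow> \<exists>l. reg_on cat (atlas M) (W \<inter> \<phi> -` O1) l \<and>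
      (\<forall>p\<in>W \<inter> \<phi> -` O1. l p \<noteq> 0 \<and> (\<forall>x\<in>Hor p. \<forall>y\<in>Hor p. h (\<phi> p) (d\<phi> p x) (d\<phi> p y) = l p * g p x y))"
    using hconf unfolding horizontally_conformal_def .
  from bspec[OF bspec[OF this assms(1), unfolded prod.case] assms(2), unfolded prod.case]
  obtain l where l: "reg_on cat (atlas M) (W \<inter> \<phi> -` O1) l"
    "\<forall>p\<in>W \<inter> \<phi> -` O1. l p \<noteq> 0 \<and> (\<forall>x\<in>Hor p. \<forall>y\<in>Hor p. h (\<phi> p) (d\<phi> p x) (d\<phi> p y) = l p * g p x y)"
    by (elim exE conjE)
  have pin: "p \<in> W \<inter> \<phi> -` O1" using assms(3,4) by simp
  have r: "open (W \<inter> \<phi> -` O1)" "\<forall>p\<in>W \<inter> \<phi> -` O1. smM p l"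
    using reg_on_imp_Smooth[OF l(1)] unfolding M.reg_on_Smooth_iff by simp_all
  have "\<forall>\<^sub>F q in nhds p. q \<in> W \<inter> \<phi> -` O1" unfolding eventually_nhds using r(1) pin by blast
  then have "\<forall>\<^sub>F q in nhds p. \<forall>x\<in>Hor q. \<forall>y\<in>Hor q. h (\<phi> q) (d\<phi> q x) (d\<phi> q y) = l q * g q x y"
    by (rule eventually_mono) (rule conjunct2[OF bspec[OF l(2)]])
  with bspec[OF r(2) pin] conjunct1[OF bspec[OF l(2) pin]] show ?thesis by (rule that)
qed

lemma conformal_partial_HDN: "conformal_partial (HDN M N \<phi>)"
  unfolding conformal_partial_def
proof (intro conjI allI impI)
  fix p x x' Y a b assume h: "x \<in> Hor p" "x' \<in> Hor p" "hfield p Y"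
  note T = H_tangent[OF h(1)] H_tangent[OF h(2)]
  show "HDN M N \<phi> p x Y \<in> Hor p" unfolding HDN_def by (rule hlift_H[OF M.tangent_carrier[OF T(1)] pb_tangent[OF T(1)]])
  show "HDN M N \<phi> p (a \<odot> x + b \<odot> x') Y = a \<odot> HDN M N \<phi> p x Y + b \<odot> HDN M N \<phi> p x' Y"
    unfolding HDN_def pb_linear[OF T]
    by (rule hlift_linear[OF M.tangent_carrier[OF T(1)] pb_tangent[OF T(1)] pb_tangent[OF T(2)]])
next
  fix W g p x assume c: "(W, g) \<in> conf M" "p \<in> W" and x: "x \<in> Hor p"
  note xT = H_tangent[OF x] and pp = M.conf_points[OF c]
  obtain O1 h where ch: "(O1, h) \<in> conf N" "\<phi> p \<in> O1" using N.conf_cover[OF phi_points[OF pp]] .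
  obtain l where l: "smM p l" "l p \<noteq> 0" "\<forall>\<^sub>F q in nhds p. \<forall>x\<in>Hor q. \<forall>y\<in>Hor q. h (\<phi> q) (d\<phi> q x) (d\<phi> q y) = l q * g q x y"
    using horizontally_conformalE[OF c(1) ch(1) c(2) ch(2)] .
  have lp: "h (\<phi> p) (d\<phi> p y) (d\<phi> p z) = l p * g p y z" if "y \<in> Hor p" "z \<in> Hor p" for y z
    using eventually_nhds_x_imp_x[OF l(3)] that by simp
  obtain a where a: "\<And>Y Z. fieldM p Y \<Longrightarrow> fieldM p Z \<Longrightarrow>
    x (\<lambda>q. h (\<phi> q) (d\<phi> q (Y q)) (d\<phi> q (Z q))) =
      h (\<phi> p) (pb p x Y) (d\<phi> p (Z p)) + h (\<phi> p) (d\<phi> p (Y p)) (pb p x Z)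
      - 2 * a * h (\<phi> p) (d\<phi> p (Y p)) (d\<phi> p (Z p))"
    by (rule pb_conformal[OF ch xT]) (rule that; assumption)
  \<comment> \<open>On horizontal vectors the pulled-back metric is \<open>l\<close> times
    \<open>g\<close>; differentiating the factor adds half its logarithmic derivative to the Lee
    form of \<open>D\<^sup>N\<close>.\<close>
  have "x (\<lambda>q. g q (Y q) (Z q)) = g p (HDN M N \<phi> p x Y) (Z p) + g p (Y p) (HDN M N \<phi> p x Z) -
      2 * (a + x l / (2 * l p)) * g p (Y p) (Z p)" if "hfield p Y" "hfield p Z" for Y Z
  proof -
    note Y = hfieldD[OF that(1)] and Z = hfieldD[OF that(2)]
    have lift: "lift p (pb p x X) \<in> Hor p" "d\<phi> p (lift p (pb p x X)) = pb p x X" for X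
      by (rule hlift_H[OF pp pb_tangent[OF xT]], rule diff_hlift[OF pp pb_tangent[OF xT]])
    have "l p * x (\<lambda>q. g q (Y q) (Z q)) + x l * g p (Y p) (Z p) = x (\<lambda>q. l q * g q (Y q) (Z q))"
      by (rule M.tangent_mult[OF xT l(1) M.metric_smooth[OF c Y(1) Z(1)], symmetric])
    also have "\<dots> = x (\<lambda>q. h (\<phi> q) (d\<phi> q (Y q)) (d\<phi> q (Z q)))"
      by (rule M.tangent_cong[OF xT]) (use l(3) Y(2) Z(2) in eventually_elim, simp)
    also have "\<dots> = h (\<phi> p) (pb p x Y) (d\<phi> p (Z p)) + h (\<phi> p) (d\<phi> p (Y p)) (pb p x Z)
      - 2 * a * h (\<phi> p) (d\<phi> p (Y p)) (d\<phi> p (Z p))" by (rule a[OF Y(1) Z(1)])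
    also have "h (\<phi> p) (pb p x Y) (d\<phi> p (Z p)) = l p * g p (HDN M N \<phi> p x Y) (Z p)"
      using lp[OF lift(1)[of Y] Z(3)] unfolding lift(2) HDN_def .
    also have "h (\<phi> p) (d\<phi> p (Y p)) (pb p x Z) = l p * g p (Y p) (HDN M N \<phi> p x Z)"
      using lp[OF Y(3) lift(1)[of Z]] unfolding lift(2) HDN_def .
    also have "h (\<phi> p) (d\<phi> p (Y p)) (d\<phi> p (Z p)) = l p * g p (Y p) (Z p)" by (rule lp[OF Y(3) Z(3)])
    finally have *: "l p * x (\<lambda>q. g q (Y q) (Z q)) + x l * g p (Y p) (Z p) =
        l p * g p (HDN M N \<phi> p x Y) (Z p) + l p * g p (Y p) (HDN M N \<phi> p x Z) - 2 * a * (l p * g p (Y p) (Z p))" .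
    have "2 * (a + x l / (2 * l p)) = 2 * a + x l / l p" by (simp add: distrib_left)
    then have "l p * (2 * (a + x l / (2 * l p)) * g p (Y p) (Z p)) = 2 * a * (l p * g p (Y p) (Z p)) + x l * g p (Y p) (Z p)"
      using l(2) by (simp add: distrib_left distrib_right)
    with * have "l p * x (\<lambda>q. g q (Y q) (Z q)) = l p * (g p (HDN M N \<phi> p x Y) (Z p) + g p (Y p) (HDN M N \<phi> p x Z) -
      2 * (a + x l / (2 * l p)) * g p (Y p) (Z p))" by (simp add: right_diff_distrib distrib_left eq_diff_eq add_ac)
    then show ?thesis using l(2) by (simp only: mult_cancel_left) simp
  qed
  then show "\<exists>a. \<forall>Y Z. hfield p Y \<longrightarrow> hfield p Z \<longrightarrow>
      x (\<lambda>q. g q (Y q) (Z q)) = g p (HDN M N \<phi> p x Y) (Z p) + g p (Y p) (HDN M N \<phi> p x Z) - 2 * a * g p (Y p) (Z p)"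
    by (intro exI[of _ "a + x l / (2 * l p)"] allI impI)
qed

text \<open>As index types are nonempty, \<open>N\<close> has positive dimension and the lift of a
  coordinate vector is nonzero; nondegeneracy on the horizontal space provides a partner. Such a
  pair makes the description in \<open>induced_on_L\<close> unique.\<close>

lemma H_pair:
  assumes "(W, g) \<in> conf M" "p \<in> W"
  obtains Y Z where "hfield p Y" "hfield p Z" "g p (Y p) (Z p) \<noteq> 0"
proof -
  note pp = M.conf_points[OF assms]
  obtain e where "orthonormal_frame (atlas M) g p e" using M.conf_frame_exists[OF assms] .
  then interpret frame_projection "tangent M p" "g p" e "Hor p" "hp p" by (rule H_projection[OF assms])
  obtain S y where c: "(S, y) \<in> atlas N" "\<phi> p \<in> S" using N.carrierE[OF phi_points[OF pp]] .
  obtain j :: 'n where True by simp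
  let ?d = "coord_field (atlas N) (S, y) j (\<phi> p)"
  note dT = N.coord_field_tangent[OF c, of j]
  have "lift p ?d \<noteq> 0"
  proof
    assume "lift p ?d = 0"
    with diff_hlift[OF pp dT] have "?d = 0" unfolding diff_0 by (simp only: diff_0)
    moreover have "?d (\<lambda>q. y q $ j) = 1" by (simp add: N.coord_field_coord[OF c])
    ultimately show False by (simp only: zero_fun_apply zero_neq_one)
  qed
  have "\<not> (\<forall>z\<in>Hor p. g p (lift p ?d) z = 0)"
  proof
    assume "\<forall>z\<in>Hor p. g p (lift p ?d) z = 0"
    from nondegenerate_B[OF hlift_H[OF pp dT] bspec[OF this]] \<open>lift p ?d \<noteq> 0\<close> show False by contradiction
  qed
  then obtain z where z: "z \<in> Hor p" "g p (lift p ?d) z \<noteq> 0" unfolding ball_simps by (elim bexE)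
  obtain Y where Y: "hfield p Y" "Y p = lift p ?d" using hfield_extension[OF hlift_H[OF pp dT]] .
  obtain Z where Z: "hfield p Z" "Z p = z" using hfield_extension[OF z(1)] .
  show ?thesis by (rule that[OF Y(1) Z(1)]) (simp only: Y(2) Z(2) z(2) not_False_eq_True)
qed

section \<open>Induced connection forms on the powers of \<open>L\<close>\<close>

lemma induced_unique:
  assumes c: "(W, g) \<in> conf M" "p \<in> W"
    and a: "\<And>Y Z. hfield p Y \<Longrightarrow> hfield p Z \<Longrightarrow>
      x (\<lambda>q. g q (Y q) (Z q)) = g p (P p x Y) (Z p) + g p (Y p) (P p x Z) - 2 * a * g p (Y p) (Z p)"
  shows "induced_on_L M N \<phi> P g p x = a"
  unfolding induced_on_L_def
proof (rule the_equality)
  show "\<forall>Y Z. hfield p Y \<and> hfield p Z \<longrightarrow>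
     x (\<lambda>q. g q (Y q) (Z q)) - g p (P p x Y) (Z p) - g p (Y p) (P p x Z) = - 2 * a * g p (Y p) (Z p)"
  proof (intro allI impI, elim conjE)
    fix Y Z assume "hfield p Y" "hfield p Z"
    from a[OF this] show "x (\<lambda>q. g q (Y q) (Z q)) - g p (P p x Y) (Z p) - g p (Y p) (P p x Z) = - 2 * a * g p (Y p) (Z p)"
      by simp
  qed
  fix b assume b: "\<forall>Y Z. hfield p Y \<and> hfield p Z \<longrightarrow>
     x (\<lambda>q. g q (Y q) (Z q)) - g p (P p x Y) (Z p) - g p (Y p) (P p x Z) = - 2 * b * g p (Y p) (Z p)"
  obtain Y Z where YZ: "hfield p Y" "hfield p Z" "g p (Y p) (Z p) \<noteq> 0" using H_pair[OF c] .
  have "x (\<lambda>q. g q (Y q) (Z q)) - g p (P p x Y) (Z p) - g p (Y p) (P p x Z) = - 2 * b * g p (Y p) (Z p)"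
    by (rule b[rule_format, OF conjI[OF YZ(1,2)]])
  then have "b * g p (Y p) (Z p) = a * g p (Y p) (Z p)" unfolding a[OF YZ(1,2)] by auto
  then show "b = a" using YZ(3) by simp
qed

lemma induced_eq:
  assumes P: "conformal_partial P" and c: "(W, g) \<in> conf M" "p \<in> W" and x: "x \<in> Hor p"
    and YZ: "hfield p Y" "hfield p Z"
  shows "x (\<lambda>q. g q (Y q) (Z q)) = g p (P p x Y) (Z p) + g p (Y p) (P p x Z) -
    2 * induced_on_L M N \<phi> P g p x * g p (Y p) (Z p)"
proof -
  from conjunct2[OF P[unfolded conformal_partial_def], rule_format, OF c x]
  obtain a where a: "\<forall>Y Z. hfield p Y \<longrightarrow> hfield p Z \<longrightarrow>
      x (\<lambda>q. g q (Y q) (Z q)) = g p (P p x Y) (Z p) + g p (Y p) (P p x Z) - 2 * a * g p (Y p) (Z p)" by (elim exE)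
  have "induced_on_L M N \<phi> P g p x = a" by (rule induced_unique[OF c]) (rule a[rule_format])
  with a[rule_format, OF YZ] show ?thesis by simp
qed

lemma induced_linear:
  assumes P: "conformal_partial P" and c: "(W, g) \<in> conf M" "p \<in> W" and x: "x \<in> Hor p" and x': "x' \<in> Hor p"
  shows "induced_on_L M N \<phi> P g p (a \<odot> x + b \<odot> x') = a * induced_on_L M N \<phi> P g p x + b * induced_on_L M N \<phi> P g p x'"
proof (rule induced_unique[OF c])
  fix Y Z assume YZ: "hfield p Y" "hfield p Z"
  interpret f: symmetric_form "tangent M p" "g p" by (rule M.conf_form[OF c])
  note Y = hfieldD[OF YZ(1)] and Z = hfieldD[OF YZ(2)]
  note PP = conjunct1[OF P[unfolded conformal_partial_def], rule_format]
  have T: "P p z X \<in> tangent M p" if "z \<in> Hor p" "hfield p X" for z X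
    using PP[OF that(1) that(1) that(2)] by (intro H_tangent) simp
  have l: "P p (a \<odot> x + b \<odot> x') X = a \<odot> P p x X + b \<odot> P p x' X" if "hfield p X" for X
    using PP[OF x x' that] by simp
  have "(a \<odot> x + b \<odot> x') (\<lambda>q. g q (Y q) (Z q)) = a * x (\<lambda>q. g q (Y q) (Z q)) + b * x' (\<lambda>q. g q (Y q) (Z q))"
    by (simp add: tscale_apply)
  then show "(a \<odot> x + b \<odot> x') (\<lambda>q. g q (Y q) (Z q)) = g p (P p (a \<odot> x + b \<odot> x') Y) (Z p) +
      g p (Y p) (P p (a \<odot> x + b \<odot> x') Z) -
      2 * (a * induced_on_L M N \<phi> P g p x + b * induced_on_L M N \<phi> P g p x') * g p (Y p) (Z p)"
    unfolding induced_eq[OF P c x YZ] induced_eq[OF P c x' YZ] l[OF YZ(1)] l[OF YZ(2)]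
      f.linear_onD[OF f.linear_g1[OF H_tangent[OF Z(3)]] T[OF x YZ(1)] T[OF x' YZ(1)]]
      f.linear_onD[OF f.linear_g2[OF H_tangent[OF Y(3)]] T[OF x YZ(2)] T[OF x' YZ(2)]]
    by (simp add: algebra_simps)
qed

text \<open>The factor in \<open>connection_forms_on_L_power\<close> is a given smooth function; it
  cannot vanish because \<open>g'\<close> pairs some horizontal vectors nontrivially by
  \<open>H_pair\<close>.\<close>

lemma conformal_factor_nonzero:
  assumes "(W, g) \<in> conf M" "(W', g') \<in> conf M" "p \<in> W" "p \<in> W'"
    and "\<forall>x\<in>tangent M p. \<forall>y\<in>tangent M p. g' p x y = c * g p x y"
  shows "c \<noteq> 0"
proof
  assume "c = 0"
  obtain Y Z where YZ: "hfield p Y" "hfield p Z" "g' p (Y p) (Z p) \<noteq> 0" using H_pair[OF assms(2,4)] .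
  then show False using assms(5) H_tangent[OF hfieldD(3)[OF YZ(1)]] H_tangent[OF hfieldD(3)[OF YZ(2)]] \<open>c = 0\<close> by simp
qed

text \<open>The Leibniz rule for \<open>\<mu>\<close> times \<open>g\<close> adds a multiple of
  \<open>g\<close> itself to the derivative, and the term with the factor -2 in the conformality
  identity absorbs it as half a logarithmic derivative.\<close>

lemma induced_conformal:
  assumes P: "conformal_partial P" and c: "(W, g) \<in> conf M" "p \<in> W" and c': "(W', g') \<in> conf M" "p \<in> W'"
    and x: "x \<in> Hor p" and mu: "smM p \<mu>"
    and ev: "\<forall>\<^sub>F q in nhds p. \<forall>x\<in>tangent M q. \<forall>y\<in>tangent M q. g' q x y = \<mu> q * g q x y"
  shows "induced_on_L M N \<phi> P g' p x = induced_on_L M N \<phi> P g p x - x \<mu> / (2 * \<mu> p)"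
proof (rule induced_unique[OF c'])
  fix Y Z assume YZ: "hfield p Y" "hfield p Z"
  note Y = hfieldD[OF YZ(1)] and Z = hfieldD[OF YZ(2)]
  note xT = H_tangent[OF x]
  note PP = conjunct1[OF P[unfolded conformal_partial_def], rule_format]
  have T: "P p x X \<in> tangent M p" if "hfield p X" for X
    using PP[OF x x that] by (intro H_tangent) simp
  note at = eventually_nhds_x_imp_x[OF ev]
  have nz: "\<mu> p \<noteq> 0" by (rule conformal_factor_nonzero[OF c(1) c'(1) c(2) c'(2) at])
  have "x (\<lambda>q. g' q (Y q) (Z q)) = x (\<lambda>q. \<mu> q * g q (Y q) (Z q))"
    by (rule M.tangent_cong[OF xT])
      (use ev M.field_near_eventually_tangent[OF Y(1)] M.field_near_eventually_tangent[OF Z(1)] in eventually_elim, simp)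
  also have "\<dots> = \<mu> p * x (\<lambda>q. g q (Y q) (Z q)) + x \<mu> * g p (Y p) (Z p)"
    by (rule M.tangent_mult[OF xT mu M.metric_smooth[OF c Y(1) Z(1)]])
  finally have e: "x (\<lambda>q. g' q (Y q) (Z q)) = \<mu> p * x (\<lambda>q. g q (Y q) (Z q)) + x \<mu> * g p (Y p) (Z p)" .
  have r: "2 * (b - x \<mu> / (2 * \<mu> p)) * (\<mu> p * G) = 2 * b * (\<mu> p * G) - x \<mu> * G" for b G
    using nz by (simp add: right_diff_distrib left_diff_distrib)
  have g': "g' p v w = \<mu> p * g p v w" if "v \<in> tangent M p" "w \<in> tangent M p" for v w
    by (rule at[rule_format, OF that])
  note YT = H_tangent[OF Y(3)] and ZT = H_tangent[OF Z(3)]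
  show "x (\<lambda>q. g' q (Y q) (Z q)) = g' p (P p x Y) (Z p) + g' p (Y p) (P p x Z) -
      2 * (induced_on_L M N \<phi> P g p x - x \<mu> / (2 * \<mu> p)) * g' p (Y p) (Z p)"
    unfolding e induced_eq[OF P c x YZ] g'[OF T[OF YZ(1)] ZT] g'[OF YT T[OF YZ(2)]] g'[OF YT ZT] r
    by (simp add: right_diff_distrib distrib_left)
qed

lemma connection_formsI:
  assumes lin: "\<And>W g p x y a b. (W, g) \<in> conf M \<Longrightarrow> p \<in> W \<Longrightarrow> x \<in> Hor p \<Longrightarrow> y \<in> Hor p \<Longrightarrow>
      A g p (a \<odot> x + b \<odot> y) = a * A g p x + b * A g p y"
    and tr: "\<And>W g W' g' p x \<mu>. (W, g) \<in> conf M \<Longrightarrow> p \<in> W \<Longrightarrow> (W', g') \<in> conf M \<Longrightarrow> p \<in> W' \<Longrightarrow> smM p \<mu> \<Longrightarrow>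
      \<forall>\<^sub>F q in nhds p. \<forall>x\<in>tangent M q. \<forall>y\<in>tangent M q. g' q x y = \<mu> q * g q x y \<Longrightarrow> x \<in> Hor p \<Longrightarrow>
      A g' p x = A g p x - of_int k / 2 * (x \<mu> / \<mu> p)"
  shows "connection_forms_on_L_power k M N \<phi> A"
proof -
  have 1: "A g' p x = A g p x - of_int k / 2 * (x \<mu> / \<mu> p)"
    if c: "(W, g) \<in> conf M" "p \<in> W" "(W', g') \<in> conf M" and h: "p \<in> O' \<and> O' \<subseteq> W \<inter> W' \<and> reg_on Smooth (atlas M) O' \<mu> \<and>
        (\<forall>q\<in>O'. \<forall>x\<in>tangent M q. \<forall>y\<in>tangent M q. g' q x y = \<mu> q * g q x y)" and x: "x \<in> Hor p" for W g p W' g' O' \<mu> x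
  proof (rule tr[OF c _ _ _ x])
    show "p \<in> W'" using h by blast
    have r: "open O'" "\<forall>p\<in>O'. smM p \<mu>" using h unfolding M.reg_on_Smooth_iff by simp_all
    show "smM p \<mu>" using r(2) h by simp
    show "\<forall>\<^sub>F q in nhds p. \<forall>x\<in>tangent M q. \<forall>y\<in>tangent M q. g' q x y = \<mu> q * g q x y"
      unfolding eventually_nhds using r(1) h by (intro exI[of _ O']) simp
  qed
  have "case c of (W, g) \<Rightarrow> \<forall>p\<in>W.
     (\<forall>x\<in>Hor p. \<forall>y\<in>Hor p. \<forall>a b. A g p (a \<odot> x + b \<odot> y) = a * A g p x + b * A g p y) \<and>
     (\<forall>(W', g')\<in>conf M. \<forall>\<mu> O'. p \<in> O' \<and> O' \<subseteq> W \<inter> W' \<and> reg_on Smooth (atlas M) O' \<mu> \<and>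
        (\<forall>q\<in>O'. \<forall>x\<in>tangent M q. \<forall>y\<in>tangent M q. g' q x y = \<mu> q * g q x y) \<longrightarrow>
        (\<forall>x\<in>Hor p. A g' p x = A g p x - of_int k / 2 * (x \<mu> / \<mu> p)))" if c: "c \<in> conf M" for c
  proof -
    obtain W g where e: "c = (W, g)" by (cases c)
    note cW = c[unfolded e]
    show ?thesis unfolding e prod.case
    proof (intro ballI conjI allI)
      fix p x y a b assume "p \<in> W" "x \<in> Hor p" "y \<in> Hor p"
      then show "A g p (a \<odot> x + b \<odot> y) = a * A g p x + b * A g p y" by (rule lin[OF cW])
    next
      fix p c' assume p: "p \<in> W" and c': "c' \<in> conf M"
      obtain W' g' where e': "c' = (W', g')" by (cases c')
      show "case c' of (W', g') \<Rightarrow> \<forall>\<mu> O'. p \<in> O' \<and> O' \<subseteq> W \<inter> W' \<and> reg_on Smooth (atlas M) O' \<mu> \<and>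
        (\<forall>q\<in>O'. \<forall>x\<in>tangent M q. \<forall>y\<in>tangent M q. g' q x y = \<mu> q * g q x y) \<longrightarrow>
        (\<forall>x\<in>Hor p. A g' p x = A g p x - of_int k / 2 * (x \<mu> / \<mu> p))"
        unfolding e' prod.case by (intro allI impI ballI) (rule 1[OF cW p c'[unfolded e']])
    qed
  qed
  then show ?thesis unfolding connection_forms_on_L_power_def by (rule ballI)
qed

end


section \<open>The Bott connection and the trace formula\<close>

text \<open>Every permutation other than the identity meets an off-diagonal entry. For a frame that
  is orthogonal and non-isotropic at the point the determinant is therefore nonzero, which makes the
  Bott form unique.\<close>

lemma gram_det_orthogonal:
  assumes "\<And>i j. i < r \<Longrightarrow> j < r \<Longrightarrow> i \<noteq> j \<Longrightarrow> g q (U i q) (U j q) = 0"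
  shows "gram_det g r U q = (\<Prod>i<r. g q (U i q) (U i q))"
proof -
  have "gram_det g r U q = (\<Sum>\<pi>\<in>{id}. of_int (sign \<pi>) * (\<Prod>i<r. g q (U i q) (U (\<pi> i) q)))"
    unfolding gram_det_def
  proof (rule sum.mono_neutral_right)
    show "finite {\<pi>. \<pi> permutes {..<r}}" by (rule finite_permutations) simp
    show "{id} \<subseteq> {\<pi>. \<pi> permutes {..<r}}" using permutes_id by simp
    show "\<forall>\<pi>\<in>{\<pi>. \<pi> permutes {..<r}} - {id}. of_int (sign \<pi>) * (\<Prod>i<r. g q (U i q) (U (\<pi> i) q)) = 0"
    proof
      fix \<pi> assume "\<pi> \<in> {\<pi>. \<pi> permutes {..<r}} - {id}"
      then have p: "\<pi> permutes {..<r}" "\<pi> \<noteq> id" by simp_all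
      obtain i where i: "\<pi> i \<noteq> i" using p(2) by (auto simp: fun_eq_iff)
      have ir: "i < r" using permutes_not_in[OF p(1), of i] i by auto
      have "\<pi> i < r" using permutes_in_image[OF p(1), of i] ir by simp
      then have "g q (U i q) (U (\<pi> i) q) = 0" using assms[of i "\<pi> i"] ir i by simp
      then have "(\<Prod>i<r. g q (U i q) (U (\<pi> i) q)) = 0" using ir by (intro prod_zero) auto
      then show "of_int (sign \<pi>) * (\<Prod>i<r. g q (U i q) (U (\<pi> i) q)) = 0" by simp
    qed
  qed
  then show ?thesis by simp
qed

context mfd
begin

text \<open>With \<open>G\<close> the Gram matrix the last hypothesis says that its derivative is C
  G plus the transpose of C G. The two summands contribute the trace of C each, by Jacobi's formula
  along rows and along columns.\<close>

lemma tangent_gram_det: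
  assumes v: "v \<in> tangent_space \<A> p"
    and sm: "\<And>i j. i < r \<Longrightarrow> j < r \<Longrightarrow> smooth_at \<A> p (\<lambda>q. g q (U i q) (U j q))"
    and sym: "\<And>i j. i < r \<Longrightarrow> j < r \<Longrightarrow> g p (U i p) (U j p) = g p (U j p) (U i p)"
    and C: "\<And>k l. k < r \<Longrightarrow> l < r \<Longrightarrow> v (\<lambda>q. g q (U k q) (U l q)) =
      (\<Sum>j<r. C k j * g p (U j p) (U l p)) + (\<Sum>j<r. C l j * g p (U j p) (U k p))"
  shows "v (gram_det g r U) = 2 * (\<Sum>k<r. C k k) * gram_det g r U p"
proof -
  note pp = tangent_carrier[OF v]
  let ?P = "{\<pi>. \<pi> permutes {..<r}}" and ?G = "\<lambda>i j q. g q (U i q) (U j q)"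
  have lt: "\<pi> i < r" if "\<pi> \<in> ?P" "i < r" for \<pi> i
    using permutes_in_image[of \<pi> "{..<r}" i] that by simp
  have sp: "smooth_at \<A> p (\<lambda>q. \<Prod>i<r. ?G i (\<pi> i) q)" if "\<pi> \<in> ?P" for \<pi>
    by (rule smooth_at_prod[OF pp sm]) (use lt[OF that] in auto)
  have "v (gram_det g r U) = v (\<lambda>q. \<Sum>\<pi>\<in>?P. of_int (sign \<pi>) * (\<Prod>i<r. ?G i (\<pi> i) q))"
    unfolding gram_det_def ..
  also have "\<dots> = (\<Sum>\<pi>\<in>?P. v (\<lambda>q. of_int (sign \<pi>) * (\<Prod>i<r. ?G i (\<pi> i) q)))"
    by (rule tangent_fsum[OF v smooth_at_mult[OF smooth_at_const[OF pp] sp]])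
  also have "\<dots> = (\<Sum>\<pi>\<in>?P. of_int (sign \<pi>) * (\<Sum>k<r. (\<Sum>j<r. C k j * ?G j (\<pi> k) p) * (\<Prod>i\<in>{..<r} - {k}. ?G i (\<pi> i) p)) +
      of_int (sign \<pi>) * (\<Sum>k<r. (\<Sum>j<r. C (\<pi> k) j * ?G j k p) * (\<Prod>i\<in>{..<r} - {k}. ?G i (\<pi> i) p)))"
  proof (rule sum.cong[OF refl])
    fix \<pi> assume \<pi>: "\<pi> \<in> ?P"
    have "v (\<lambda>q. of_int (sign \<pi>) * (\<Prod>i<r. ?G i (\<pi> i) q)) = of_int (sign \<pi>) * v (\<lambda>q. \<Prod>i<r. ?G i (\<pi> i) q)"
      unfolding tangent_mult[OF v smooth_at_const[OF pp] sp[OF \<pi>]] tangent_const[OF v] by simp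
    also have "v (\<lambda>q. \<Prod>i<r. ?G i (\<pi> i) q) = (\<Sum>k<r. v (?G k (\<pi> k)) * (\<Prod>i\<in>{..<r} - {k}. ?G i (\<pi> i) p))"
      by (rule tangent_fprod[OF v finite_lessThan sm]) (use lt[OF \<pi>] in auto)
    also have "\<dots> = (\<Sum>k<r. ((\<Sum>j<r. C k j * ?G j (\<pi> k) p) + (\<Sum>j<r. C (\<pi> k) j * ?G j k p)) * (\<Prod>i\<in>{..<r} - {k}. ?G i (\<pi> i) p))"
      by (rule sum.cong[OF refl]) (use C lt[OF \<pi>] in simp)
    finally show "v (\<lambda>q. of_int (sign \<pi>) * (\<Prod>i<r. ?G i (\<pi> i) q)) =
        of_int (sign \<pi>) * (\<Sum>k<r. (\<Sum>j<r. C k j * ?G j (\<pi> k) p) * (\<Prod>i\<in>{..<r} - {k}. ?G i (\<pi> i) p)) +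
        of_int (sign \<pi>) * (\<Sum>k<r. (\<Sum>j<r. C (\<pi> k) j * ?G j k p) * (\<Prod>i\<in>{..<r} - {k}. ?G i (\<pi> i) p))"
      by (simp add: distrib_left distrib_right sum.distrib)
  qed
  also have "\<dots> = (\<Sum>k<r. C k k) * gram_det g r U p + (\<Sum>k<r. C k k) * gram_det g r U p"
    unfolding sum.distrib gram_det_def
    by (rule arg_cong2[where f = "(+)", OF jacobi_rows[where G = "\<lambda>i j. ?G i j p"]
      jacobi_columns[where G = "\<lambda>i j. ?G i j p"]]) (rule sym)
  finally show ?thesis by (simp add: mult.assoc)
qed

end

context weyl_submersion
begin

abbreviation "\<alpha>M \<equiv> induced_on_L M N \<phi> (HDM M N \<phi>)"
abbreviation "\<alpha>N \<equiv> induced_on_L M N \<phi> (HDN M N \<phi>)"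
abbreviation "vp \<equiv> vpart M N \<phi>"

lemma hlift_minus:
  assumes "p \<in> points M" "v \<in> tangent N (\<phi> p)" "w \<in> tangent N (\<phi> p)"
  shows "lift p (v - w) = lift p v - lift p w"
  by (rule hlift_eqI[OF tv.subspace_diff[OF H_subspace[OF assms(1)] hlift_H[OF assms(1,2)] hlift_H[OF assms(1,3)]]])
    (simp only: diff_diff diff_hlift[OF assms(1,2)] diff_hlift[OF assms(1,3)])

lemma hlift_sum:
  assumes pp: "p \<in> points M" and fin: "finite I" and w: "\<And>i. i \<in> I \<Longrightarrow> w i \<in> tangent N (\<phi> p)"
  shows "lift p (\<Sum>i\<in>I. w i) = (\<Sum>i\<in>I. lift p (w i))"
  using fin w
proof (induction I rule: finite_induct)
  case empty
  show ?case unfolding sum.empty by (rule hlift_eqI[OF tv.subspace_0[OF H_subspace[OF pp]] diff_0])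
next
  case (insert i I)
  have wi: "w i \<in> tangent N (\<phi> p)" by (rule insert.prems) (rule insertI1)
  have wI: "\<And>j. j \<in> I \<Longrightarrow> w j \<in> tangent N (\<phi> p)" by (rule insert.prems) (rule insertI2)
  have IH: "lift p (\<Sum>i\<in>I. w i) = (\<Sum>i\<in>I. lift p (w i))" by (rule insert.IH) (rule wI)
  have s: "(\<Sum>i\<in>I. w i) \<in> tangent N (\<phi> p)" by (rule N.tangent_sum[OF phi_points[OF pp] wI])
  from hlift_linear[OF pp wi s, of 1 1] show ?case
    unfolding tv.scale_one sum.insert[OF insert.hyps] IH .
qed

section \<open>The second fundamental form on horizontal and on vertical vectors\<close>

lemma dd_horizontal:
  assumes x: "x \<in> Hor p" and Y: "hfield p Y"
  shows "lift p (dd p x (Y p)) = HDN M N \<phi> p x Y - HDM M N \<phi> p x Y"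
proof -
  note xT = H_tangent[OF x] and YF = hfieldD(1)[OF Y]
  show ?thesis
    unfolding dd_sff[OF xT YF] sff_def HDN_def HDM_def
      hlift_minus[OF M.tangent_carrier[OF xT] pb_tangent[OF xT] diff_tangent[OF M.conn_tangent[OF xT YF]]]
      hlift_diff[OF M.conn_tangent[OF xT YF]] ..
qed

lemma pb_vertical:
  assumes u: "u \<in> tangent M p" and U: "vfield p U"
  shows "pb p u U = 0"
proof -
  obtain S y where c: "(S, y) \<in> atlas N" "\<phi> p \<in> S" and
    e: "\<And>x \<sigma>. pullback_conn N \<phi> p x \<sigma> = (\<Sum>j\<in>UNIV. x (\<lambda>q. \<sigma> q (\<lambda>r. y r $ j)) \<odot> coord_field (atlas N) (S, y) j (\<phi> p) +
        \<sigma> p (\<lambda>r. y r $ j) \<odot> conn N (\<phi> p) (d\<phi> p x) (coord_field (atlas N) (S, y) j))"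
    by (rule pullback_chart[OF M.tangent_carrier[OF u]]) (rule that; assumption)
  have "u (\<lambda>q. d\<phi> q (U q) (\<lambda>r. y r $ j)) = u (\<lambda>q. 0)" for j
    by (rule M.tangent_cong[OF u], rule eventually_mono[OF vfieldD(2)[OF U]]) (simp only: V_diff zero_fun_apply)
  then have 1: "u (\<lambda>q. d\<phi> q (U q) (\<lambda>r. y r $ j)) = 0" for j unfolding M.tangent_const[OF u] .
  show ?thesis unfolding e 1 V_diff[OF vfieldD(3)[OF U]] zero_fun_apply tv.scale_zero_left add_0_left sum.neutral_const ..
qed

lemma dd_vertical:
  assumes c: "(W, g) \<in> conf M" "p \<in> W" and u: "u \<in> tangent M p" and U: "vfield p U" and x: "x \<in> Hor p"
  shows "g p (lift p (dd p u (U p))) x = - g p (conn M p u U) x"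
proof -
  interpret f: symmetric_form "tangent M p" "g p" by (rule M.conf_form[OF c])
  note UF = vfieldD(1)[OF U] and pp = M.conf_points[OF c]
  note D = M.conn_tangent[OF u UF]
  have z: "0 \<in> tangent N (\<phi> p)" by (rule N.tangent_0[OF phi_points[OF pp]])
  have "lift p (dd p u (U p)) = lift p (0 - d\<phi> p (conn M p u U))"
    unfolding dd_sff[OF u UF] sff_def pb_vertical[OF u U] ..
  also have "\<dots> = lift p 0 - hp p (conn M p u U)"
    unfolding hlift_minus[OF pp z diff_tangent[OF D]] hlift_diff[OF D] ..
  finally have e: "lift p (dd p u (U p)) = lift p 0 - hp p (conn M p u U)" .
  have l0: "lift p 0 = 0" by (rule hlift_eqI[OF tv.subspace_0[OF H_subspace[OF pp]] diff_0])
  have "g p (0 - hp p (conn M p u U)) x = g p 0 x - g p (hp p (conn M p u U)) x"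
    by (rule f.linear_on_diff[OF f.linear_g1[OF H_tangent[OF x]] M.tangent_0[OF pp] H_tangent[OF hpart_H[OF D]]])
  then show ?thesis
    unfolding e l0 f.linear_on_0[OF f.linear_g1[OF H_tangent[OF x]]] hpart_orth[OF c D x] by simp
qed

text \<open>Extend \<open>z\<close> and \<open>w\<close> to horizontal fields and subtract the
  conformality identities of \<open>HDN\<close> and \<open>HDM\<close>; the derivative of their
  product along \<open>y\<close> is common to both.\<close>

lemma dd_conformal:
  assumes c: "(W, g) \<in> conf M" "p \<in> W" and y: "y \<in> Hor p" and z: "z \<in> Hor p" and w: "w \<in> Hor p"
  shows "g p (lift p (dd p y z)) w + g p z (lift p (dd p y w)) = 2 * (\<alpha>N g p y - \<alpha>M g p y) * g p z w"
proof -
  interpret f: symmetric_form "tangent M p" "g p" by (rule M.conf_form[OF c])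
  obtain Z where Z: "hfield p Z" "Z p = z" using hfield_extension[OF z] .
  obtain Y where Y: "hfield p Y" "Y p = w" using hfield_extension[OF w] .
  have T: "HDM M N \<phi> p y X \<in> tangent M p" "HDN M N \<phi> p y X \<in> tangent M p" if "hfield p X" for X
    using conjunct1[OF conformal_partial_HDM[unfolded conformal_partial_def], rule_format, OF y y that]
      conjunct1[OF conformal_partial_HDN[unfolded conformal_partial_def], rule_format, OF y y that]
    by (intro H_tangent; simp)+
  note zT = H_tangent[OF z] and wT = H_tangent[OF w]
  show ?thesis
    using induced_eq[OF conformal_partial_HDM c y Z(1) Y(1)] induced_eq[OF conformal_partial_HDN c y Z(1) Y(1)]
      dd_horizontal[OF y Z(1)] dd_horizontal[OF y Y(1)]
      f.linear_on_diff[OF f.linear_g1[OF wT] T(2,1)[OF Z(1)]] f.linear_on_diff[OF f.linear_g2[OF zT] T(2,1)[OF Y(1)]]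
    unfolding Z(2) Y(2) by (simp only:) (simp add: algebra_simps)
qed

text \<open>Frame independence of traces is available for scalar forms; evaluation on a function
  \<open>f\<close> brings the vector-valued form \<open>dd\<close> under it.\<close>

lemma bilinear_dd_apply:
  assumes "(W, g) \<in> conf M" "p \<in> W"
  shows "symmetric_form.bilinear_on (tangent M p) (\<lambda>y z. dd p y z f)"
proof -
  interpret f: symmetric_form "tangent M p" "g p" by (rule M.conf_form[OF assms])
  have l: "dd p (a \<odot> y + b \<odot> z) x f = a * dd p y x f + b * dd p z x f"
    if "x \<in> tangent M p" "y \<in> tangent M p" "z \<in> tangent M p" for x y z a b
    unfolding dd_linear[OF that(2,3,1)] by (simp add: tscale_apply)
  have "dd p x (a \<odot> y + b \<odot> z) f = a * dd p x y f + b * dd p x z f"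
    if "x \<in> tangent M p" "y \<in> tangent M p" "z \<in> tangent M p" for x y z a b
    using l[OF that, of a b]
    unfolding dd_sym[OF that(1) M.tangent_plus[OF M.tangent_scale[OF that(2)] M.tangent_scale[OF that(3)]]]
      dd_sym[OF that(1,2)] dd_sym[OF that(1,3)] .
  with l show ?thesis unfolding f.bilinear_on_def f.linear_on_def by simp
qed

lemma bilinear_dd:
  assumes c: "(W, g) \<in> conf M" "p \<in> W" and x: "x \<in> Hor p"
  shows "symmetric_form.bilinear_on (tangent M p) (\<lambda>y z. g p (lift p (dd p y z)) x)"
proof -
  interpret f: symmetric_form "tangent M p" "g p" by (rule M.conf_form[OF c])
  note pp = M.conf_points[OF c]
  have l: "g p (lift p (dd p (a \<odot> y + b \<odot> z) w)) x = a * g p (lift p (dd p y w)) x + b * g p (lift p (dd p z w)) x"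
    if "w \<in> tangent M p" "y \<in> tangent M p" "z \<in> tangent M p" for w y z a b
    unfolding dd_linear[OF that(2,3,1)] hlift_linear[OF pp dd_tangent[OF that(2,1)] dd_tangent[OF that(3,1)]]
    by (rule f.linear_onD[OF f.linear_g1[OF H_tangent[OF x]] H_tangent[OF hlift_H[OF pp dd_tangent[OF that(2,1)]]]
      H_tangent[OF hlift_H[OF pp dd_tangent[OF that(3,1)]]]])
  have "g p (lift p (dd p w (a \<odot> y + b \<odot> z))) x = a * g p (lift p (dd p w y)) x + b * g p (lift p (dd p w z)) x"
    if "w \<in> tangent M p" "y \<in> tangent M p" "z \<in> tangent M p" for w y z a b
    using l[OF that, of a b]
    unfolding dd_sym[OF that(1) M.tangent_plus[OF M.tangent_scale[OF that(2)] M.tangent_scale[OF that(3)]]]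
      dd_sym[OF that(1,2)] dd_sym[OF that(1,3)] .
  with l show ?thesis unfolding f.bilinear_on_def f.linear_on_def by simp
qed

section \<open>The trace of the second fundamental form\<close>

lemma trace_eq_sum:
  assumes c: "(W, g) \<in> conf M" "p \<in> W" and e: "orthonormal_frame (atlas M) g p e"
  shows "trace_D_differential M N \<phi> g p = (\<Sum>i\<in>UNIV. dd p (e i) (e i))"
  unfolding trace_D_differential_def
proof (rule the_equality)
  interpret frame "tangent M p" "g p" e by (rule M.conf_frame[OF c e])
  show "\<forall>e'. orthonormal_frame (atlas M) g p e' \<longrightarrow> (\<Sum>i\<in>UNIV. dd p (e i) (e i)) = (\<Sum>i\<in>UNIV. dd p (e' i) (e' i))"
  proof (intro allI impI ext)
    fix e' f assume e': "orthonormal_frame (atlas M) g p e'"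
    interpret f': frame "tangent M p" "g p" e' by (rule M.conf_frame[OF c e'])
    have "1 * (\<Sum>i\<in>UNIV. dd p (e' i) (e' i) f) = (\<Sum>i\<in>UNIV. dd p (e i) (e i) f)"
    proof (rule trace_conformal[OF bilinear_dd_apply[OF c] f'.eT one_neq_zero])
      show "x = (\<Sum>i\<in>UNIV. (1 * g p x (e' i)) \<odot> e' i)" if "x \<in> tangent M p" for x
        unfolding mult_1 by (rule f'.expand[OF that])
      show "g p (e i) (e j) = (if i = j then 1 else 0)" for i j
        using e unfolding orthonormal_frame_def by simp
    qed
    then show "(\<Sum>i\<in>UNIV. dd p (e i) (e i)) f = (\<Sum>i\<in>UNIV. dd p (e' i) (e' i)) f"
      unfolding sum_fun_apply mult_1 by (rule HOL.sym)
  qed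
  show "w = (\<Sum>i\<in>UNIV. dd p (e i) (e i))"
    if "\<forall>e. orthonormal_frame (atlas M) g p e \<longrightarrow> w = (\<Sum>i\<in>UNIV. dd p (e i) (e i))" for w
    by (rule that[rule_format, OF e])
qed

lemma trace_flat_eq:
  assumes c: "(W, g) \<in> conf M" "p \<in> W" and e: "orthonormal_frame (atlas M) g p e" and x: "x \<in> Hor p"
  shows "trace_D_differential_flat M N \<phi> g p x = (\<Sum>i\<in>UNIV. g p (lift p (dd p (e i) (e i))) x)"
proof -
  interpret frame "tangent M p" "g p" e by (rule M.conf_frame[OF c e])
  note pp = M.conf_points[OF c]
  show ?thesis
    unfolding trace_D_differential_flat_def trace_eq_sum[OF c e] hlift_sum[OF pp finite dd_tangent[OF eT eT]]
    by (rule linear_on_sum1[OF linear_g1[OF H_tangent[OF x]]]) (rule H_tangent[OF hlift_H[OF pp dd_tangent[OF eT eT]]])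
qed

text \<open>Replacing \<open>g\<close> by \<open>b\<close> times \<open>g\<close> divides the trace
  by \<open>b\<close>, while lowering the index multiplies by \<open>b\<close>.\<close>

lemma trace_flat_conformal:
  assumes c: "(W, g) \<in> conf M" "p \<in> W" and c': "(W', g') \<in> conf M" "p \<in> W'" and x: "x \<in> Hor p"
    and g': "\<forall>x\<in>tangent M p. \<forall>y\<in>tangent M p. g' p x y = b * g p x y"
  shows "trace_D_differential_flat M N \<phi> g' p x = trace_D_differential_flat M N \<phi> g p x"
proof -
  note pp = M.conf_points[OF c]
  have b: "b \<noteq> 0" by (rule conformal_factor_nonzero[OF c(1) c'(1) c(2) c'(2) g'])
  obtain e where e: "orthonormal_frame (atlas M) g p e" using M.conf_frame_exists[OF c] .
  obtain e' where e': "orthonormal_frame (atlas M) g' p e'" using M.conf_frame_exists[OF c'] .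
  interpret frame "tangent M p" "g p" e by (rule M.conf_frame[OF c e])
  interpret f': frame "tangent M p" "g' p" e' by (rule M.conf_frame[OF c' e'])
  have "b * (\<Sum>i\<in>UNIV. g p (lift p (dd p (e' i) (e' i))) x) = (\<Sum>i\<in>UNIV. g p (lift p (dd p (e i) (e i))) x)"
  proof (rule trace_conformal[OF bilinear_dd[OF c x] f'.eT b])
    show "v = (\<Sum>i\<in>UNIV. (b * g p v (e' i)) \<odot> e' i)" if "v \<in> tangent M p" for v
      using f'.expand[OF that] unfolding g'[rule_format, OF that f'.eT] .
    show "g p (e i) (e j) = (if i = j then 1 else 0)" for i j
      using e unfolding orthonormal_frame_def by simp
  qed
  then show ?thesis
    unfolding trace_flat_eq[OF c e x] trace_flat_eq[OF c' e' x]
      g'[rule_format, OF H_tangent[OF hlift_H[OF pp dd_tangent[OF f'.eT f'.eT]]] H_tangent[OF x]]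
      sum_distrib_left[symmetric] .
qed

lemma trace_flat_linear:
  assumes c: "(W, g) \<in> conf M" "p \<in> W" and x: "x \<in> Hor p" and y: "y \<in> Hor p"
  shows "trace_D_differential_flat M N \<phi> g p (a \<odot> x + b \<odot> y) =
    a * trace_D_differential_flat M N \<phi> g p x + b * trace_D_differential_flat M N \<phi> g p y"
proof -
  note pp = M.conf_points[OF c]
  obtain e where e: "orthonormal_frame (atlas M) g p e" using M.conf_frame_exists[OF c] .
  interpret frame "tangent M p" "g p" e by (rule M.conf_frame[OF c e])
  have "trace_D_differential M N \<phi> g p \<in> tangent N (\<phi> p)"
    unfolding trace_eq_sum[OF c e] by (rule N.tangent_sum[OF phi_points[OF pp] dd_tangent[OF eT eT]])
  from linear_onD[OF linear_g2[OF H_tangent[OF hlift_H[OF pp this]]] H_tangent[OF x] H_tangent[OF y]]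
  show ?thesis unfolding trace_D_differential_flat_def .
qed

text \<open>The vertical contribution to the trace, formed with a frame \<open>e\<close> of the
  whole tangent space. By \<open>dd_vertical\<close> it is minus the vertical trace of
  \<open>g(D\<^sup>M\<^sub>U U, x)\<close>.\<close>

definition vertical_trace :: "('a, 'k) metric \<Rightarrow> 'a \<Rightarrow> ('m \<Rightarrow> ('a, 'k) tvec) \<Rightarrow> ('a, 'k) tvec \<Rightarrow> 'k" where
  "vertical_trace g p e x = (\<Sum>i\<in>UNIV. g p (lift p (dd p (vp p (e i)) (vp p (e i)))) x)"

text \<open>The trace of a projection is the dimension of its image. Lifts of the coordinate vectors
  of \<open>N\<close> form the basis for which \<open>trace_basis\<close> is used, with the identity
  matrix.\<close>

lemma trace_hpart:
  assumes c: "(W, g) \<in> conf M" "p \<in> W" and e: "orthonormal_frame (atlas M) g p e"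
  shows "(\<Sum>i\<in>UNIV. g p (hp p (e i)) (hp p (e i))) = of_nat CARD('n)"
proof -
  interpret frame_projection "tangent M p" "g p" e "Hor p" "hp p" by (rule H_projection[OF c e])
  note pp = M.conf_points[OF c]
  obtain S y where ch: "(S, y) \<in> atlas N" "\<phi> p \<in> S" using N.carrierE[OF phi_points[OF pp]] .
  let ?d = "\<lambda>j. coord_field (atlas N) (S, y) j (\<phi> p)"
  note dT = N.coord_field_tangent[OF ch]
  have ds: "d\<phi> p (\<Sum>j\<in>UNIV. a j \<odot> lift p (?d j)) = (\<Sum>j\<in>UNIV. a j \<odot> ?d j)" for a
  proof
    fix f
    show "d\<phi> p (\<Sum>j\<in>UNIV. a j \<odot> lift p (?d j)) f = (\<Sum>j\<in>UNIV. a j \<odot> ?d j) f"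
    proof (cases "smN (\<phi> p) f")
      case True
      have "d\<phi> p (\<Sum>j\<in>UNIV. a j \<odot> lift p (?d j)) f = (\<Sum>j\<in>UNIV. a j * d\<phi> p (lift p (?d j)) f)"
        using True by (simp add: differential_def sum_fun_apply tscale_apply)
      then show ?thesis unfolding diff_hlift[OF pp dT] sum_fun_apply tscale_apply .
    next
      case False
      then show ?thesis using N.tangent_nonsmooth[OF dT False]
        by (simp add: differential_def sum_fun_apply tscale_apply)
    qed
  qed
  have "(\<Sum>i\<in>UNIV. g p (hp p (e i)) (hp p (e i))) = (\<Sum>k\<in>(UNIV::'n set). if k = k then 1 else 0)"
  proof (rule trace_basis[where E = "\<lambda>k l. if k = l then 1 else 0", OF bilinear_g finite hlift_H[OF pp dT]])
    fix x assume x: "x \<in> Hor p"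
    have "x = (\<Sum>j\<in>UNIV. x (\<lambda>q. y (\<phi> q) $ j) \<odot> lift p (?d j))"
    proof (rule trans[OF hlift_eqI[OF x diff_eq_sum[OF H_tangent[OF x] ch], symmetric]], rule hlift_eqI)
      show "(\<Sum>j\<in>UNIV. x (\<lambda>q. y (\<phi> q) $ j) \<odot> lift p (?d j)) \<in> Hor p"
        by (rule tv.subspace_sum[OF H_subspace[OF pp] tv.subspace_scale[OF H_subspace[OF pp] hlift_H[OF pp dT]]])
    qed (rule ds)
    then show "\<exists>a. x = (\<Sum>j\<in>UNIV. a j \<odot> lift p (?d j))"
      by (intro exI[of _ "\<lambda>j. x (\<lambda>q. y (\<phi> q) $ j)"])
  next
    fix a assume "(\<Sum>j\<in>UNIV. a j \<odot> lift p (?d j)) = 0"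
    with ds[of a] have z: "(\<Sum>j\<in>UNIV. a j \<odot> ?d j) = 0" by (simp only: diff_0)
    show "\<forall>j\<in>UNIV. a j = 0"
    proof
      fix j
      have "(\<Sum>j\<in>UNIV. a j \<odot> ?d j) (\<lambda>q. y q $ j) = 0" unfolding z by (rule zero_fun_apply)
      then show "a j = 0"
        by (simp add: sum_fun_apply tscale_apply N.coord_field_coord[OF ch] if_distrib[of "\<lambda>t. _ * t"] cong: if_cong)
    qed
  next
    fix k w
    show "g p (lift p (?d k)) w = (\<Sum>l\<in>UNIV. (if k = l then 1 else 0) * g p (lift p (?d l)) w)"
      by (simp add: if_distrib[of "\<lambda>t. t * _"] cong: if_cong)
  qed
  then show ?thesis by simp
qed

text \<open>The length \<open>r\<close> of an orthogonal vertical basis is found by splitting the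
  trace of the identity, which gives m = n + r in the ground field and hence, in characteristic 0,
  for natural numbers. Thus the natural subtraction in the definition of the Bott form is
  exact.\<close>

lemma vertical_basis:
  assumes c: "(W, g) \<in> conf M" "p \<in> W"
  obtains u :: "nat \<Rightarrow> ('a, 'k) tvec" and r where "CARD('m) = CARD('n) + r"
    "\<And>i. i < r \<Longrightarrow> u i \<in> Ver p" "\<And>i j. i < r \<Longrightarrow> j < r \<Longrightarrow> i \<noteq> j \<Longrightarrow> g p (u i) (u j) = 0"
    "\<And>i. i < r \<Longrightarrow> g p (u i) (u i) \<noteq> 0"
    "\<And>x. x \<in> Ver p \<Longrightarrow> \<exists>c. x = (\<Sum>i<r. c i \<odot> u i)"
    "\<And>a. (\<Sum>i<r. a i \<odot> u i) = 0 \<Longrightarrow> \<forall>i<r. a i = 0"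
proof -
  obtain e where e: "orthonormal_frame (atlas M) g p e" using M.conf_frame_exists[OF c] .
  interpret h: frame_projection "tangent M p" "g p" e "Hor p" "hp p" by (rule H_projection[OF c e])
  interpret v: frame_projection "tangent M p" "g p" e "Ver p" "vp p" by (rule V_projection[OF c e])
  obtain r and u :: "nat \<Rightarrow> ('a, 'k) tvec" where u: "\<And>i. i < r \<Longrightarrow> u i \<in> Ver p"
    "\<And>i j. i < r \<Longrightarrow> j < r \<Longrightarrow> i \<noteq> j \<Longrightarrow> g p (u i) (u j) = 0"
    "\<And>i. i < r \<Longrightarrow> g p (u i) (u i) \<noteq> 0"
    "\<And>x. x \<in> Ver p \<Longrightarrow> \<exists>c. x = (\<Sum>i<r. c i \<odot> u i)"
    "\<And>a. (\<Sum>i<r. a i \<odot> u i) = 0 \<Longrightarrow> \<forall>i<r. a i = 0"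
    by (rule v.orthogonal_basis) (rule that; assumption)
  have "(\<Sum>i\<in>UNIV. g p (vp p (e i)) (vp p (e i))) = (\<Sum>k\<in>{..<r}. if k = k then 1 else 0)"
  proof (rule v.trace_basis[where E = "\<lambda>k l. if k = l then 1 else 0", OF h.bilinear_g finite_lessThan])
    show "u j \<in> Ver p" if "j \<in> {..<r}" for j using u(1) that by simp
    show "\<exists>c. x = (\<Sum>i<r. c i \<odot> u i)" if "x \<in> Ver p" for x by (rule u(4)[OF that])
    show "\<forall>j\<in>{..<r}. a j = 0" if "(\<Sum>i<r. a i \<odot> u i) = 0" for a using u(5)[OF that] by simp
    show "g p (u k) w = (\<Sum>l<r. (if k = l then 1 else 0) * g p (u l) w)" if "k \<in> {..<r}" for k w
      using that by (simp add: if_distrib[of "\<lambda>t. t * _"] cong: if_cong)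
  qed
  then have vr: "(\<Sum>i\<in>UNIV. g p (vp p (e i)) (vp p (e i))) = of_nat r" by simp
  have "(\<Sum>i\<in>UNIV. g p (e i) (e i)) = (\<Sum>i\<in>(UNIV::'m set). 1)"
    using e unfolding orthonormal_frame_def by simp
  then have "of_nat CARD('m) = (of_nat CARD('n) + of_nat r :: 'k)"
    using h.trace_split[OF h.bilinear_g] unfolding trace_hpart[OF c e] vpart_def[symmetric] vr by simp
  then have "CARD('m) = CARD('n) + r" unfolding of_nat_add[symmetric] of_nat_eq_iff .
  from that[OF this u] show ?thesis .
qed

lemma trace_formula:
  assumes c: "(W, g) \<in> conf M" "p \<in> W" and e: "orthonormal_frame (atlas M) g p e" and x: "x \<in> Hor p"
  shows "trace_D_differential_flat M N \<phi> g p x =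
    (of_nat CARD('n) - 2) * (\<alpha>M g p x - \<alpha>N g p x) + vertical_trace g p e x"
proof -
  interpret frame_projection "tangent M p" "g p" e "Hor p" "hp p" by (rule H_projection[OF c e])
  note pp = M.conf_points[OF c] and xT = H_tangent[OF x]
  define \<beta> where "\<beta> y = \<alpha>N g p y - \<alpha>M g p y" for y
  \<comment> \<open>Linearity of \<open>\<beta>\<close> is available on horizontal vectors; composed
    with the projection it holds on the tangent space, as \<open>contraction\<close>
    requires.\<close>
  have bl: "linear_on (\<lambda>y. \<beta> (hp p y))"
    unfolding linear_on_def
  proof (intro ballI allI)
    fix y z a b assume yz: "y \<in> tangent M p" "z \<in> tangent M p"
    note H = hpart_H[OF yz(1)] hpart_H[OF yz(2)]
    show "\<beta> (hp p (a \<odot> y + b \<odot> z)) = a * \<beta> (hp p y) + b * \<beta> (hp p z)"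
      unfolding \<beta>_def hpart_linear[OF yz] induced_linear[OF conformal_partial_HDM c H] induced_linear[OF conformal_partial_HDN c H]
      by (simp add: algebra_simps)
  qed
  \<comment> \<open>Conformality with the arguments (h, h, x) and (x, h, h), joined by the symmetry
    of \<open>dd\<close>. The iterated projection has the shape to which \<open>contraction\<close>
    applies.\<close>
  have "g p (lift p (dd p (hp p (e i)) (hp p (e i)))) x =
      2 * (g p x (e i) * \<beta> (hp p (hp p (e i)))) - \<beta> x * g p (hp p (e i)) (hp p (e i))" for i
  proof -
    let ?h = "hp p (e i)"
    note h = pB[OF eT, of i] and hT = pT[OF eT, of i]
    have "g p (lift p (dd p ?h ?h)) x + g p ?h (lift p (dd p ?h x)) = 2 * \<beta> ?h * g p ?h x"
      unfolding \<beta>_def by (rule dd_conformal[OF c h h x])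
    moreover have "g p (lift p (dd p x ?h)) ?h + g p ?h (lift p (dd p x ?h)) = 2 * \<beta> x * g p ?h ?h"
      unfolding \<beta>_def by (rule dd_conformal[OF c x h h])
    moreover have "g p (lift p (dd p x ?h)) ?h = g p ?h (lift p (dd p x ?h))"
      by (rule sym[OF H_tangent[OF hlift_H[OF pp dd_tangent[OF xT hT]]] hT])
    moreover have "dd p ?h x = dd p x ?h" by (rule dd_sym[OF hT xT])
    moreover have "g p ?h x = g p x (e i)"
      unfolding hpart_orth[OF c eT x] by (rule sym[OF eT xT])
    moreover have "hp p ?h = ?h" by (rule pid[OF h])
    ultimately show ?thesis by (simp add: algebra_simps)
  qed
  then have "(\<Sum>i\<in>UNIV. g p (lift p (dd p (hp p (e i)) (hp p (e i)))) x) =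
      2 * (\<Sum>i\<in>UNIV. g p x (e i) * \<beta> (hp p (hp p (e i)))) - \<beta> x * (\<Sum>i\<in>UNIV. g p (hp p (e i)) (hp p (e i)))"
    by (simp add: sum_subtractf sum_distrib_left)
  \<comment> \<open>The first sum contracts \<open>x\<close> with the projected frame, the second is
    the trace of the projection.\<close>
  also have "\<dots> = 2 * \<beta> x - \<beta> x * of_nat CARD('n)"
    unfolding contraction[OF bl x] trace_hpart[OF c e] pid[OF x] ..
  finally show ?thesis
    unfolding trace_flat_eq[OF c e x] trace_split[OF bilinear_dd[OF c x]] vertical_trace_def vpart_def \<beta>_def
    by (simp add: algebra_simps)
qed

text \<open>\<open>bott_on_L_power\<close> quantifies over families of which independence at
  \<open>p\<close> is assumed; comparing their length with that of a basis shows that they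
  span.\<close>

lemma vertical_frame_spans:
  assumes c: "(W, g) \<in> conf M" "p \<in> W" and r: "CARD('m) = CARD('n) + r"
    and U: "\<And>i. i < r \<Longrightarrow> u i \<in> Ver p" and ind: "\<And>a. (\<Sum>i<r. a i \<odot> u i) = 0 \<Longrightarrow> \<forall>i<r. a i = 0"
    and z: "z \<in> Ver p"
  obtains a where "z = (\<Sum>i<r. a i \<odot> u i)"
proof -
  obtain b :: "nat \<Rightarrow> ('a, 'k) tvec" and s where s: "CARD('m) = CARD('n) + s"
    and b: "\<And>x. x \<in> Ver p \<Longrightarrow> \<exists>c. x = (\<Sum>i<s. c i \<odot> b i)"
    by (rule vertical_basis[OF c]) (rule that; assumption)
  have rs: "s = r" using s r by simp
  have sp: "x \<in> tv.span (b ` {..<r})" if x: "x \<in> Ver p" for x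
  proof -
    obtain c where xc: "x = (\<Sum>i<r. c i \<odot> b i)" using b[OF x] unfolding rs by (elim exE)
    show ?thesis unfolding xc by (intro tv.span_sum tv.span_scale tv.span_base imageI)
  qed
  have "\<exists>a. z = (\<Sum>i<r. a i \<odot> u i)"
  proof (rule independent_family_spans[of "{..<r}" "{..<r}" u b z])
    show "u i \<in> tv.span (b ` {..<r})" if "i \<in> {..<r}" for i by (rule sp[OF U]) (use that in simp)
    show "\<forall>i\<in>{..<r}. a i = 0" if "(\<Sum>i<r. a i \<odot> u i) = 0" for a using ind[OF that] by simp
    show "z \<in> tv.span (b ` {..<r})" by (rule sp[OF z])
    show "\<exists>a. z = (\<Sum>i<r. a i \<odot> u i)" if "z = (\<Sum>i<r. c i \<odot> u i)" for c
      using that by (intro exI[of _ c])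
  qed simp_all
  then show ?thesis using that by (elim exE)
qed

text \<open>The form read off from horizontal fields by \<open>induced_on_L\<close> is the full Lee
  form of \<open>D\<^sup>M\<close>, so the identity may be applied to vertical fields.\<close>

lemma lee_form_horizontal:
  assumes c: "(W, g) \<in> conf M" "p \<in> W" and x: "x \<in> Hor p" and Y: "fieldM p Y" and Z: "fieldM p Z"
  shows "x (\<lambda>q. g q (Y q) (Z q)) =
    g p (conn M p x Y) (Z p) + g p (Y p) (conn M p x Z) - 2 * \<alpha>M g p x * g p (Y p) (Z p)"
proof -
  obtain a where a: "\<And>Y Z. fieldM p Y \<Longrightarrow> fieldM p Z \<Longrightarrow>
    x (\<lambda>q. g q (Y q) (Z q)) = g p (conn M p x Y) (Z p) + g p (Y p) (conn M p x Z) - 2 * a * g p (Y p) (Z p)"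
    by (rule M.lee_form[OF c H_tangent[OF x]]) (rule that; assumption)
  have "\<alpha>M g p x = a"
  proof (rule induced_unique[OF c])
    fix Y Z assume YZ: "hfield p Y" "hfield p Z"
    show "x (\<lambda>q. g q (Y q) (Z q)) = g p (HDM M N \<phi> p x Y) (Z p) + g p (Y p) (HDM M N \<phi> p x Z) - 2 * a * g p (Y p) (Z p)"
      unfolding HDM_metric[OF c x YZ] by (rule a[OF hfieldD(1)[OF YZ(1)] hfieldD(1)[OF YZ(2)]])
  qed
  then show ?thesis using a[OF Y Z] by (simp only:)
qed

text \<open>Differentiate the identity g(X, U) = 0 along \<open>u\<close>; the Lee term vanishes
  with g(X, U) itself, and \<open>dd_vertical\<close> identifies the rest.\<close>

lemma conn_vertical_horizontal:
  assumes c: "(W, g) \<in> conf M" "p \<in> W" and u: "u \<in> tangent M p" and X: "hfield p X" and U: "vfield p U"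
  shows "g p (conn M p u X) (U p) = g p (lift p (dd p u (U p))) (X p)"
proof -
  interpret f: symmetric_form "tangent M p" "g p" by (rule M.conf_form[OF c])
  note XF = hfieldD[OF X] and UF = vfieldD[OF U]
  obtain a where a: "\<And>Y Z. fieldM p Y \<Longrightarrow> fieldM p Z \<Longrightarrow>
    u (\<lambda>q. g q (Y q) (Z q)) = g p (conn M p u Y) (Z p) + g p (Y p) (conn M p u Z) - 2 * a * g p (Y p) (Z p)"
    by (rule M.lee_form[OF c u]) (rule that; assumption)
  have "\<forall>\<^sub>F q in nhds p. g q (X q) (U q) = 0"
    using M.conf_eventually[OF c] XF(2) UF(2) by eventually_elim (rule H_orth[OF c(1)])
  then have "u (\<lambda>q. g q (X q) (U q)) = u (\<lambda>q. 0)" by (rule M.tangent_cong[OF u])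
  then have "0 = g p (conn M p u X) (U p) + g p (X p) (conn M p u U)"
    unfolding a[OF XF(1) UF(1)] M.tangent_const[OF u] H_orth[OF c XF(3) UF(3)] by simp
  moreover have "g p (X p) (conn M p u U) = g p (conn M p u U) (X p)"
    by (rule f.sym[OF H_tangent[OF XF(3)] M.conn_tangent[OF u UF(1)]])
  ultimately show ?thesis unfolding dd_vertical[OF c u U XF(3)] by (simp add: eq_neg_iff_add_eq_0)
qed

text \<open>The stated value satisfies the defining equation of \<open>bott_on_L_power\<close> for
  every admissible choice of \<open>X\<close>, \<open>U\<close> and \<open>\<omega>\<close>.\<close>

lemma bott_gram_det:
  assumes c: "(W, g) \<in> conf M" "p \<in> W" and e: "orthonormal_frame (atlas M) g p e"
    and r: "CARD('m) = CARD('n) + r" and X: "hfield p X" and U: "\<And>i. i < r \<Longrightarrow> vfield p (U i)"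
    and ind: "\<And>a. (\<Sum>i<r. a i \<odot> U i p) = 0 \<Longrightarrow> \<forall>i<r. a i = 0"
    and \<omega>: "\<And>i. i < r \<Longrightarrow> bott M N \<phi> X (U i) p = (\<Sum>j<r. \<omega> i j \<odot> U j p)"
  shows "X p (gram_det g r U) + 2 * (of_nat r * \<alpha>M g p (X p) - vertical_trace g p e (X p)) * gram_det g r U p =
    2 * (\<Sum>i<r. \<omega> i i) * gram_det g r U p"
proof -
  interpret f: frame_projection "tangent M p" "g p" e "Ver p" "vp p" by (rule V_projection[OF c e])
  note XF = hfieldD[OF X] and pp = M.conf_points[OF c]
  note x = XF(3) and xT = H_tangent[OF XF(3)]
  have UF: "\<And>i. i < r \<Longrightarrow> fieldM p (U i)" "\<And>i. i < r \<Longrightarrow> U i p \<in> Ver p"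
    by (rule vfieldD(1)[OF U], assumption) (rule vfieldD(3)[OF U])
  have UT: "\<And>i. i < r \<Longrightarrow> U i p \<in> tangent M p" by (rule V_tangent[OF UF(2)])
  let ?q = "\<lambda>y z. g p (lift p (dd p y z)) (X p)"
  note bil = bilinear_dd[OF c x]
  \<comment> \<open>Row \<open>k\<close> of a matrix \<open>E\<close> is obtained by representing
    the linear form \<open>?q (U k p)\<close> by a vertical vector and expanding that vector in the
    frame. Its trace will be the vertical trace.\<close>
  have "\<exists>E. k < r \<longrightarrow> (\<forall>w\<in>Ver p. ?q (U k p) w = (\<Sum>j<r. E j * g p (U j p) w))" for k
  proof (cases "k < r")
    case True
    have "f.linear_on (?q (U k p))" using bil UT[OF True] unfolding f.bilinear_on_def by simp
    then obtain z where z: "z \<in> Ver p" "\<And>w. w \<in> Ver p \<Longrightarrow> ?q (U k p) w = g p z w"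
      by (rule f.represent) (rule that; assumption)
    obtain E where E: "z = (\<Sum>i<r. E i \<odot> U i p)"
      using vertical_frame_spans[OF c r UF(2) ind z(1)] .
    have "?q (U k p) w = (\<Sum>j<r. E j * g p (U j p) w)" if w: "w \<in> Ver p" for w
      unfolding z(2)[OF w] E by (rule f.linear_on_sum[OF f.linear_g1[OF V_tangent[OF w]]]) (rule UT, simp)
    then show ?thesis by (intro exI[of _ E] impI ballI)
  next
    case False
    then show ?thesis by simp
  qed
  then have "\<forall>k. \<exists>E. k < r \<longrightarrow> (\<forall>w\<in>Ver p. ?q (U k p) w = (\<Sum>j<r. E j * g p (U j p) w))" ..
  from choice[OF this] obtain E where E0: "\<forall>k. k < r \<longrightarrow> (\<forall>w\<in>Ver p. ?q (U k p) w = (\<Sum>j<r. E k j * g p (U j p) w))"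
    by (elim exE)
  have E: "?q (U k p) w = (\<Sum>j<r. E k j * g p (U j p) w)" if "k < r" "w \<in> Ver p" for k w
    by (rule E0[rule_format, OF that])
  have trE: "vertical_trace g p e (X p) = (\<Sum>k<r. E k k)"
    unfolding vertical_trace_def
  proof (rule f.trace_basis[where E = E and b = "\<lambda>j. U j p", OF bil finite_lessThan])
    show "U j p \<in> Ver p" if "j \<in> {..<r}" for j using UF(2) that by simp
    show "\<exists>c. z = (\<Sum>i<r. c i \<odot> U i p)" if z: "z \<in> Ver p" for z
    proof -
      obtain a where "z = (\<Sum>i<r. a i \<odot> U i p)" using vertical_frame_spans[OF c r UF(2) ind z] .
      then show ?thesis by (intro exI[of _ a])
    qed
    show "\<forall>j\<in>{..<r}. a j = 0" if "(\<Sum>i<r. a i \<odot> U i p) = 0" for a using ind[OF that] by simp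
    show "?q (U k p) w = (\<Sum>j<r. E k j * g p (U j p) w)" if "k \<in> {..<r}" "w \<in> Ver p" for k w
      by (rule E) (use that in simp_all)
  qed
  have key: "g p (conn M p (X p) (U k)) (U l p) = (\<Sum>j<r. \<omega> k j * g p (U j p) (U l p)) + (\<Sum>j<r. E k j * g p (U j p) (U l p))"
    if k: "k < r" and l: "l < r" for k l
  proof -
    let ?b = "lie_bracket (atlas M) X (U k) p" and ?D = "conn M p (U k p) X"
    note bT = M.lie_bracket_tangent[OF XF(1) UF(1)[OF k]] and DT = M.conn_tangent[OF UT[OF k] XF(1)]
    have "conn M p (X p) (U k) = ?b + ?D"
      using M.torsion[OF XF(1) UF(1)[OF k]] by (simp only: diff_eq_eq)
    then have "g p (conn M p (X p) (U k)) (U l p) = g p ?b (U l p) + g p ?D (U l p)"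
      using f.linear_on_add[OF f.linear_g1[OF UT[OF l]] bT DT] by (simp only:)
    \<comment> \<open>Against a vertical vector only the vertical part of the bracket counts, and
      this is the Bott derivative.\<close>
    also have "g p ?b (U l p) = g p (vp p ?b) (U l p)"
      unfolding f.psym[OF bT UT[OF l]] f.pid[OF UF(2)[OF l]] ..
    also have "vp p ?b = (\<Sum>j<r. \<omega> k j \<odot> U j p)" using \<omega>[OF k] unfolding bott_def .
    also have "g p (\<Sum>j<r. \<omega> k j \<odot> U j p) (U l p) = (\<Sum>j<r. \<omega> k j * g p (U j p) (U l p))"
      by (rule f.linear_on_sum[OF f.linear_g1[OF UT[OF l]]]) (rule UT, simp)
    also have "g p ?D (U l p) = ?q (U k p) (U l p)"
      by (rule conn_vertical_horizontal[OF c UT[OF k] X U[OF l]])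
    also have "\<dots> = (\<Sum>j<r. E k j * g p (U j p) (U l p))" by (rule E[OF k UF(2)[OF l]])
    finally show ?thesis .
  qed
  let ?\<alpha> = "\<alpha>M g p (X p)"
  \<comment> \<open>\<open>\<omega>\<close> comes from the bracket and \<open>E\<close> from the
    derivative of \<open>X\<close> in vertical directions. The Lee term carries the factor 2, so one
    copy of \<open>?\<alpha>\<close> goes to each of the two symmetric summands.\<close>
  let ?C = "\<lambda>k j. \<omega> k j + E k j - (if j = k then ?\<alpha> else 0)"
  have Csum: "(\<Sum>j<r. ?C k j * g p (U j p) (U l p)) = (\<Sum>j<r. \<omega> k j * g p (U j p) (U l p)) +
      (\<Sum>j<r. E k j * g p (U j p) (U l p)) - ?\<alpha> * g p (U k p) (U l p)" if "k < r" for k l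
    using that by (simp add: left_diff_distrib distrib_right sum.distrib sum_subtractf if_distrib[of "\<lambda>t. t * _"] cong: if_cong)
  have "X p (gram_det g r U) = 2 * (\<Sum>k<r. ?C k k) * gram_det g r U p"
  proof (rule M.tangent_gram_det[where C = ?C, OF xT])
    fix k l assume kl: "k < r" "l < r"
    show "smM p (\<lambda>q. g q (U k q) (U l q))" by (rule M.metric_smooth[OF c UF(1)[OF kl(1)] UF(1)[OF kl(2)]])
    show s: "g p (U k p) (U l p) = g p (U l p) (U k p)" by (rule f.sym[OF UT[OF kl(1)] UT[OF kl(2)]])
    have "g p (U k p) (conn M p (X p) (U l)) = g p (conn M p (X p) (U l)) (U k p)"
      by (rule f.sym[OF UT[OF kl(1)] M.conn_tangent[OF xT UF(1)[OF kl(2)]]])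
    then show "X p (\<lambda>q. g q (U k q) (U l q)) =
      (\<Sum>j<r. ?C k j * g p (U j p) (U l p)) + (\<Sum>j<r. ?C l j * g p (U j p) (U k p))"
      unfolding lee_form_horizontal[OF c x UF(1)[OF kl(1)] UF(1)[OF kl(2)]] Csum[OF kl(1)] Csum[OF kl(2)]
        key[OF kl(2,1)] key[OF kl] s by simp
  qed
  moreover have "(\<Sum>k<r. ?C k k) = (\<Sum>i<r. \<omega> i i) + vertical_trace g p e (X p) - of_nat r * ?\<alpha>"
    unfolding trE by (simp add: sum.distrib sum_subtractf)
  ultimately have G: "X p (gram_det g r U) =
      2 * ((\<Sum>i<r. \<omega> i i) + vertical_trace g p e (X p) - of_nat r * ?\<alpha>) * gram_det g r U p" by (simp only:)
  show ?thesis unfolding G by (simp add: algebra_simps)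
qed

lemma bott_value:
  assumes c: "(W, g) \<in> conf M" "p \<in> W" and e: "orthonormal_frame (atlas M) g p e"
    and r: "CARD('m) = CARD('n) + r" and x: "x \<in> Hor p"
  shows "bott_on_L_power M N \<phi> g p x = of_nat r * \<alpha>M g p x - vertical_trace g p e x"
proof -
  have r': "CARD('m) - CARD('n) = r" using r by simp
  let ?b = "of_nat r * \<alpha>M g p x - vertical_trace g p e x"
  show ?thesis
    unfolding bott_on_L_power_def Let_def r'
  proof (rule the_equality)
    show "\<forall>X U \<omega>. hfield p X \<and> X p = x \<and> (\<forall>i<r. vfield p (U i)) \<and>
       (\<forall>a. (\<Sum>i<r. a i \<odot> U i p) = 0 \<longrightarrow> (\<forall>i<r. a i = 0)) \<and>
       (\<forall>i<r. bott M N \<phi> X (U i) p = (\<Sum>j<r. \<omega> i j \<odot> U j p)) \<longrightarrow>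
       x (gram_det g r U) + 2 * ?b * gram_det g r U p = 2 * (\<Sum>i<r. \<omega> i i) * gram_det g r U p"
    proof (intro allI impI, elim conjE)
      fix X U \<omega>
      assume h: "hfield p X" "X p = x" "\<forall>i<r. vfield p (U i)"
        "\<forall>a. (\<Sum>i<r. a i \<odot> U i p) = 0 \<longrightarrow> (\<forall>i<r. a i = 0)"
        "\<forall>i<r. bott M N \<phi> X (U i) p = (\<Sum>j<r. \<omega> i j \<odot> U j p)"
      from bott_gram_det[OF c e r h(1) h(3)[rule_format] h(4)[THEN spec, THEN mp] h(5)[rule_format]]
      show "x (gram_det g r U) + 2 * ?b * gram_det g r U p = 2 * (\<Sum>i<r. \<omega> i i) * gram_det g r U p"
        unfolding h(2) .
    qed
    fix b assume b: "\<forall>X U \<omega>. hfield p X \<and> X p = x \<and> (\<forall>i<r. vfield p (U i)) \<and>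
       (\<forall>a. (\<Sum>i<r. a i \<odot> U i p) = 0 \<longrightarrow> (\<forall>i<r. a i = 0)) \<and>
       (\<forall>i<r. bott M N \<phi> X (U i) p = (\<Sum>j<r. \<omega> i j \<odot> U j p)) \<longrightarrow>
       x (gram_det g r U) + 2 * b * gram_det g r U p = 2 * (\<Sum>i<r. \<omega> i i) * gram_det g r U p"
    \<comment> \<open>For uniqueness one admissible frame with nonvanishing Gram determinant
      suffices; it extends an orthogonal basis of the vertical space at \<open>p\<close>.\<close>
    obtain u :: "nat \<Rightarrow> ('a, 'k) tvec" and s where s: "CARD('m) = CARD('n) + s"
      and u0: "\<And>i. i < s \<Longrightarrow> u i \<in> Ver p" "\<And>i j. i < s \<Longrightarrow> j < s \<Longrightarrow> i \<noteq> j \<Longrightarrow> g p (u i) (u j) = 0"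
      "\<And>i. i < s \<Longrightarrow> g p (u i) (u i) \<noteq> 0"
      "\<And>x. x \<in> Ver p \<Longrightarrow> \<exists>c. x = (\<Sum>i<s. c i \<odot> u i)"
      "\<And>a. (\<Sum>i<s. a i \<odot> u i) = 0 \<Longrightarrow> \<forall>i<s. a i = 0"
      by (rule vertical_basis[OF c]) (rule that; assumption)
    have "s = r" using s r by simp
    note u = u0[unfolded this]
    have "\<exists>U. i < r \<longrightarrow> vfield p U \<and> U p = u i" for i
    proof (cases "i < r")
      case True
      obtain U where "vfield p U" "U p = u i" using vfield_extension[OF u(1)[OF True]] .
      then show ?thesis by (intro exI[of _ U] impI conjI)
    qed simp
    then have "\<forall>i. \<exists>U. i < r \<longrightarrow> vfield p U \<and> U p = u i" ..
    from choice[OF this] obtain U where U0: "\<forall>i. i < r \<longrightarrow> vfield p (U i) \<and> U i p = u i" by (elim exE)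
    have U: "vfield p (U i)" "U i p = u i" if "i < r" for i
      by (rule conjunct1[OF U0[rule_format, OF that]], rule conjunct2[OF U0[rule_format, OF that]])
    have sU: "(\<Sum>i<r. a i \<odot> U i p) = (\<Sum>i<r. a i \<odot> u i)" for a
      by (rule sum.cong[OF refl]) (simp only: U(2) lessThan_iff)
    obtain X where X: "hfield p X" "X p = x" using hfield_extension[OF x] .
    interpret f: frame_projection "tangent M p" "g p" e "Ver p" "vp p" by (rule V_projection[OF c e])
    have "\<exists>w. i < r \<longrightarrow> bott M N \<phi> X (U i) p = (\<Sum>j<r. w j \<odot> U j p)" for i
    proof (cases "i < r")
      case True
      have "bott M N \<phi> X (U i) p \<in> Ver p" unfolding bott_def
        by (rule f.pB[OF M.lie_bracket_tangent[OF hfieldD(1)[OF X(1)] vfieldD(1)[OF U(1)[OF True]]]])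
      from u(4)[OF this] obtain w where "bott M N \<phi> X (U i) p = (\<Sum>j<r. w j \<odot> u j)" by (elim exE)
      then show ?thesis unfolding sU[symmetric] by (intro exI[of _ w] impI)
    qed simp
    then have "\<forall>i. \<exists>w. i < r \<longrightarrow> bott M N \<phi> X (U i) p = (\<Sum>j<r. w j \<odot> U j p)" ..
    from choice[OF this] obtain \<omega> where \<omega>: "\<forall>i. i < r \<longrightarrow> bott M N \<phi> X (U i) p = (\<Sum>j<r. \<omega> i j \<odot> U j p)" by (elim exE)
    have ind: "\<forall>i<r. a i = 0" if "(\<Sum>i<r. a i \<odot> U i p) = 0" for a by (rule u(5)) (use that in \<open>simp only: sU\<close>)
    have "gram_det g r U p = (\<Prod>i<r. g p (U i p) (U i p))"
      by (rule gram_det_orthogonal) (simp only: U(2) u(2) not_False_eq_True)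
    also have "\<dots> \<noteq> 0" unfolding prod_zero_iff[OF finite_lessThan] using U(2) u(3) by simp
    finally have nz: "gram_det g r U p \<noteq> 0" .
    have U1: "\<forall>i<r. vfield p (U i)" by (intro allI impI) (rule U(1))
    have ind1: "\<forall>a. (\<Sum>i<r. a i \<odot> U i p) = 0 \<longrightarrow> (\<forall>i<r. a i = 0)" by (rule allI, rule impI, rule ind)
    have 1: "x (gram_det g r U) + 2 * b * gram_det g r U p = 2 * (\<Sum>i<r. \<omega> i i) * gram_det g r U p"
      by (rule b[THEN spec, THEN spec, THEN spec, THEN mp, OF conjI[OF X(1) conjI[OF X(2) conjI[OF U1 conjI[OF ind1 \<omega>]]]]])
    have 2: "x (gram_det g r U) + 2 * ?b * gram_det g r U p = 2 * (\<Sum>i<r. \<omega> i i) * gram_det g r U p"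
      using bott_gram_det[OF c e r X(1) U(1) ind \<omega>[rule_format]] unfolding X(2) .
    have "2 * b * gram_det g r U p = 2 * ?b * gram_det g r U p"
      by (rule add_left_imp_eq[OF trans[OF 1 2[symmetric]]])
    then have "(2 * gram_det g r U p) * b = (2 * gram_det g r U p) * ?b" by (simp only: mult_ac)
    moreover have "2 * gram_det g r U p \<noteq> 0" using nz by simp
    ultimately show "b = ?b" by (simp only: mult_cancel_left if_False simp_thms)
  qed
qed

text \<open>Multiplication by m - n undoes the division in \<open>bott_on_L\<close> when m > n. In
  the case m = n division by 0 gives 0, and the right side vanishes as well.\<close>

lemma bott_form:
  assumes c: "(W, g) \<in> conf M" "p \<in> W" and e: "orthonormal_frame (atlas M) g p e" and x: "x \<in> Hor p"
  shows "of_int (int CARD('m) - int CARD('n)) * bott_on_L M N \<phi> g p x =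
    (of_nat CARD('m) - of_nat CARD('n)) * \<alpha>M g p x - vertical_trace g p e x"
proof -
  obtain u :: "nat \<Rightarrow> ('a, 'k) tvec" and r where r: "CARD('m) = CARD('n) + r"
    and u: "\<And>x. x \<in> Ver p \<Longrightarrow> \<exists>c. x = (\<Sum>i<r. c i \<odot> u i)"
    by (rule vertical_basis[OF c]) (rule that; assumption)
  have "of_nat r * (bott_on_L_power M N \<phi> g p x / of_nat r) = of_nat r * \<alpha>M g p x - vertical_trace g p e x"
  proof (cases "r = 0")
    case False
    then show ?thesis by (simp add: bott_value[OF c e r x])
  next
    \<comment> \<open>Here the vertical space is 0, so all vertical parts of the frame vanish and so
      does the vertical trace.\<close>
    case True
    interpret f: frame_projection "tangent M p" "g p" e "Ver p" "vp p" by (rule V_projection[OF c e])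
    have v0: "vp p (e i) = 0" for i
      using u[OF f.pB[OF f.eT, of i]] unfolding True lessThan_0 sum.empty by (rule exE)
    have "f.linear_on (\<lambda>z. g p (lift p (dd p z 0)) x)"
      using bilinear_dd[OF c x] M.tangent_0[OF M.conf_points[OF c]] unfolding f.bilinear_on_def by simp
    from f.linear_on_0[OF this] have "vertical_trace g p e x = 0"
      unfolding vertical_trace_def v0 by simp
    with True show ?thesis by simp
  qed
  moreover have "CARD('m) - CARD('n) = r" "int CARD('m) - int CARD('n) = int r"
    "(of_nat CARD('m) :: 'k) - of_nat CARD('n) = of_nat r" using r by simp_all
  ultimately show ?thesis unfolding bott_on_L_def by simp
qed

end

lemma conn_tensor_apply: "(A \<otimes>\<^sub>L B) g p x = A g p x + B g p x"
  by (simp add: conn_tensor_def)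

lemma conn_power_apply: "(A ^\<^sub>L k) g p x = of_int k * A g p x"
  by (simp add: conn_power_def)

theorem proposition2p2:
  fixes cat :: category
    and M :: "('a::{t2_space,second_countable_topology}, 'k::real_or_complex, 'm::finite) weyl"
    and N :: "('b::{t2_space,second_countable_topology}, 'k, 'n::finite) weyl"
    and \<phi> :: "'a \<Rightarrow> 'b"
  assumes "weyl_space cat M"
    and "weyl_space cat N"
    and "submersion cat M N \<phi>"
    and "nowhere_degenerate_fibres M N \<phi>"
    and "horizontally_conformal cat M N \<phi>"
  shows "let m = int CARD('m); n = int CARD('n);
             A = induced_on_L M N \<phi> (HDM M N \<phi>) ^\<^sub>L (m - 2) \<otimes>\<^sub>L
                 induced_on_L M N \<phi> (HDN M N \<phi>) ^\<^sub>L (- (n - 2));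
             B = bott_on_L M N \<phi> ^\<^sub>L (m - n)
         in connection_forms_on_L_power (m - n) M N \<phi> A \<and>
            connection_forms_on_L_power (m - n) M N \<phi> B \<and>
            (\<forall>(W, g)\<in>conf M. \<forall>p\<in>W. \<forall>x\<in>horizontal M N \<phi> p.
               trace_D_differential_flat M N \<phi> g p x = A g p x - B g p x)"
proof -
  interpret weyl_submersion cat M N \<phi> by (rule weyl_submersion.intro) (fact assms)+
  let ?m = "int CARD('m)" and ?n = "int CARD('n)"
  let ?A = "\<alpha>M ^\<^sub>L (?m - 2) \<otimes>\<^sub>L \<alpha>N ^\<^sub>L (- (?n - 2))" and ?B = "bott_on_L M N \<phi> ^\<^sub>L (?m - ?n)"
  have A: "?A g p x = (of_nat CARD('m) - 2) * \<alpha>M g p x - (of_nat CARD('n) - 2) * \<alpha>N g p x" for g p x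
    unfolding conn_tensor_apply conn_power_apply by (simp add: algebra_simps)
  \<comment> \<open>The multiples of \<open>\<alpha>M\<close> combine as (m - 2) - (m - n) = n - 2,
    the coefficient in \<open>trace_formula\<close>; the two minus signs before the vertical trace
    cancel.\<close>
  have AB: "trace_D_differential_flat M N \<phi> g p x = ?A g p x - ?B g p x"
    if c: "(W, g) \<in> conf M" "p \<in> W" and x: "x \<in> Hor p" for W g p x
  proof -
    obtain e where e: "orthonormal_frame (atlas M) g p e" using M.conf_frame_exists[OF c] .
    show ?thesis
      unfolding A trace_formula[OF c e x] conn_power_apply bott_form[OF c e x] by (simp add: algebra_simps)
  qed
  have Alin: "?A g p (a \<odot> x + b \<odot> y) = a * ?A g p x + b * ?A g p y"
    if c: "(W, g) \<in> conf M" "p \<in> W" and x: "x \<in> Hor p" and y: "y \<in> Hor p" for W g p x y a b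
    unfolding A induced_linear[OF conformal_partial_HDM c x y] induced_linear[OF conformal_partial_HDN c x y]
    by (simp add: algebra_simps)
  \<comment> \<open>Both induced forms change by the same term, and the weights m - 2 and -(n - 2)
    add up to m - n.\<close>
  have Atr: "?A g' p x = ?A g p x - of_int (?m - ?n) / 2 * (x \<mu> / \<mu> p)"
    if c: "(W, g) \<in> conf M" "p \<in> W" "(W', g') \<in> conf M" "p \<in> W'" "smM p \<mu>"
      "\<forall>\<^sub>F q in nhds p. \<forall>x\<in>tangent M q. \<forall>y\<in>tangent M q. g' q x y = \<mu> q * g q x y" "x \<in> Hor p"
    for W g W' g' p x \<mu>
  proof -
    have t: "x \<mu> / (2 * \<mu> p) = (x \<mu> / \<mu> p) / 2" by simp
    show ?thesis
      unfolding A induced_conformal[OF conformal_partial_HDM c(1-4,7,5,6)]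
        induced_conformal[OF conformal_partial_HDN c(1-4,7,5,6)] t
      by (simp add: algebra_simps diff_divide_distrib)
  qed
  have B: "?B g p x = ?A g p x - trace_D_differential_flat M N \<phi> g p x"
    if "(W, g) \<in> conf M" "p \<in> W" "x \<in> Hor p" for W g p x
    using AB[OF that] by simp
  have "connection_forms_on_L_power (?m - ?n) M N \<phi> ?A"
    by (rule connection_formsI[OF Alin Atr])
  moreover have "connection_forms_on_L_power (?m - ?n) M N \<phi> ?B"
  proof (rule connection_formsI)
    fix W g p x y a b assume c: "(W, g) \<in> conf M" "p \<in> W" and x: "x \<in> Hor p" and y: "y \<in> Hor p"
    have s: "a \<odot> x + b \<odot> y \<in> Hor p"
      by (intro tv.subspace_add[OF H_subspace[OF M.conf_points[OF c]]] tv.subspace_scale[OF H_subspace[OF M.conf_points[OF c]]] x y)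
    show "?B g p (a \<odot> x + b \<odot> y) = a * ?B g p x + b * ?B g p y"
      unfolding B[OF c s] B[OF c x] B[OF c y] Alin[OF c x y] trace_flat_linear[OF c x y] by (simp add: algebra_simps)
  next
    fix W g W' g' p x \<mu>
    assume c: "(W, g) \<in> conf M" "p \<in> W" "(W', g') \<in> conf M" "p \<in> W'" "smM p \<mu>"
      "\<forall>\<^sub>F q in nhds p. \<forall>x\<in>tangent M q. \<forall>y\<in>tangent M q. g' q x y = \<mu> q * g q x y" "x \<in> Hor p"
    show "?B g' p x = ?B g p x - of_int (?m - ?n) / 2 * (x \<mu> / \<mu> p)"
      unfolding B[OF c(1,2,7)] B[OF c(3,4,7)] Atr[OF c]
        trace_flat_conformal[OF c(1-4,7) eventually_nhds_x_imp_x[OF c(6)]] by simp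
  qed
  moreover have "\<forall>(W, g)\<in>conf M. \<forall>p\<in>W. \<forall>x\<in>Hor p. trace_D_differential_flat M N \<phi> g p x = ?A g p x - ?B g p x"
  proof (rule ballI)
    fix c assume c: "c \<in> conf M"
    obtain W g where "c = (W, g)" by (cases c)
    with c show "case c of (W, g) \<Rightarrow> \<forall>p\<in>W. \<forall>x\<in>Hor p. trace_D_differential_flat M N \<phi> g p x = ?A g p x - ?B g p x"
      by (simp only: prod.case) (intro ballI AB)
  qed
  ultimately show ?thesis unfolding Let_def by (intro conjI)
qed

end
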